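(* Let $(K,R)$ be a finite-dimensional ribbon Hopf algebra over $\mathbb F$, let $\Gamma$ be a ciliated ribbon graph and $v$ a vertex of $\Gamma$ with $n$ incident edge ends, numbered $1<2<\dots<n$ by the linear order at $v$. Define $\tau:\{1,\dots,n\}\to\{0,1\}$ by $\tau(i)=0$ if the $i$th edge end is incoming at $v$ and $\tau(i)=1$ if it is outgoing, and let $\sigma:\{1,\dots,n\}\to\{0,1\}$ be an arbitrary map. Then the multiplication on $K^{*\otimes n}$ with unit $1^{\otimes n}$ determined by $\alpha^1\otimes\cdots\otimes\alpha^n=(\alpha^1)_1\cdots(\alpha^n)_n$ and $$(\alpha)_i\cdot(\beta)_i=\begin{cases}\langle\beta_{(1)}\otimes\alpha_{(1)},R\rangle\,(\beta_{(2)}\alpha_{(2)})_i&\sigma(i)=\tau(i)=0\\ \langle\beta_{(2)}\otimes\alpha_{(2)},R\rangle\,(\alpha_{(1)}\beta_{(1)})_i&\sigma(i)=0,\ \tau(i)=1\\ (\alpha\beta)_i&\sigma(i)=1,\ \tau(i)=0\\ (\beta\alpha)_i&\sigma(i)=\tau(i)=1,\end{cases}$$ $$(\alpha)_i\cdot(\beta)_j=\begin{cases}(\alpha\otimes\beta)_{ij}&i<j\\ \langle\beta_{(1+\tau(j))}\otimes\alpha_{(1+\tau(i))},(S^{\tau(j)}\otimes S^{\tau(i)})(R)\rangle\,(\alpha_{(2-\tau(i))}\otimes\beta_{(2-\tau(j))})_{ij}&i>j\end{cases}$$ for $\alpha,\beta,\alpha^i\in K^*$, together with the linear map $\lhd^*:K^{*\otimes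 n}\otimes K\to K^{*\otimes n}$, $$(\alpha^1\otimes\cdots\otimes\alpha^n)\lhd^*h=\langle S^{\tau(1)}(\alpha^1_{(1+\tau(1))})\cdots S^{\tau(n)}(\alpha^n_{(1+\tau(n))}),h\rangle\;\alpha^1_{(2-\tau(1))}\otimes\cdots\otimes\alpha^n_{(2-\tau(n))},$$ define a $K$-valued Hopf algebra gauge theory on the vertex neighbourhood $\Gamma_v$.
   Context: $\mathbb F$ is a field of characteristic zero; Sweedler notation without summation signs is used. $\langle\,,\rangle$ is the pairing of $K^*$ with $K$, extended to tensor powers. An $R$-matrix of $K$ is an invertible $R=R_{(1)}\otimes R_{(2)}\in K\otimes K$ with $R\,\Delta(h)=\Delta^{op}(h)\,R$, $(\Delta\otimes\mathrm{id})(R)=R_{13}R_{23}$, $(\mathrm{id}\otimes\Delta)(R)=R_{13}R_{12}$. With $u=S(R_{(2)})R_{(1)}$, $(K,R)$ is ribbon if there is a central invertible $\nu\in K$ with $uS(u)=\nu^2$, $\epsilon(\nu)=1$, $S(\nu)=\nu$, $\Delta(\nu)=R^{-1}R_{21}^{-1}(\nu\otimes\nu)$. $(v^1\otimes\cdots\otimes v^k)_{i_1\ldots i_k}$ denotes the element of a tensor power with $v^j$ in the $i_j$th factor and $1$ in all others; $\pi_i$ denotes projection to the $i$th factor, applying the counit to all others; $\iota_i(\alpha)=(\alpha)_i$, $\iota_{ij}(\alpha\otimes\beta)=(\alpha\otimes\beta)_{ij}$. A ciliated ribbon graph is a finite directed graph (loops and multiple edges allowed) with a linear order of the incident edge ends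 at each vertex. Each edge $e$ has a starting end $s(e)$ at its starting vertex (outgoing there) and a target end $t(e)$ at its target vertex (incoming there). The vertex neighbourhood $\Gamma_v$ consists of $v$, all edge ends at $v$ (with their orientation and order), and a univalent vertex at the free end of each edge end. A $K$-valued Hopf algebra gauge theory on $\Gamma_v$, with gauge transformations assigned only to $v$, consists of: the vector space $K^{\otimes n}$ of connections (one factor for each edge end at $v$) and the Hopf algebra $K$ of gauge transformations; an associative algebra structure on $K^{*\otimes n}$ with unit $1^{\otimes n}$ such that $(\alpha)_i\cdot(\beta)_i\in\iota_i(K^* )$ and $(\alpha)_i\cdot(\beta)_j\in\iota_{ij}(K^*\otimes K^* )$ for all $i\ne j$, $\alpha,\beta\in K^*$; and a $K$-left module structure $\rhd$ on $K^{\otimes n}$ whose dual $K$-right module structure $\lhd^*$ on $K^{*\otimes n}$ (defined by $\langle\alpha\lhd^*h,k\rangle=\langle\alpha,h\rhd k\rangle$) makes $K^{*\otimes n}$ a $K$-right module algebra (i.e. $(ab)\lhd^*h=(a\lhd^*h_{(1)})(b\lhd^*h_{(2)})$ and $1\lhd^*h=\epsilon(h)1$), such that $\pi_i(h\rhd(k)_i)=hk$ if the $i$th end is incoming at $v$ and $\pi_i(h\rhd(k)_i)=kS(h)$ if it is outgoing. *)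

theory Defs
  imports "HOL-Library.FuncSet" "Graph_Theory.Digraph"
begin

section \<open>Hopf algebra data and tensor powers\<close>

text \<open>
  The unital ring underlying the Hopf algebra is the type \<open>'k\<close> itself; the record holds
  the remaining structure over the field \<open>'f\<close>.
  An \<open>n\<close>-tuple is a function on \<open>nat\<close> of which only the values at \<open>1, \<dots>, n\<close> matter.
  Since multilinear forms separate tensors over a field, the tensor power \<open>K\<^sup>\<otimes>\<^sup>n\<close> is
  realised in the dual of the space of \<open>n\<close>-linear forms on \<open>K\<close>: the tensor
  \<open>k\<^sub>1 \<otimes> \<dots> \<otimes> k\<^sub>n\<close> is the evaluation at \<open>(k\<^sub>1, \<dots>, k\<^sub>n)\<close>. Hence, if \<open>x\<close> is a tensor and
  \<open>\<Phi>\<close> is an \<open>n\<close>-linear form, then \<open>x \<Phi>\<close> stands for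
  \<open>\<Phi>(x\<^sub>(\<^sub>1\<^sub>), \<dots>, x\<^sub>(\<^sub>n\<^sub>))\<close> in Sweedler notation.
  The elements of \<open>K\<^sup>*\<^sup>\<otimes>\<^sup>n\<close> are the sums of the \<open>n\<close>-linear forms
  \<open>\<alpha>\<^sub>1 \<otimes> \<dots> \<otimes> \<alpha>\<^sub>n = (\<lambda>k. \<alpha>\<^sub>1(k\<^sub>1) \<cdots> \<alpha>\<^sub>n(k\<^sub>n))\<close>.
\<close>

type_synonym ('f, 'k) dtens = "(nat \<Rightarrow> 'k) \<Rightarrow> 'f"
type_synonym ('f, 'k) tens = "((nat \<Rightarrow> 'k) \<Rightarrow> 'f) \<Rightarrow> 'f"

record ('f, 'k) hopf =
  scl :: "'f \<Rightarrow> 'k \<Rightarrow> 'k"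
  cop :: "'k \<Rightarrow> ('f, 'k) tens"
  counit :: "'k \<Rightarrow> 'f"
  antipode :: "'k \<Rightarrow> 'k"

definition tup :: "'a list \<Rightarrow> nat \<Rightarrow> 'a" where
  "tup xs i = xs ! (i - 1)"

definition dual :: "('f::field, 'k::ring_1) hopf \<Rightarrow> ('k \<Rightarrow> 'f) set" where
  "dual H = {\<alpha>. Vector_Spaces.linear (scl H) (*) \<alpha>}"

definition mforms :: "('f::field, 'k::ring_1) hopf \<Rightarrow> nat \<Rightarrow> ('f, 'k) dtens set" where
  "mforms H n = {\<Phi>.
     (\<forall>k k'. (\<forall>i\<in>{1..n}. k i = k' i) \<longrightarrow> \<Phi> k = \<Phi> k') \<and>
     (\<forall>k. \<forall>i\<in>{1..n}. Vector_Spaces.linear (scl H) (*) (\<lambda>x. \<Phi> (k(i := x))))}"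

definition pure :: "('f::field, 'k::ring_1) hopf \<Rightarrow> nat \<Rightarrow> (nat \<Rightarrow> 'k) \<Rightarrow> ('f, 'k) tens" where
  "pure H n k = (\<lambda>\<Phi>\<in>mforms H n. \<Phi> k)"

definition tensor_power :: "('f::field, 'k::ring_1) hopf \<Rightarrow> nat \<Rightarrow> ('f, 'k) tens set" where
  "tensor_power H n =
     {x. \<exists>(m::nat) c k. x = (\<lambda>\<Phi>\<in>mforms H n. \<Sum>p<m. c p * pure H n (k p) \<Phi>)}"

definition dpure :: "nat \<Rightarrow> (nat \<Rightarrow> 'k \<Rightarrow> 'f::field) \<Rightarrow> ('f, 'k) dtens" where
  "dpure n \<alpha> = (\<lambda>k. \<Prod>i\<in>{1..n}. \<alpha> i (k i))"

definition dual_tensor_power :: "('f::field, 'k::ring_1) hopf \<Rightarrow> nat \<Rightarrow> ('f, 'k) dtens set" where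
  "dual_tensor_power H n =
     {A. \<exists>(m::nat) c \<alpha>. (\<forall>p<m. \<forall>i\<in>{1..n}. \<alpha> p i \<in> dual H) \<and>
           A = (\<lambda>k. \<Sum>p<m. c p * dpure n (\<alpha> p) k)}"

text \<open>On pure tensors this is \<open>\<langle>\<alpha>\<^sub>1 \<otimes> \<dots> \<otimes> \<alpha>\<^sub>n, k\<^sub>1 \<otimes> \<dots> \<otimes> k\<^sub>n\<rangle> = \<alpha>\<^sub>1(k\<^sub>1) \<cdots> \<alpha>\<^sub>n(k\<^sub>n)\<close>.\<close>

definition pairing :: "('f, 'k) dtens \<Rightarrow> ('f, 'k) tens \<Rightarrow> 'f" where
  "pairing A x = x A"

text \<open>
  The value at the tensor \<open>x\<close> of the linear map into \<open>K\<close> induced by the \<open>K\<close>-valued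
  multilinear map \<open>f\<close>; an element of \<open>K\<close> is determined by its values under \<open>K\<^sup>*\<close>.
\<close>

definition lift :: "('f::field, 'k::ring_1) hopf \<Rightarrow> ((nat \<Rightarrow> 'k) \<Rightarrow> 'k) \<Rightarrow> ('f, 'k) tens \<Rightarrow> 'k" where
  "lift H f x = (THE z. \<forall>\<alpha>\<in>dual H. \<alpha> z = x (\<lambda>k. \<alpha> (f k)))"

definition tens_mult ::
  "('f::field, 'k::ring_1) hopf \<Rightarrow> nat \<Rightarrow> ('f, 'k) tens \<Rightarrow> ('f, 'k) tens \<Rightarrow> ('f, 'k) tens" where
  "tens_mult H n x y = (\<lambda>\<Phi>\<in>mforms H n. x (\<lambda>k. y (\<lambda>l. \<Phi> (\<lambda>i. k i * l i))))"

definition tens_one :: "('f::field, 'k::ring_1) hopf \<Rightarrow> nat \<Rightarrow> ('f, 'k) tens" where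
  "tens_one H n = pure H n (\<lambda>_. 1)"

definition tens_invertible :: "('f::field, 'k::ring_1) hopf \<Rightarrow> nat \<Rightarrow> ('f, 'k) tens \<Rightarrow> bool" where
  "tens_invertible H n x \<longleftrightarrow> x \<in> tensor_power H n \<and>
     (\<exists>y\<in>tensor_power H n. tens_mult H n x y = tens_one H n \<and> tens_mult H n y x = tens_one H n)"

definition tens_inv :: "('f::field, 'k::ring_1) hopf \<Rightarrow> nat \<Rightarrow> ('f, 'k) tens \<Rightarrow> ('f, 'k) tens" where
  "tens_inv H n x = (THE y. y \<in> tensor_power H n \<and>
     tens_mult H n x y = tens_one H n \<and> tens_mult H n y x = tens_one H n)"

text \<open>\<open>f\<^sub>1 \<otimes> \<dots> \<otimes> f\<^sub>n\<close> for linear maps \<open>f\<^sub>i : K \<rightarrow> K\<close>.\<close>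

definition tens_map ::
  "('f::field, 'k::ring_1) hopf \<Rightarrow> nat \<Rightarrow> (nat \<Rightarrow> 'k \<Rightarrow> 'k) \<Rightarrow> ('f, 'k) tens \<Rightarrow> ('f, 'k) tens" where
  "tens_map H n f x = (\<lambda>\<Phi>\<in>mforms H n. x (\<lambda>k. \<Phi> (\<lambda>i. f i (k i))))"

text \<open>\<open>(k)\<^sub>i\<close> and \<open>(x\<^sub>(\<^sub>1\<^sub>) \<otimes> x\<^sub>(\<^sub>2\<^sub>))\<^sub>i\<^sub>j\<close> in \<open>K\<^sup>\<otimes>\<^sup>n\<close>, and the projection \<open>\<pi>\<^sub>i\<close>.\<close>

definition place1 :: "('f::field, 'k::ring_1) hopf \<Rightarrow> nat \<Rightarrow> nat \<Rightarrow> 'k \<Rightarrow> ('f, 'k) tens" where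
  "place1 H n i k = pure H n ((\<lambda>_. 1)(i := k))"

definition place2 ::
  "('f::field, 'k::ring_1) hopf \<Rightarrow> nat \<Rightarrow> nat \<Rightarrow> nat \<Rightarrow> ('f, 'k) tens \<Rightarrow> ('f, 'k) tens" where
  "place2 H n i j x = (\<lambda>\<Phi>\<in>mforms H n. x (\<lambda>r. \<Phi> ((\<lambda>_. 1)(i := r 1, j := r 2))))"

definition proj :: "('f::field, 'k::ring_1) hopf \<Rightarrow> nat \<Rightarrow> nat \<Rightarrow> ('f, 'k) tens \<Rightarrow> 'k" where
  "proj H n i = lift H (\<lambda>k. scl H (\<Prod>j\<in>{1..n} - {i}. counit H (k j)) (k i))"


section \<open>Ribbon Hopf algebras\<close>

definition cop_op :: "('f::field, 'k::ring_1) hopf \<Rightarrow> 'k \<Rightarrow> ('f, 'k) tens" where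
  "cop_op H h = place2 H 2 2 1 (cop H h)"

text \<open>\<open>\<Delta> \<otimes> id\<close> and \<open>id \<otimes> \<Delta>\<close> as maps \<open>K \<otimes> K \<rightarrow> K \<otimes> K \<otimes> K\<close>.\<close>

definition cop_id :: "('f::field, 'k::ring_1) hopf \<Rightarrow> ('f, 'k) tens \<Rightarrow> ('f, 'k) tens" where
  "cop_id H x = (\<lambda>\<Phi>\<in>mforms H 3. x (\<lambda>r. cop H (r 1) (\<lambda>p. \<Phi> (tup [p 1, p 2, r 2]))))"

definition id_cop :: "('f::field, 'k::ring_1) hopf \<Rightarrow> ('f, 'k) tens \<Rightarrow> ('f, 'k) tens" where
  "id_cop H x = (\<lambda>\<Phi>\<in>mforms H 3. x (\<lambda>r. cop H (r 2) (\<lambda>p. \<Phi> (tup [r 1, p 1, p 2]))))"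

locale fin_dim_hopf_algebra =
  fixes H :: "('f::field, 'k::ring_1) hopf"
  assumes fin_dim: "\<exists>Basis. finite_dimensional_vector_space (scl H) Basis"
    and scl_mult_left: "scl H c x * y = scl H c (x * y)"
    and scl_mult_right: "x * scl H c y = scl H c (x * y)"
    and cop_in: "cop H x \<in> tensor_power H 2"
    and cop_linear: "cop H (scl H c x + y) = (\<lambda>\<Phi>\<in>mforms H 2. c * cop H x \<Phi> + cop H y \<Phi>)"
    and cop_mult: "cop H (x * y) = tens_mult H 2 (cop H x) (cop H y)"
    and cop_one: "cop H 1 = tens_one H 2"
    and coassoc: "cop_id H (cop H x) = id_cop H (cop H x)"
    and counit_linear: "counit H \<in> dual H"
    and counit_mult: "counit H (x * y) = counit H x * counit H y"
    and counit_one: "counit H 1 = 1"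
    and counit_left: "lift H (\<lambda>p. scl H (counit H (p 1)) (p 2)) (cop H x) = x"
    and counit_right: "lift H (\<lambda>p. scl H (counit H (p 2)) (p 1)) (cop H x) = x"
    and antipode_linear: "Vector_Spaces.linear (scl H) (scl H) (antipode H)"
    and antipode_left: "lift H (\<lambda>p. antipode H (p 1) * p 2) (cop H x) = scl H (counit H x) 1"
    and antipode_right: "lift H (\<lambda>p. p 1 * antipode H (p 2)) (cop H x) = scl H (counit H x) 1"

definition R_matrix :: "('f::field, 'k::ring_1) hopf \<Rightarrow> ('f, 'k) tens \<Rightarrow> bool" where
  "R_matrix H R \<longleftrightarrow>
     tens_invertible H 2 R \<and>
     (\<forall>h. tens_mult H 2 R (cop H h) = tens_mult H 2 (cop_op H h) R) \<and>
     cop_id H R = tens_mult H 3 (place2 H 3 1 3 R) (place2 H 3 2 3 R) \<and>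
     id_cop H R = tens_mult H 3 (place2 H 3 1 3 R) (place2 H 3 1 2 R)"

definition drinfeld_element :: "('f::field, 'k::ring_1) hopf \<Rightarrow> ('f, 'k) tens \<Rightarrow> 'k" where
  "drinfeld_element H R = lift H (\<lambda>r. antipode H (r 2) * r 1) R"

definition ribbon_element :: "('f::field, 'k::ring_1) hopf \<Rightarrow> ('f, 'k) tens \<Rightarrow> 'k \<Rightarrow> bool" where
  "ribbon_element H R \<nu> \<longleftrightarrow>
     (\<forall>x. \<nu> * x = x * \<nu>) \<and> (\<exists>\<mu>. \<nu> * \<mu> = 1 \<and> \<mu> * \<nu> = 1) \<and>
     drinfeld_element H R * antipode H (drinfeld_element H R) = \<nu>\<^sup>2 \<and>
     counit H \<nu> = 1 \<and> antipode H \<nu> = \<nu> \<and>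
     cop H \<nu> = tens_mult H 2 (tens_mult H 2 (tens_inv H 2 R) (tens_inv H 2 (place2 H 2 2 1 R)))
                             (pure H 2 (tup [\<nu>, \<nu>]))"

definition ribbon_hopf_algebra :: "('f::field, 'k::ring_1) hopf \<Rightarrow> ('f, 'k) tens \<Rightarrow> bool" where
  "ribbon_hopf_algebra H R \<longleftrightarrow>
     fin_dim_hopf_algebra H \<and> R_matrix H R \<and> (\<exists>\<nu>. ribbon_element H R \<nu>)"


section \<open>The dual Hopf algebra\<close>

text \<open>
  Conventions: \<open>\<langle>\<alpha>\<beta>, k\<rangle> = \<langle>\<alpha> \<otimes> \<beta>, \<Delta>(k)\<rangle>\<close>, \<open>\<langle>\<Delta>(\<alpha>), k \<otimes> l\<rangle> = \<langle>\<alpha>, kl\<rangle>\<close>, the unit of \<open>K\<^sup>*\<close> is the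
  counit of \<open>K\<close>, and \<open>S(\<alpha>) = \<alpha> \<circ> S\<close>.
\<close>

definition dmult :: "('f::field, 'k::ring_1) hopf \<Rightarrow> ('k \<Rightarrow> 'f) \<Rightarrow> ('k \<Rightarrow> 'f) \<Rightarrow> 'k \<Rightarrow> 'f" where
  "dmult H \<alpha> \<beta> = (\<lambda>k. pairing (dpure 2 (tup [\<alpha>, \<beta>])) (cop H k))"

definition dcop :: "('k::ring_1 \<Rightarrow> 'f) \<Rightarrow> ('f, 'k) dtens" where
  "dcop \<alpha> = (\<lambda>k. \<alpha> (k 1 * k 2))"

definition dantipode :: "('f::field, 'k::ring_1) hopf \<Rightarrow> ('k \<Rightarrow> 'f) \<Rightarrow> 'k \<Rightarrow> 'f" where
  "dantipode H \<alpha> = \<alpha> \<circ> antipode H"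

text \<open>
  \<open>\<Delta>(\<alpha>) = \<Sum>p<m. a p 1 \<otimes> a p 2\<close> with all \<open>a p i\<close> in \<open>K\<^sup>*\<close>. Expressions in Sweedler notation
  for \<open>K\<^sup>*\<close> are sums over such a representation and do not depend on its choice.
\<close>

definition sweedler ::
  "('f::field, 'k::ring_1) hopf \<Rightarrow> ('k \<Rightarrow> 'f) \<Rightarrow> nat \<Rightarrow> (nat \<Rightarrow> nat \<Rightarrow> 'k \<Rightarrow> 'f) \<Rightarrow> bool" where
  "sweedler H \<alpha> m a \<longleftrightarrow>
     (\<forall>p<m. a p 1 \<in> dual H \<and> a p 2 \<in> dual H) \<and>
     dcop \<alpha> = (\<lambda>k. \<Sum>p<m. dpure 2 (a p) k)"

definition dtens_one :: "('f::field, 'k::ring_1) hopf \<Rightarrow> nat \<Rightarrow> ('f, 'k) dtens" where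
  "dtens_one H n = dpure n (\<lambda>_. counit H)"

text \<open>The embeddings \<open>\<iota>\<^sub>i\<close> and \<open>\<iota>\<^sub>i\<^sub>j\<close> into \<open>K\<^sup>*\<^sup>\<otimes>\<^sup>n\<close>.\<close>

definition dplace1 ::
  "('f::field, 'k::ring_1) hopf \<Rightarrow> nat \<Rightarrow> nat \<Rightarrow> ('k \<Rightarrow> 'f) \<Rightarrow> ('f, 'k) dtens" where
  "dplace1 H n i \<alpha> = dpure n ((\<lambda>_. counit H)(i := \<alpha>))"

definition dplace2 ::
  "('f::field, 'k::ring_1) hopf \<Rightarrow> nat \<Rightarrow> nat \<Rightarrow> nat \<Rightarrow> ('f, 'k) dtens \<Rightarrow> ('f, 'k) dtens" where
  "dplace2 H n i j A = (\<lambda>k. A (tup [k i, k j]) * (\<Prod>l\<in>{1..n} - {i, j}. counit H (k l)))"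


section \<open>Ciliated ribbon graphs and vertex neighbourhoods\<close>

datatype 'e edge_end = Start 'e | Target 'e

definition edge_ends :: "('v, 'e) pre_digraph \<Rightarrow> 'v \<Rightarrow> 'e edge_end set" where
  "edge_ends G v = {Start e | e. e \<in> arcs G \<and> tail G e = v} \<union>
                   {Target e | e. e \<in> arcs G \<and> head G e = v}"

locale ciliated_ribbon_graph = fin_digraph G
  for G :: "('v, 'e) pre_digraph" +
  fixes ord :: "'v \<Rightarrow> 'e edge_end rel"
  assumes linear_order: "v \<in> verts G \<Longrightarrow> linear_order_on (edge_ends G v) (ord v)"

text \<open>\<open>ed 1 < \<dots> < ed n\<close> are the edge ends at \<open>v\<close>.\<close>

definition numbered_ends ::
  "('v, 'e) pre_digraph \<Rightarrow> ('v \<Rightarrow> 'e edge_end rel) \<Rightarrow> 'v \<Rightarrow> nat \<Rightarrow> (nat \<Rightarrow> 'e edge_end) \<Rightarrow> bool" where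
  "numbered_ends G ord v n ed \<longleftrightarrow>
     bij_betw ed {1..n} (edge_ends G v) \<and>
     (\<forall>i\<in>{1..n}. \<forall>j\<in>{1..n}. (ed i, ed j) \<in> ord v \<longleftrightarrow> i \<le> j)"

text \<open>The edges of the vertex neighbourhood are the edge ends at \<open>v\<close>; each has its own free vertex.\<close>

datatype ('v, 'e) nbhd_vertex = Centre 'v | Free "'e edge_end"

definition vertex_nbhd ::
  "('v, 'e) pre_digraph \<Rightarrow> 'v \<Rightarrow> (('v, 'e) nbhd_vertex, 'e edge_end) pre_digraph" where
  "vertex_nbhd G v =
     \<lparr>verts = insert (Centre v) (Free ` edge_ends G v),
      arcs = edge_ends G v,
      tail = (\<lambda>x. case x of Start e \<Rightarrow> Centre v | Target e \<Rightarrow> Free x),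
      head = (\<lambda>x. case x of Start e \<Rightarrow> Free x | Target e \<Rightarrow> Centre v)\<rparr>"

definition end_sign :: "'e edge_end \<Rightarrow> nat" where
  "end_sign x = (case x of Target e \<Rightarrow> 0 | Start e \<Rightarrow> 1)"


section \<open>Hopf algebra gauge theories on a vertex neighbourhood\<close>

definition dtens_algebra ::
  "('f::field, 'k::ring_1) hopf \<Rightarrow> nat \<Rightarrow>
   (('f, 'k) dtens \<Rightarrow> ('f, 'k) dtens \<Rightarrow> ('f, 'k) dtens) \<Rightarrow> bool" where
  "dtens_algebra H n mul \<longleftrightarrow>
     (let D = dual_tensor_power H n in
      (\<forall>A\<in>D. \<forall>B\<in>D. mul A B \<in> D) \<and>
      (\<forall>c. \<forall>A\<in>D. \<forall>B\<in>D. \<forall>C\<in>D.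
         mul (\<lambda>k. c * A k + B k) C = (\<lambda>k. c * mul A C k + mul B C k) \<and>
         mul C (\<lambda>k. c * A k + B k) = (\<lambda>k. c * mul C A k + mul C B k)) \<and>
      (\<forall>A\<in>D. \<forall>B\<in>D. \<forall>C\<in>D. mul (mul A B) C = mul A (mul B C)) \<and>
      (\<forall>A\<in>D. mul (dtens_one H n) A = A \<and> mul A (dtens_one H n) = A))"

definition tens_left_module ::
  "('f::field, 'k::ring_1) hopf \<Rightarrow> nat \<Rightarrow> ('k \<Rightarrow> ('f, 'k) tens \<Rightarrow> ('f, 'k) tens) \<Rightarrow> bool" where
  "tens_left_module H n act \<longleftrightarrow>
     (let T = tensor_power H n in
      (\<forall>h. \<forall>x\<in>T. act h x \<in> T) \<and>
      (\<forall>c h. \<forall>x\<in>T. \<forall>y\<in>T.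
         act h (\<lambda>\<Phi>\<in>mforms H n. c * x \<Phi> + y \<Phi>) = (\<lambda>\<Phi>\<in>mforms H n. c * act h x \<Phi> + act h y \<Phi>)) \<and>
      (\<forall>c g h. \<forall>x\<in>T.
         act (scl H c g + h) x = (\<lambda>\<Phi>\<in>mforms H n. c * act g x \<Phi> + act h x \<Phi>)) \<and>
      (\<forall>g h. \<forall>x\<in>T. act (g * h) x = act g (act h x)) \<and>
      (\<forall>x\<in>T. act 1 x = x))"

text \<open>
  \<open>dact\<close> is the right module structure dual to \<open>act\<close>. In the module algebra condition the
  application of \<open>cop H h\<close> is the summation over \<open>h\<^sub>(\<^sub>1\<^sub>) \<otimes> h\<^sub>(\<^sub>2\<^sub>)\<close>.
\<close>

definition vertex_gauge_theory ::
  "('f::field, 'k::ring_1) hopf \<Rightarrow> ('v, 'e) pre_digraph \<Rightarrow> 'v \<Rightarrow> nat \<Rightarrow> (nat \<Rightarrow> 'e edge_end) \<Rightarrow>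
   (('f, 'k) dtens \<Rightarrow> ('f, 'k) dtens \<Rightarrow> ('f, 'k) dtens) \<Rightarrow>
   ('k \<Rightarrow> ('f, 'k) tens \<Rightarrow> ('f, 'k) tens) \<Rightarrow>
   (('f, 'k) dtens \<Rightarrow> 'k \<Rightarrow> ('f, 'k) dtens) \<Rightarrow> bool" where
  "vertex_gauge_theory H G v n ed mul act dact \<longleftrightarrow>
     (let \<Gamma> = vertex_nbhd G v; D = dual_tensor_power H n; T = tensor_power H n in
      bij_betw ed {1..n} (arcs \<Gamma>) \<and>
      dtens_algebra H n mul \<and>
      (\<forall>i\<in>{1..n}. \<forall>\<alpha>\<in>dual H. \<forall>\<beta>\<in>dual H.
         mul (dplace1 H n i \<alpha>) (dplace1 H n i \<beta>) \<in> dplace1 H n i ` dual H) \<and>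
      (\<forall>i\<in>{1..n}. \<forall>j\<in>{1..n}. i \<noteq> j \<longrightarrow> (\<forall>\<alpha>\<in>dual H. \<forall>\<beta>\<in>dual H.
         mul (dplace1 H n i \<alpha>) (dplace1 H n j \<beta>) \<in> dplace2 H n i j ` dual_tensor_power H 2)) \<and>
      tens_left_module H n act \<and>
      (\<forall>A\<in>D. \<forall>h. dact A h \<in> D \<and> (\<forall>x\<in>T. pairing (dact A h) x = pairing A (act h x))) \<and>
      (\<forall>A\<in>D. \<forall>B\<in>D. \<forall>h.
         dact (mul A B) h = (\<lambda>k. cop H h (\<lambda>p. mul (dact A (p 1)) (dact B (p 2)) k))) \<and>
      (\<forall>h. dact (dtens_one H n) h = (\<lambda>k. counit H h * dtens_one H n k)) \<and>
      (\<forall>i\<in>{1..n}. \<forall>h k.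
         (head \<Gamma> (ed i) = Centre v \<longrightarrow> proj H n i (act h (place1 H n i k)) = h * k) \<and>
         (tail \<Gamma> (ed i) = Centre v \<longrightarrow> proj H n i (act h (place1 H n i k)) = k * antipode H h)))"


section \<open>The multiplication and the action at a vertex\<close>

definition vertex_multiplication ::
  "('f::field, 'k::ring_1) hopf \<Rightarrow> ('f, 'k) tens \<Rightarrow> nat \<Rightarrow> (nat \<Rightarrow> nat) \<Rightarrow> (nat \<Rightarrow> nat) \<Rightarrow>
   (('f, 'k) dtens \<Rightarrow> ('f, 'k) dtens \<Rightarrow> ('f, 'k) dtens) \<Rightarrow> bool" where
  "vertex_multiplication H R n \<sigma> \<tau> mul \<longleftrightarrow>
     dtens_algebra H n mul \<and>
     (\<forall>\<alpha>. (\<forall>i\<in>{1..n}. \<alpha> i \<in> dual H) \<longrightarrow>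
        dpure n \<alpha> = foldr mul (map (\<lambda>i. dplace1 H n i (\<alpha> i)) [1..<n+1]) (dtens_one H n)) \<and>
     (\<forall>\<alpha>\<in>dual H. \<forall>\<beta>\<in>dual H. \<forall>m a l b. sweedler H \<alpha> m a \<and> sweedler H \<beta> l b \<longrightarrow>
        (\<forall>i\<in>{1..n}. mul (dplace1 H n i \<alpha>) (dplace1 H n i \<beta>) =
           (if \<sigma> i = 0 \<and> \<tau> i = 0 then
              (\<lambda>k. \<Sum>q<l. \<Sum>p<m. pairing (dpure 2 (tup [b q 1, a p 1])) R *
                                  dplace1 H n i (dmult H (b q 2) (a p 2)) k)
            else if \<sigma> i = 0 \<and> \<tau> i = 1 then
              (\<lambda>k. \<Sum>q<l. \<Sum>p<m. pairing (dpure 2 (tup [b q 2, a p 2])) R *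
                                  dplace1 H n i (dmult H (a p 1) (b q 1)) k)
            else if \<sigma> i = 1 \<and> \<tau> i = 0 then dplace1 H n i (dmult H \<alpha> \<beta>)
            else dplace1 H n i (dmult H \<beta> \<alpha>))) \<and>
        (\<forall>i\<in>{1..n}. \<forall>j\<in>{1..n}.
           (i < j \<longrightarrow> mul (dplace1 H n i \<alpha>) (dplace1 H n j \<beta>) =
              dplace2 H n i j (dpure 2 (tup [\<alpha>, \<beta>]))) \<and>
           (i > j \<longrightarrow> mul (dplace1 H n i \<alpha>) (dplace1 H n j \<beta>) =
              (\<lambda>k. \<Sum>q<l. \<Sum>p<m.
                 pairing (dpure 2 (tup [b q (1 + \<tau> j), a p (1 + \<tau> i)]))
                   (tens_map H 2 (tup [antipode H ^^ \<tau> j, antipode H ^^ \<tau> i]) R) *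
                 dplace2 H n i j (dpure 2 (tup [a p (2 - \<tau> i), b q (2 - \<tau> j)])) k))))"

definition vertex_action ::
  "('f::field, 'k::ring_1) hopf \<Rightarrow> nat \<Rightarrow> (nat \<Rightarrow> nat) \<Rightarrow>
   (('f, 'k) dtens \<Rightarrow> 'k \<Rightarrow> ('f, 'k) dtens) \<Rightarrow> bool" where
  "vertex_action H n \<tau> dact \<longleftrightarrow>
     (let D = dual_tensor_power H n in
      (\<forall>A\<in>D. \<forall>h. dact A h \<in> D) \<and>
      (\<forall>c h. \<forall>A\<in>D. \<forall>B\<in>D.
         dact (\<lambda>k. c * A k + B k) h = (\<lambda>k. c * dact A h k + dact B h k)) \<and>
      (\<forall>c g h. \<forall>A\<in>D. dact A (scl H c g + h) = (\<lambda>k. c * dact A g k + dact A h k)) \<and>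
      (\<forall>\<alpha> m a h. (\<forall>i\<in>{1..n}. \<alpha> i \<in> dual H \<and> sweedler H (\<alpha> i) (m i) (a i)) \<longrightarrow>
         dact (dpure n \<alpha>) h =
           (\<lambda>k. \<Sum>p\<in>Pi\<^sub>E {1..n} (\<lambda>i. {..<m i}).
              foldr (dmult H)
                (map (\<lambda>i. (dantipode H ^^ \<tau> i) (a i (p i) (1 + \<tau> i))) [1..<n+1]) (counit H) h *
              dpure n (\<lambda>i. a i (p i) (2 - \<tau> i)) k)))"

end

theory Submission
  imports Defs
begin

text \<open>
  The formulas at a vertex describe an \<open>n\<close>-fold braided tensor product. At an end with data
  \<open>(\<sigma>, \<tau>)\<close> the space \<open>K\<^sup>*\<close> is an algebra that is dual to the coproduct \<open>\<Delta>\<close>, \<open>\<Delta>\<^sup>o\<^sup>p\<close> or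
  \<open>k \<mapsto> \<Delta>(k)R\<^sub>2\<^sub>1\<close> on \<open>K\<close>, and \<open>K\<close> acts on it from the right by the transpose of \<open>k \<mapsto> hk\<close> or
  \<open>k \<mapsto> kS(h)\<close>. This is a module algebra (\<open>module_algebra_end\<close>): coassociativity of the twisted
  coproduct is the Yang-Baxter equation, its counit law is \<open>(\<epsilon> \<otimes> id)(R) = 1 = (id \<otimes> \<epsilon>)(R)\<close>, and its
  compatibility with the action follows from \<open>R\<Delta>(h) = \<Delta>\<^sup>o\<^sup>p(h)R\<close> and from the fact that \<open>S\<close> reverses
  products and coproducts.

  The relation between generators at different ends says that
  \<open>(\<alpha>)\<^sub>i(\<beta>)\<^sub>j = (\<beta> \<lhd> R\<^sub>(\<^sub>1\<^sub>))\<^sub>j(\<alpha> \<lhd> R\<^sub>(\<^sub>2\<^sub>))\<^sub>i\<close> for \<open>i > j\<close>. It is the braiding of right \<open>K\<close>-modules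
  given by \<open>R\<close>, and so the algebra is built up by adding one end at a time through
  \<open>(A \<otimes> \<alpha>)(B \<otimes> \<beta>) = A(B \<lhd> R\<^sub>(\<^sub>1\<^sub>)) \<otimes> (\<alpha> \<lhd> R\<^sub>(\<^sub>2\<^sub>))\<beta>\<close>
  with the diagonal action. The two hexagon identities give associativity, and
  \<open>R\<Delta>(h) = \<Delta>\<^sup>o\<^sup>p(h)R\<close> makes the result a module algebra again (\<open>module_algebra_Suc\<close>). The formulas
  on generators and the action formula are then read off by induction on the number of ends, and the
  left module structure on \<open>K\<^sup>\<otimes>\<^sup>n\<close> is the transpose of the action.

  The action is unique because it is prescribed on pure tensors. The multiplication is unique because
  pure tensors are ordered monomials in the generators and the relations suffice to reorder any
  product of monomials (\<open>vertex_multiplication_generator\<close>).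
\<close>

section \<open>Linear and multilinear forms\<close>

context fin_dim_hopf_algebra
begin

(* The slots of a tensor are numbered from 1, and the literal 1 is kept in this form throughout. *)
declare One_nat_def [simp del]

lemma vector_space_scl: "vector_space (scl H)"
  using fin_dim by (auto simp: finite_dimensional_vector_space_def)

sublocale V: vector_space "scl H"
  by (rule vector_space_scl)

definition lin :: "('k \<Rightarrow> 'f) \<Rightarrow> bool" where
  "lin f \<longleftrightarrow> (\<forall>c x y. f (scl H c x + y) = c * f x + f y)"

definition klin :: "('k \<Rightarrow> 'k) \<Rightarrow> bool" where
  "klin f \<longleftrightarrow> (\<forall>c x y. f (scl H c x + y) = scl H c (f x) + f y)"

definition bilin :: "('k \<Rightarrow> 'k \<Rightarrow> 'f) \<Rightarrow> bool" where
  "bilin f \<longleftrightarrow> (\<forall>b. lin (\<lambda>a. f a b)) \<and> (\<forall>a. lin (\<lambda>b. f a b))"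

definition trilin :: "('k \<Rightarrow> 'k \<Rightarrow> 'k \<Rightarrow> 'f) \<Rightarrow> bool" where
  "trilin f \<longleftrightarrow> (\<forall>b c. lin (\<lambda>a. f a b c)) \<and> (\<forall>a c. lin (\<lambda>b. f a b c)) \<and>
     (\<forall>a b. lin (\<lambda>c. f a b c))"

lemma linD: "lin f \<Longrightarrow> f (scl H c x + y) = c * f x + f y"
  by (simp add: lin_def)

lemma lin_zero: "lin f \<Longrightarrow> f 0 = 0"
  using linD[of f "- 1" 0 0] by simp

lemma lin_add: "lin f \<Longrightarrow> f (x + y) = f x + f y"
  using linD[of f 1 x y] by simp

lemma lin_scl: "lin f \<Longrightarrow> f (scl H c x) = c * f x"
  using linD[of f c x 0] by (simp add: lin_zero)

lemma lin_sum: "lin f \<Longrightarrow> f (\<Sum>i\<in>I. g i) = (\<Sum>i\<in>I. f (g i))"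
  by (induction I rule: infinite_finite_induct) (auto simp: lin_zero lin_add)

lemma linear_iff_lin: "Vector_Spaces.linear (scl H) (*) f \<longleftrightarrow> lin f"
proof
  assume "Vector_Spaces.linear (scl H) (*) f"
  then show "lin f"
    by (simp add: lin_def Vector_Spaces.linear_iff)
next
  assume "lin f"
  moreover have "vector_space ((*) :: 'f \<Rightarrow> 'f \<Rightarrow> 'f)"
    by unfold_locales (simp_all add: algebra_simps)
  ultimately show "Vector_Spaces.linear (scl H) (*) f"
    using vector_space_scl
    by (simp add: Vector_Spaces.linear_iff lin_add lin_scl)
qed

lemma dual_iff_lin: "\<alpha> \<in> dual H \<longleftrightarrow> lin \<alpha>"
  by (simp add: dual_def linear_iff_lin)

lemma bilinI: "(\<And>b. lin (\<lambda>a. f a b)) \<Longrightarrow> (\<And>a. lin (\<lambda>b. f a b)) \<Longrightarrow> bilin f"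
  by (simp add: bilin_def)

lemma trilinI:
  "(\<And>b c. lin (\<lambda>a. f a b c)) \<Longrightarrow> (\<And>a c. lin (\<lambda>b. f a b c)) \<Longrightarrow> (\<And>a b. lin (\<lambda>c. f a b c))
    \<Longrightarrow> trilin f"
  by (simp add: trilin_def)

lemma bilin_lin1: "bilin f \<Longrightarrow> lin (\<lambda>a. f a b)" and bilin_lin2: "bilin f \<Longrightarrow> lin (f a)"
  by (simp_all add: bilin_def)

lemma lin_comp: "lin f \<Longrightarrow> klin g \<Longrightarrow> lin (\<lambda>x. f (g x))"
  by (simp add: lin_def klin_def)

lemma bilin_comp1: "bilin f \<Longrightarrow> klin g \<Longrightarrow> lin (\<lambda>x. f (g x) b)"
  and bilin_comp2: "bilin f \<Longrightarrow> klin g \<Longrightarrow> lin (\<lambda>x. f a (g x))"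
  by (simp_all add: lin_def klin_def bilin_def)

lemma trilin_comp1: "trilin f \<Longrightarrow> klin g \<Longrightarrow> lin (\<lambda>x. f (g x) b c)"
  and trilin_comp2: "trilin f \<Longrightarrow> klin g \<Longrightarrow> lin (\<lambda>x. f a (g x) c)"
  and trilin_comp3: "trilin f \<Longrightarrow> klin g \<Longrightarrow> lin (\<lambda>x. f a b (g x))"
  by (simp_all add: lin_def klin_def trilin_def)

lemma lin_cmult: "lin f \<Longrightarrow> lin (\<lambda>x. c * f x)"
  and lin_multc: "lin f \<Longrightarrow> lin (\<lambda>x. f x * c)"
  and lin_plus: "lin f \<Longrightarrow> lin g \<Longrightarrow> lin (\<lambda>x. f x + g x)"
  by (simp_all add: lin_def algebra_simps)

lemma lin_sumI: "(\<And>i. i \<in> I \<Longrightarrow> lin (\<lambda>x. f x i)) \<Longrightarrow> lin (\<lambda>x. \<Sum>i\<in>I. f x i)"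
  by (induction I rule: infinite_finite_induct) (simp_all add: lin_plus, simp_all add: lin_def)

lemma klin_id: "klin (\<lambda>x. x)"
  by (simp add: klin_def)

lemma klin_left: "klin g \<Longrightarrow> klin (\<lambda>x. c * g x)"
  and klin_right: "klin g \<Longrightarrow> klin (\<lambda>x. g x * c)"
  by (simp_all add: klin_def distrib_left distrib_right scl_mult_left scl_mult_right)

lemma antipode_scl_add: "antipode H (scl H c x + y) = scl H c (antipode H x) + antipode H y"
  using antipode_linear by (simp add: Vector_Spaces.linear_iff)

lemma klin_antipode: "klin g \<Longrightarrow> klin (\<lambda>x. antipode H (g x))"
  by (simp add: klin_def antipode_scl_add)

lemma lin_counit: "lin (counit H)"
  using counit_linear by (simp add: dual_iff_lin)

lemma lin_counitI: "klin g \<Longrightarrow> lin (\<lambda>x. counit H (g x))"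
  by (rule lin_comp[OF lin_counit])

lemmas lin_intros = lin_cmult lin_multc klin_id klin_left klin_right klin_antipode lin_counitI

text \<open>
  Coordinates with respect to a basis are linear, so that a finite basis yields a dual basis. The
  two consequences used later are that linear forms separate the points of \<open>K\<close> and that every
  multilinear form is a sum of pure ones.
\<close>

lemma dual_basis:
  obtains E :: "'k set" and co :: "'k \<Rightarrow> 'k \<Rightarrow> 'f" where
    "finite E" "\<And>b. lin (co b)" "\<And>x. (\<Sum>b\<in>E. scl H (co b x) b) = x"
proof -
  obtain E where E: "finite_dimensional_vector_space (scl H) E"
    using fin_dim by blast
  interpret E: finite_dimensional_vector_space "scl H" E by (rule E)
  show thesis
  proof
    show "finite E" by (rule E.finite_Basis)
    show "lin (\<lambda>x. V.representation E x b)" for b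
      by (simp add: lin_def V.representation_add V.representation_scale E.independent_Basis
          E.span_Basis)
    show "(\<Sum>b\<in>E. scl H (V.representation E x b) b) = x" for x
      by (rule V.sum_representation_eq)
        (auto simp: E.independent_Basis E.span_Basis E.finite_Basis)
  qed
qed

lemma lin_separates: "(\<And>\<alpha>. lin \<alpha> \<Longrightarrow> \<alpha> x = \<alpha> y) \<Longrightarrow> x = y"
  by (metis (no_types, lifting) dual_basis sum.cong)

lemma lin_expand: "lin f \<Longrightarrow> (\<And>x. (\<Sum>b\<in>E. scl H (co b x) b) = x) \<Longrightarrow> f x = (\<Sum>b\<in>E. co b x * f b)"
  by (metis (no_types, lifting) lin_scl lin_sum sum.cong)


section \<open>Tensors of degree two and three as Sweedler sums\<close>

lemma mforms_iff:
  "\<Phi> \<in> mforms H n \<longleftrightarrow> (\<forall>k k'. (\<forall>i\<in>{1..n}. k i = k' i) \<longrightarrow> \<Phi> k = \<Phi> k') \<and>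
     (\<forall>k. \<forall>i\<in>{1..n}. lin (\<lambda>x. \<Phi> (k(i := x))))"
  by (simp add: mforms_def linear_iff_lin)

lemma tup_2: "tup [a, b] 1 = a" "tup [a, b] (Suc 0) = a" "tup [a, b] 2 = b"
  by (simp_all add: tup_def)

lemma tup_3: "tup [a, b, c] 1 = a" "tup [a, b, c] (Suc 0) = a" "tup [a, b, c] 2 = b"
    "tup [a, b, c] 3 = c"
  by (simp_all add: tup_def)

lemma atLeastAtMost_1_2: "{1..2::nat} = {1, 2}" and atLeastAtMost_1_3: "{1..3::nat} = {1, 2, 3}"
  by auto

lemma mforms_2I: "bilin f \<Longrightarrow> (\<lambda>p. f (p 1) (p 2)) \<in> mforms H 2"
  unfolding mforms_iff atLeastAtMost_1_2 by (auto simp: bilin_def)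

lemma mforms_3I: "trilin f \<Longrightarrow> (\<lambda>p. f (p 1) (p 2) (p 3)) \<in> mforms H 3"
  unfolding mforms_iff atLeastAtMost_1_3 by (auto simp: trilin_def)

text \<open>
  A tensor in \<open>K \<otimes> K\<close> is only known as a functional on bilinear forms. Fixing one representation
  \<open>\<Sum>p a\<^sub>p \<otimes> b\<^sub>p\<close> of it turns Sweedler sums into genuine finite sums, which commute with each other
  and with everything additive, whether or not the summand is bilinear. Bilinearity
  enters where the identity of the tensor itself is used. In Sweedler notation \<open>sw x f\<close> is
  \<open>f(x\<^sub>(\<^sub>1\<^sub>), x\<^sub>(\<^sub>2\<^sub>))\<close>, and \<open>cp h f\<close> below is \<open>f(h\<^sub>(\<^sub>1\<^sub>), h\<^sub>(\<^sub>2\<^sub>))\<close>.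
\<close>

definition represents :: "(nat \<times> (nat \<Rightarrow> 'k) \<times> (nat \<Rightarrow> 'k)) \<Rightarrow> ('f, 'k) tens \<Rightarrow> bool" where
  "represents = (\<lambda>(m, a, b) x. \<forall>f. bilin f \<longrightarrow> (\<Sum>p<m. f (a p) (b p)) = x (\<lambda>r. f (r 1) (r 2)))"

definition sw :: "('f, 'k) tens \<Rightarrow> ('k \<Rightarrow> 'k \<Rightarrow> 'a::comm_monoid_add) \<Rightarrow> 'a" where
  "sw x f = (case SOME t. represents t x of (m, a, b) \<Rightarrow> \<Sum>p<m. f (a p) (b p))"

lemma sw_eval:
  assumes x: "x \<in> tensor_power H 2" and f: "bilin f"
  shows "sw x f = x (\<lambda>r. f (r 1) (r 2))"
proof -
  obtain m c k where x_eq: "x = (\<lambda>\<Phi>\<in>mforms H 2. \<Sum>p<(m::nat). c p * pure H 2 (k p) \<Phi>)"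
    using x by (auto simp: tensor_power_def)
  have "represents (m, \<lambda>p. scl H (c p) (k p 1), \<lambda>p. k p 2) x"
    unfolding represents_def
  proof (clarify)
    fix f assume f: "bilin f"
    then have "lin (\<lambda>a. f a b)" for b by (simp add: bilin_def)
    then show "(\<Sum>p<m. f (scl H (c p) (k p 1)) (k p 2)) = x (\<lambda>r. f (r 1) (r 2))"
      using mforms_2I[OF f] by (simp add: x_eq pure_def lin_scl[of "\<lambda>a. f a _"])
  qed
  then have "represents (SOME t. represents t x) x"
    by (rule someI)
  then show ?thesis
    using f by (auto simp: represents_def sw_def split: prod.splits)
qed

lemma
  fixes f :: "'k \<Rightarrow> 'k \<Rightarrow> 'f"
  shows sw_cmult: "sw x (\<lambda>a b. c * f a b) = c * sw x f"
    and sw_multc: "sw x (\<lambda>a b. f a b * c) = sw x f * c"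
  by (auto simp: sw_def sum_distrib_left sum_distrib_right split: prod.splits)

lemma sw_add: "sw x (\<lambda>a b. f a b + g a b) = sw x f + sw x g"
  by (auto simp: sw_def sum.distrib split: prod.splits)

lemma sw_swap: "sw x (\<lambda>a b. sw y (\<lambda>c d. f a b c d)) = sw y (\<lambda>c d. sw x (\<lambda>a b. f a b c d))"
  by (auto simp: sw_def intro: sum.swap split: prod.splits)

lemma sw_sum: "sw x (\<lambda>a b. \<Sum>i\<in>I. f i a b) = (\<Sum>i\<in>I. sw x (f i))"
  by (auto simp: sw_def intro: sum.swap split: prod.splits)

lemma lin_of_sw: "lin \<phi> \<Longrightarrow> \<phi> (sw x f) = sw x (\<lambda>a b. \<phi> (f a b))"
  by (auto simp: sw_def lin_sum split: prod.splits)

lemma lin_sw: "(\<And>a b. lin (\<lambda>x. f x a b)) \<Longrightarrow> lin (\<lambda>x. sw t (f x))"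
  unfolding sw_def by (cases "SOME r. represents r t") (auto intro!: lin_sumI)

lemma lift_eq_sw:
  assumes x: "x \<in> tensor_power H 2" and f: "\<And>\<alpha>. lin \<alpha> \<Longrightarrow> bilin (\<lambda>a b. \<alpha> (f a b))"
  shows "lift H (\<lambda>p. f (p 1) (p 2)) x = sw x f"
  unfolding lift_def
proof (rule the_equality)
  show *: "\<forall>\<alpha>\<in>dual H. \<alpha> (sw x f) = x (\<lambda>k. \<alpha> (f (k 1) (k 2)))"
    using sw_eval[OF x f] by (auto simp: dual_iff_lin lin_of_sw)
  show "z = sw x f" if "\<forall>\<alpha>\<in>dual H. \<alpha> z = x (\<lambda>k. \<alpha> (f (k 1) (k 2)))" for z
  proof (rule lin_separates)
    fix \<alpha> assume "lin \<alpha>"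
    then have "\<alpha> \<in> dual H" by (simp add: dual_iff_lin)
    with bspec[OF *, of \<alpha>] bspec[OF that, of \<alpha>] show "\<alpha> z = \<alpha> (sw x f)" by simp
  qed
qed

lemma sw_pure: "bilin f \<Longrightarrow> sw (pure H 2 k) f = f (k 1) (k 2)"
proof -
  assume f: "bilin f"
  have "pure H 2 k \<in> tensor_power H 2"
    unfolding tensor_power_def
    by (rule CollectI, rule exI[of _ 1], rule exI[of _ "\<lambda>_. 1"], rule exI[of _ "\<lambda>_. k"])
      (auto simp: pure_def)
  then show ?thesis
    using f by (simp add: sw_eval pure_def mforms_2I)
qed

abbreviation cp :: "'k \<Rightarrow> ('k \<Rightarrow> 'k \<Rightarrow> 'a::comm_monoid_add) \<Rightarrow> 'a" where
  "cp h \<equiv> sw (cop H h)"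

lemmas cp_eval = sw_eval[OF cop_in]

lemma lin_cp: "bilin f \<Longrightarrow> klin g \<Longrightarrow> lin (\<lambda>h. cp (g h) f)"
  using mforms_2I[of f] by (simp add: lin_def klin_def cp_eval cop_linear)

lemma tens_mult_eval:
  assumes x: "x \<in> tensor_power H 2" and y: "y \<in> tensor_power H 2" and f: "bilin f"
  shows "tens_mult H 2 x y (\<lambda>r. f (r 1) (r 2)) = sw x (\<lambda>a b. sw y (\<lambda>c d. f (a * c) (b * d)))"
proof -
  have 1: "bilin (\<lambda>c d. f (a * c) (b * d))" for a b
    by (intro bilinI bilin_comp1[OF f] bilin_comp2[OF f] lin_intros)
  have 2: "bilin (\<lambda>a b. sw y (\<lambda>c d. f (a * c) (b * d)))"
    by (intro bilinI lin_sw bilin_comp1[OF f] bilin_comp2[OF f] lin_intros)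
  have "tens_mult H 2 x y (\<lambda>r. f (r 1) (r 2)) =
      x (\<lambda>k. y (\<lambda>l. f (k 1 * l 1) (k 2 * l 2)))"
    using mforms_2I[OF f] by (simp add: tens_mult_def)
  also have "\<dots> = x (\<lambda>k. sw y (\<lambda>c d. f (k 1 * c) (k 2 * d)))"
    by (simp only: sw_eval[OF y 1])
  also have "\<dots> = sw x (\<lambda>a b. sw y (\<lambda>c d. f (a * c) (b * d)))"
    by (rule sw_eval[OF x 2, symmetric])
  finally show ?thesis .
qed

lemma cp_mult:
  assumes f: "bilin f"
  shows "cp (x * y) f = cp x (\<lambda>a b. cp y (\<lambda>c d. f (a * c) (b * d)))"
proof -
  have "cp (x * y) f = cop H (x * y) (\<lambda>r. f (r 1) (r 2))"
    by (rule cp_eval[OF f])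
  also have "\<dots> = cp x (\<lambda>a b. cp y (\<lambda>c d. f (a * c) (b * d)))"
    unfolding cop_mult by (rule tens_mult_eval[OF cop_in cop_in f])
  finally show ?thesis .
qed

lemma cp_one: "bilin f \<Longrightarrow> cp 1 f = f 1 1"
  by (simp add: cop_one tens_one_def sw_pure)

lemma bilin_of_trilin:
  assumes f: "trilin f"
  shows "bilin (\<lambda>a b. f a b c)" "bilin (\<lambda>a b. f a c b)" "bilin (f c)"
  using f by (simp_all add: trilin_def bilin_def)

lemma cop_id_eval:
  assumes x: "x \<in> tensor_power H 2" and f: "trilin f"
  shows "cop_id H x (\<lambda>r. f (r 1) (r 2) (r 3)) = sw x (\<lambda>a b. cp a (\<lambda>c d. f c d b))"
proof -
  have "bilin (\<lambda>a b. cp a (\<lambda>c d. f c d b))"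
    by (intro bilinI lin_cp bilin_of_trilin[OF f] lin_sw trilin_comp3[OF f] lin_intros)
  then show ?thesis
    using mforms_3I[OF f] by (simp add: cop_id_def tup_3 sw_eval[OF x] cp_eval bilin_of_trilin[OF f])
qed

lemma id_cop_eval:
  assumes x: "x \<in> tensor_power H 2" and f: "trilin f"
  shows "id_cop H x (\<lambda>r. f (r 1) (r 2) (r 3)) = sw x (\<lambda>a b. cp b (\<lambda>c d. f a c d))"
proof -
  have "bilin (\<lambda>a b. cp b (\<lambda>c d. f a c d))"
    by (intro bilinI lin_cp bilin_of_trilin[OF f] lin_sw trilin_comp1[OF f] lin_intros)
  then show ?thesis
    using mforms_3I[OF f] by (simp add: id_cop_def tup_3 sw_eval[OF x] cp_eval bilin_of_trilin[OF f])
qed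

lemma cp_coassoc:
  assumes f: "trilin f"
  shows "cp x (\<lambda>a b. cp a (\<lambda>c d. f c d b)) = cp x (\<lambda>a b. cp b (\<lambda>c d. f a c d))"
  using coassoc[of x] cop_id_eval[OF cop_in f, of x] id_cop_eval[OF cop_in f, of x] by simp

lemma cp_counit_left: "lin \<phi> \<Longrightarrow> cp x (\<lambda>a b. counit H a * \<phi> b) = \<phi> x"
proof -
  assume \<phi>: "lin \<phi>"
  have "lift H (\<lambda>p. scl H (counit H (p 1)) (p 2)) (cop H x) = cp x (\<lambda>a b. scl H (counit H a) b)"
    by (rule lift_eq_sw[OF cop_in]) (auto simp: lin_scl intro!: bilinI lin_intros)
  with counit_left[of x] have "\<phi> x = \<phi> (cp x (\<lambda>a b. scl H (counit H a) b))" by simp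
  with \<phi> show ?thesis by (simp add: lin_of_sw lin_scl)
qed

lemma cp_counit_right: "lin \<phi> \<Longrightarrow> cp x (\<lambda>a b. \<phi> a * counit H b) = \<phi> x"
proof -
  assume \<phi>: "lin \<phi>"
  have "lift H (\<lambda>p. scl H (counit H (p 2)) (p 1)) (cop H x) = cp x (\<lambda>a b. scl H (counit H b) a)"
    by (rule lift_eq_sw[OF cop_in]) (auto simp: lin_scl intro!: bilinI lin_intros)
  with counit_right[of x] have "\<phi> x = \<phi> (cp x (\<lambda>a b. scl H (counit H b) a))" by simp
  with \<phi> show ?thesis by (simp add: lin_of_sw lin_scl mult.commute)
qed

lemma cp_antipode_left: "lin \<phi> \<Longrightarrow> cp x (\<lambda>a b. \<phi> (antipode H a * b)) = counit H x * \<phi> 1"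
proof -
  assume \<phi>: "lin \<phi>"
  have "lift H (\<lambda>p. antipode H (p 1) * p 2) (cop H x) = cp x (\<lambda>a b. antipode H a * b)"
    by (rule lift_eq_sw[OF cop_in]) (rule bilinI; erule lin_comp; intro lin_intros)
  with antipode_left[of x] have "\<phi> (cp x (\<lambda>a b. antipode H a * b)) = \<phi> (scl H (counit H x) 1)"
    by simp
  with \<phi> show ?thesis by (simp add: lin_of_sw lin_scl)
qed

lemma cp_antipode_right: "lin \<phi> \<Longrightarrow> cp x (\<lambda>a b. \<phi> (a * antipode H b)) = counit H x * \<phi> 1"
proof -
  assume \<phi>: "lin \<phi>"
  have "lift H (\<lambda>p. p 1 * antipode H (p 2)) (cop H x) = cp x (\<lambda>a b. a * antipode H b)"
    by (rule lift_eq_sw[OF cop_in]) (rule bilinI; erule lin_comp; intro lin_intros)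
  with antipode_right[of x] have "\<phi> (cp x (\<lambda>a b. a * antipode H b)) = \<phi> (scl H (counit H x) 1)"
    by simp
  with \<phi> show ?thesis by (simp add: lin_of_sw lin_scl)
qed

end


section \<open>The antipode reverses products and coproducts\<close>

context fin_dim_hopf_algebra
begin

text \<open>
  Regrouping \<open>h\<^sub>(\<^sub>1\<^sub>) \<otimes> \<dots> \<otimes> h\<^sub>(\<^sub>4\<^sub>)\<close> so that the two middle factors come from a single coproduct: in this
  form they can be cancelled by the antipode or commuted past \<open>R\<close>.
\<close>

lemma cp_coassoc4:
  assumes g: "\<And>b c d. lin (\<lambda>a. g a b c d)" "\<And>a c d. lin (\<lambda>b. g a b c d)"
    "\<And>a b d. lin (\<lambda>c. g a b c d)" "\<And>a b c. lin (\<lambda>d. g a b c d)"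
  shows "cp h (\<lambda>p q. cp p (\<lambda>a b. cp q (\<lambda>c d. g a b c d))) =
    cp h (\<lambda>a m. cp m (\<lambda>n d. cp n (\<lambda>b c. g a b c d)))"
proof -
  have "cp h (\<lambda>p q. cp p (\<lambda>a b. cp q (\<lambda>c d. g a b c d))) =
      cp h (\<lambda>a m. cp m (\<lambda>b q. cp q (\<lambda>c d. g a b c d)))"
    by (rule cp_coassoc) (intro trilinI lin_sw lin_cp bilinI g klin_id)
  also have "\<dots> = cp h (\<lambda>a m. cp m (\<lambda>n d. cp n (\<lambda>b c. g a b c d)))"
    by (subst cp_coassoc) (intro trilinI g, rule refl)
  finally show ?thesis .
qed

lemma antipode_one: "antipode H 1 = 1"
proof (rule lin_separates)
  fix \<phi> assume \<phi>: "lin \<phi>"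
  have "bilin (\<lambda>a b. \<phi> (antipode H a * b))"
    by (intro bilinI lin_intros lin_comp[OF \<phi>])
  from cp_one[OF this] cp_antipode_left[OF \<phi>, of 1] show "\<phi> (antipode H 1) = \<phi> 1"
    by (simp add: counit_one)
qed

lemma counit_antipode: "counit H (antipode H x) = counit H x"
proof -
  have "counit H x = cp x (\<lambda>a b. counit H (antipode H a) * counit H b)"
    using cp_antipode_left[OF lin_counit, of x] by (simp add: counit_mult counit_one)
  also have "\<dots> = counit H (antipode H x)"
    by (rule cp_counit_right) (intro lin_intros)
  finally show ?thesis by simp
qed

text \<open>
  Both sides are convolution inverse to the multiplication \<open>K \<otimes> K \<rightarrow> K\<close>: bracketing
  \<open>S(x\<^sub>(\<^sub>1\<^sub>)y\<^sub>(\<^sub>1\<^sub>)) x\<^sub>(\<^sub>2\<^sub>)y\<^sub>(\<^sub>2\<^sub>) S(y\<^sub>(\<^sub>3\<^sub>))S(x\<^sub>(\<^sub>3\<^sub>))\<close> in the two possible ways cancels one or the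
  other factor.
\<close>

lemma antipode_mult: "antipode H (x * y) = antipode H y * antipode H x"
proof (rule lin_separates)
  fix \<phi> assume \<phi>: "lin \<phi>"
  let ?S = "antipode H"
  define F where "F a c p q r s = \<phi> (?S (a * c) * (p * (r * (?S s * ?S q))))" for a c p q r s
  have lF: "lin (\<lambda>a. F a c p q r s)" "lin (\<lambda>c. F a c p q r s)" "lin (\<lambda>p. F a c p q r s)"
    "lin (\<lambda>q. F a c p q r s)" "lin (\<lambda>r. F a c p q r s)" "lin (\<lambda>s. F a c p q r s)" for a c p q r s
    unfolding F_def by (intro lin_intros lin_comp[OF \<phi>])+
  have "cp b (\<lambda>p q. cp d (\<lambda>r s. F a c p q r s)) = \<phi> (?S (a * c)) * counit H d * counit H b" for a b c d
  proof -
    have "cp d (\<lambda>r s. F a c p q r s) = counit H d * \<phi> (?S (a * c) * (p * ?S q))" for p q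
      using cp_antipode_right[of "\<lambda>z. \<phi> (?S (a * c) * (p * (z * ?S q)))" d]
      by (simp add: F_def mult.assoc lin_intros lin_comp[OF \<phi>])
    moreover have "cp b (\<lambda>p q. \<phi> (?S (a * c) * (p * ?S q))) = counit H b * \<phi> (?S (a * c))"
      using cp_antipode_right[of "\<lambda>z. \<phi> (?S (a * c) * z)" b]
      by (simp add: lin_intros lin_comp[OF \<phi>])
    ultimately show ?thesis by (simp add: sw_cmult mult_ac)
  qed
  then have "cp x (\<lambda>a b. cp y (\<lambda>c d. cp b (\<lambda>p q. cp d (\<lambda>r s. F a c p q r s)))) =
      cp x (\<lambda>a b. cp y (\<lambda>c d. \<phi> (?S (a * c)) * counit H d) * counit H b)"
    by (simp add: sw_multc)
  also have "\<dots> = cp x (\<lambda>a b. \<phi> (?S (a * y)) * counit H b)"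
    by (subst cp_counit_right) (intro lin_intros lin_comp[OF \<phi>], rule refl)
  also have "\<dots> = \<phi> (?S (x * y))"
    by (rule cp_counit_right) (intro lin_intros lin_comp[OF \<phi>])
  finally have 1: "cp x (\<lambda>a b. cp y (\<lambda>c d. cp b (\<lambda>p q. cp d (\<lambda>r s. F a c p q r s)))) =
      \<phi> (?S (x * y))" .
  have "cp x (\<lambda>a b. cp y (\<lambda>c d. cp b (\<lambda>p q. cp d (\<lambda>r s. F a c p q r s)))) =
      cp x (\<lambda>a b. cp b (\<lambda>p q. cp y (\<lambda>c d. cp d (\<lambda>r s. F a c p q r s))))"
    by (subst sw_swap) (rule refl)
  also have "\<dots> = cp x (\<lambda>b q. cp b (\<lambda>a p. cp y (\<lambda>c d. cp d (\<lambda>r s. F a c p q r s))))"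
    by (rule cp_coassoc[symmetric]) (intro trilinI lin_sw lF)
  also have "\<dots> = cp x (\<lambda>b q. cp b (\<lambda>a p. cp y (\<lambda>d s. cp d (\<lambda>c r. F a c p q r s))))"
    by (subst cp_coassoc) (intro trilinI lF, rule refl)
  also have "\<dots> = cp x (\<lambda>b q. cp y (\<lambda>d s. cp b (\<lambda>a p. cp d (\<lambda>c r. F a c p q r s))))"
    by (subst sw_swap) (rule refl)
  also have "\<dots> = cp x (\<lambda>b q. cp y (\<lambda>d s. counit H b * (counit H d * \<phi> (?S s * ?S q))))"
  proof -
    have "cp b (\<lambda>a p. cp d (\<lambda>c r. F a c p q r s)) = counit H b * (counit H d * \<phi> (?S s * ?S q))"
      for b d q s
    proof -
      have "bilin (\<lambda>u v. \<phi> (?S u * (v * (?S s * ?S q))))"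
        by (intro bilinI lin_intros lin_comp[OF \<phi>])
      from cp_mult[OF this, of b d]
      show ?thesis using cp_antipode_left[of "\<lambda>z. \<phi> (z * (?S s * ?S q))" "b * d"]
        by (simp add: F_def mult.assoc lin_intros lin_comp[OF \<phi>] counit_mult)
    qed
    then show ?thesis by simp
  qed
  also have "\<dots> = cp x (\<lambda>b q. counit H b * \<phi> (?S y * ?S q))"
    by (subst sw_cmult, subst cp_counit_left) (intro lin_intros lin_comp[OF \<phi>], rule refl)
  also have "\<dots> = \<phi> (?S y * ?S x)"
    by (rule cp_counit_left) (intro lin_intros lin_comp[OF \<phi>])
  finally show "\<phi> (?S (x * y)) = \<phi> (?S y * ?S x)"
    by (simp add: 1)
qed

text \<open>
  Both sides are convolution inverse to \<open>\<Delta> : K \<rightarrow> K \<otimes> K\<close>, as is seen by bracketing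
  \<open>\<Delta>(S(x\<^sub>(\<^sub>1\<^sub>))) \<Delta>(x\<^sub>(\<^sub>2\<^sub>)) (S(x\<^sub>(\<^sub>4\<^sub>)) \<otimes> S(x\<^sub>(\<^sub>3\<^sub>)))\<close> in the two possible ways.
\<close>

lemma cp_antipode:
  assumes f: "bilin f"
  shows "cp (antipode H x) f = cp x (\<lambda>a b. f (antipode H b) (antipode H a))"
proof -
  let ?S = "antipode H"
  note fl = bilin_comp1[OF f] bilin_comp2[OF f]
  define g where "g c d p1 p2 q1 q2 = f (c * (p1 * ?S q2)) (d * (p2 * ?S q1))" for c d p1 p2 q1 q2
  have lg: "lin (\<lambda>c. g c d p1 p2 q1 q2)" "lin (\<lambda>d. g c d p1 p2 q1 q2)"
    "lin (\<lambda>p1. g c d p1 p2 q1 q2)" "lin (\<lambda>p2. g c d p1 p2 q1 q2)"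
    "lin (\<lambda>q1. g c d p1 p2 q1 q2)" "lin (\<lambda>q2. g c d p1 p2 q1 q2)" for c d p1 p2 q1 q2
    unfolding g_def by (intro lin_intros fl)+
  define T where "T = cp x (\<lambda>a b. cp (?S a) (\<lambda>c d.
      cp b (\<lambda>p q. cp p (\<lambda>p1 p2. cp q (\<lambda>q1 q2. g c d p1 p2 q1 q2)))))"
  have "cp b (\<lambda>p q. cp p (\<lambda>p1 p2. cp q (\<lambda>q1 q2. g c d p1 p2 q1 q2))) = f c d * counit H b"
    for b c d
  proof -
    have "cp b (\<lambda>p q. cp p (\<lambda>p1 p2. cp q (\<lambda>q1 q2. g c d p1 p2 q1 q2))) =
        cp b (\<lambda>p1 m. cp m (\<lambda>n q2. cp n (\<lambda>p2 q1. g c d p1 p2 q1 q2)))"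
      by (rule cp_coassoc4) (rule lg)+
    also have "\<dots> = cp b (\<lambda>p1 m. f (c * (p1 * ?S m)) d)"
    proof -
      have "cp n (\<lambda>p2 q1. g c d p1 p2 q1 q2) = counit H n * f (c * (p1 * ?S q2)) d" for n p1 q2
        using cp_antipode_right[of "\<lambda>z. f (c * (p1 * ?S q2)) (d * z)" n]
        by (simp add: g_def lin_intros fl)
      moreover have "cp m (\<lambda>n q2. counit H n * f (c * (p1 * ?S q2)) d) = f (c * (p1 * ?S m)) d" for p1 m
        by (rule cp_counit_left) (intro lin_intros fl)
      ultimately show ?thesis by simp
    qed
    also have "\<dots> = counit H b * f c d"
      using cp_antipode_right[of "\<lambda>z. f (c * z) d" b] by (simp add: lin_intros fl)
    finally show ?thesis by (simp add: mult.commute)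
  qed
  then have "T = cp x (\<lambda>a b. cp (?S a) f * counit H b)"
    by (simp add: T_def sw_multc)
  also have "\<dots> = cp (?S x) f"
    by (rule cp_counit_right) (intro lin_cp f klin_antipode klin_id)
  finally have 1: "T = cp (?S x) f" .
  have "T = cp x (\<lambda>a b. cp b (\<lambda>p q. cp (?S a) (\<lambda>c d.
      cp p (\<lambda>p1 p2. cp q (\<lambda>q1 q2. g c d p1 p2 q1 q2)))))"
    unfolding T_def by (subst sw_swap) (rule refl)
  also have "\<dots> = cp x (\<lambda>e q. cp e (\<lambda>a p. cp (?S a) (\<lambda>c d.
      cp p (\<lambda>p1 p2. cp q (\<lambda>q1 q2. g c d p1 p2 q1 q2)))))"
  proof (rule cp_coassoc[symmetric], rule trilinI)
    show "lin (\<lambda>a. cp (?S a) (\<lambda>c d. cp p (\<lambda>p1 p2. cp q (\<lambda>q1 q2. g c d p1 p2 q1 q2))))" for p q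
      by (rule lin_cp) (intro bilinI lin_sw lg klin_antipode klin_id)+
    show "lin (\<lambda>p. cp (?S a) (\<lambda>c d. cp p (\<lambda>p1 p2. cp q (\<lambda>q1 q2. g c d p1 p2 q1 q2))))" for a q
      by (rule lin_sw, rule lin_cp) (intro bilinI lin_sw lg klin_id)+
    show "lin (\<lambda>q. cp (?S a) (\<lambda>c d. cp p (\<lambda>p1 p2. cp q (\<lambda>q1 q2. g c d p1 p2 q1 q2))))" for a p
      by (rule lin_sw, rule lin_sw, rule lin_cp) (intro bilinI lin_sw lg klin_id)+
  qed
  also have "\<dots> = cp x (\<lambda>e q. counit H e * cp q (\<lambda>q1 q2. f (?S q2) (?S q1)))"
  proof -
    define h where "h q u v = cp q (\<lambda>q1 q2. f (u * ?S q2) (v * ?S q1))" for q u v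
    have h: "bilin (h q)" for q
      unfolding h_def by (intro bilinI lin_sw lin_intros fl)
    have "cp (?S a) (\<lambda>c d. cp p (\<lambda>p1 p2. cp q (\<lambda>q1 q2. g c d p1 p2 q1 q2))) = cp (?S a * p) (h q)"
      for a p q
      by (simp add: cp_mult[OF h]) (simp add: h_def g_def mult.assoc)
    moreover have "cp e (\<lambda>a p. cp (?S a * p) (h q)) = counit H e * h q 1 1" for e q
      by (subst cp_antipode_left) (intro lin_cp h klin_id, simp add: cp_one[OF h])
    ultimately show ?thesis by (simp add: h_def)
  qed
  also have "\<dots> = cp x (\<lambda>q1 q2. f (?S q2) (?S q1))"
    by (rule cp_counit_left) (intro lin_cp klin_id bilinI lin_intros fl)
  finally show ?thesis by (simp add: 1)
qed

end


section \<open>R-matrices\<close>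

locale quasitriangular_hopf_algebra = fin_dim_hopf_algebra H
  for H :: "('f::field, 'k::ring_1) hopf" +
  fixes R :: "('f, 'k) tens"
  assumes R_matrix: "R_matrix H R"
begin

lemma R_in: "R \<in> tensor_power H 2"
  using R_matrix by (simp add: R_matrix_def tens_invertible_def)

lemma R_cop:
  assumes f: "bilin f"
  shows "sw R (\<lambda>a b. cp h (\<lambda>c d. f (a * c) (b * d))) = cp h (\<lambda>c d. sw R (\<lambda>a b. f (d * a) (c * b)))"
proof -
  note fl = bilin_comp1[OF f] bilin_comp2[OF f]
  let ?f = "\<lambda>r. f (r 1) (r 2)"
  have 1: "R (\<lambda>l. f (x * l 1) (y * l 2)) = sw R (\<lambda>a b. f (x * a) (y * b))" for x y
    by (rule sw_eval[OF R_in, symmetric]) (intro bilinI lin_intros fl)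
  have 2: "(\<lambda>k. sw R (\<lambda>a b. f (k 1 * a) (k 2 * b))) \<in> mforms H 2"
    by (rule mforms_2I) (intro bilinI lin_sw lin_intros fl)
  have "sw R (\<lambda>a b. cp h (\<lambda>c d. f (a * c) (b * d))) = tens_mult H 2 R (cop H h) ?f"
    by (rule tens_mult_eval[OF R_in cop_in f, symmetric])
  also have "\<dots> = tens_mult H 2 (cop_op H h) R ?f"
    using R_matrix by (simp add: R_matrix_def)
  also have "\<dots> = cop H h (\<lambda>r. sw R (\<lambda>a b. f (r 2 * a) (r 1 * b)))"
    using mforms_2I[OF f] 2 by (simp add: tens_mult_def cop_op_def place2_def 1)
  also have "\<dots> = cp h (\<lambda>c d. sw R (\<lambda>a b. f (d * a) (c * b)))"
    by (rule cp_eval[symmetric]) (intro bilinI lin_sw lin_intros fl)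
  finally show ?thesis .
qed

lemma place2_eval:
  assumes f: "trilin f"
  shows "place2 H 3 1 2 R (\<lambda>r. f (r 1) (r 2) (r 3)) = sw R (\<lambda>a b. f a b 1)"
    and "place2 H 3 1 3 R (\<lambda>r. f (r 1) (r 2) (r 3)) = sw R (\<lambda>a b. f a 1 b)"
    and "place2 H 3 2 3 R (\<lambda>r. f (r 1) (r 2) (r 3)) = sw R (\<lambda>a b. f 1 a b)"
  using mforms_3I[OF f] by (simp_all add: place2_def sw_eval[OF R_in] bilin_of_trilin[OF f])

lemma R_cop_id:
  assumes f: "trilin f"
  shows "sw R (\<lambda>a b. cp a (\<lambda>c d. f c d b)) = sw R (\<lambda>a b. sw R (\<lambda>c d. f a c (b * d)))"
proof -
  note fl = trilin_comp1[OF f] trilin_comp2[OF f] trilin_comp3[OF f]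
  have 1: "trilin (\<lambda>a b c. f (k 1 * a) (k 2 * b) (k 3 * c))" for k :: "nat \<Rightarrow> 'k"
    by (intro trilinI lin_intros fl)
  have 2: "trilin (\<lambda>k1 k2 k3. sw R (\<lambda>a b. f k1 (k2 * a) (k3 * b)))"
    by (intro trilinI lin_sw lin_intros fl)
  have "sw R (\<lambda>a b. cp a (\<lambda>c d. f c d b)) =
      tens_mult H 3 (place2 H 3 1 3 R) (place2 H 3 2 3 R) (\<lambda>r. f (r 1) (r 2) (r 3))"
    using R_matrix by (simp add: R_matrix_def cop_id_eval[OF R_in f, symmetric])
  also have "\<dots> = place2 H 3 1 3 R (\<lambda>k. place2 H 3 2 3 R (\<lambda>l. f (k 1 * l 1) (k 2 * l 2) (k 3 * l 3)))"
    using mforms_3I[OF f] by (simp add: tens_mult_def)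
  also have "\<dots> = sw R (\<lambda>a b. sw R (\<lambda>c d. f a c (b * d)))"
    using place2_eval(2)[OF 2] by (simp add: place2_eval(3)[OF 1])
  finally show ?thesis .
qed

lemma R_id_cop:
  assumes f: "trilin f"
  shows "sw R (\<lambda>a b. cp b (\<lambda>c d. f a c d)) = sw R (\<lambda>a b. sw R (\<lambda>c d. f (a * c) d b))"
proof -
  note fl = trilin_comp1[OF f] trilin_comp2[OF f] trilin_comp3[OF f]
  have 1: "trilin (\<lambda>a b c. f (k 1 * a) (k 2 * b) (k 3 * c))" for k :: "nat \<Rightarrow> 'k"
    by (intro trilinI lin_intros fl)
  have 2: "trilin (\<lambda>k1 k2 k3. sw R (\<lambda>a b. f (k1 * a) (k2 * b) k3))"
    by (intro trilinI lin_sw lin_intros fl)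
  have "sw R (\<lambda>a b. cp b (\<lambda>c d. f a c d)) =
      tens_mult H 3 (place2 H 3 1 3 R) (place2 H 3 1 2 R) (\<lambda>r. f (r 1) (r 2) (r 3))"
    using R_matrix by (simp add: R_matrix_def id_cop_eval[OF R_in f, symmetric])
  also have "\<dots> = place2 H 3 1 3 R (\<lambda>k. place2 H 3 1 2 R (\<lambda>l. f (k 1 * l 1) (k 2 * l 2) (k 3 * l 3)))"
    using mforms_3I[OF f] by (simp add: tens_mult_def)
  also have "\<dots> = sw R (\<lambda>a b. sw R (\<lambda>c d. f (a * c) d b))"
    using place2_eval(2)[OF 2] by (simp add: place2_eval(1)[OF 1])
  finally show ?thesis .
qed

lemma R_right_inverse:
  obtains Ri where "\<And>f. bilin f \<Longrightarrow> sw R (\<lambda>a b. sw Ri (\<lambda>c d. f (a * c) (b * d))) = f 1 1"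
proof -
  obtain Ri where Ri: "Ri \<in> tensor_power H 2" "tens_mult H 2 R Ri = tens_one H 2"
    using R_matrix by (auto simp: R_matrix_def tens_invertible_def)
  have "sw R (\<lambda>a b. sw Ri (\<lambda>c d. f (a * c) (b * d))) = f 1 1" if f: "bilin f" for f
    using tens_mult_eval[OF R_in Ri(1) f] mforms_2I[OF f]
    by (simp add: Ri(2) tens_one_def pure_def)
  then show thesis by (rule that)
qed

text \<open>
  Applying \<open>\<epsilon>\<close> to the first factor of \<open>(\<Delta> \<otimes> id)(R) = R\<^sub>1\<^sub>3R\<^sub>2\<^sub>3\<close> yields \<open>R = (1 \<otimes> e)R\<close> for
  \<open>e = (\<epsilon> \<otimes> id)(R)\<close>, whence \<open>e = 1\<close> because \<open>R\<close> is invertible. The other factor is analogous.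
\<close>

lemma R_counit_left:
  assumes \<phi>: "lin \<phi>"
  shows "sw R (\<lambda>a b. counit H a * \<phi> b) = \<phi> 1"
proof -
  obtain Ri where Ri: "\<And>f. bilin f \<Longrightarrow> sw R (\<lambda>a b. sw Ri (\<lambda>c d. f (a * c) (b * d))) = f 1 1"
    using R_right_inverse by blast
  have R: "sw R f = sw R (\<lambda>a b. counit H a * sw R (\<lambda>c d. f c (b * d)))" if f: "bilin f" for f
  proof -
    note fl = bilin_comp1[OF f] bilin_comp2[OF f]
    have "sw R f = sw R (\<lambda>a b. cp a (\<lambda>c d. counit H c * f d b))"
      by (subst cp_counit_left) (rule bilin_lin1[OF f], rule refl)
    also have "\<dots> = sw R (\<lambda>a b. sw R (\<lambda>c d. counit H a * f c (b * d)))"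
      by (rule R_cop_id) (intro trilinI lin_intros fl)
    finally show ?thesis by (simp add: sw_cmult)
  qed
  have b: "bilin (\<lambda>x y. counit H x * \<phi> y)"
    by (intro bilinI lin_intros lin_comp[OF \<phi>])
  have "\<phi> 1 = sw R (\<lambda>a b. sw Ri (\<lambda>c d. counit H (a * c) * \<phi> (b * d)))"
    by (simp add: Ri[OF b] counit_one)
  also have "\<dots> = sw R (\<lambda>a b. counit H a * sw R (\<lambda>p q. sw Ri (\<lambda>c d. counit H (p * c) * \<phi> (b * (q * d)))))"
    by (subst R) (intro bilinI lin_sw lin_intros lin_comp[OF \<phi>], simp add: mult.assoc)
  also have "\<dots> = sw R (\<lambda>a b. counit H a * \<phi> b)"
  proof -
    have "bilin (\<lambda>x y. counit H x * \<phi> (b * y))" for b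
      by (intro bilinI lin_intros lin_comp[OF \<phi>])
    from Ri[OF this] show ?thesis by (simp add: counit_one)
  qed
  finally show ?thesis by simp
qed

lemma R_counit_right:
  assumes \<phi>: "lin \<phi>"
  shows "sw R (\<lambda>a b. \<phi> a * counit H b) = \<phi> 1"
proof -
  obtain Ri where Ri: "\<And>f. bilin f \<Longrightarrow> sw R (\<lambda>a b. sw Ri (\<lambda>c d. f (a * c) (b * d))) = f 1 1"
    using R_right_inverse by blast
  have R: "sw R f = sw R (\<lambda>a b. sw R (\<lambda>c d. f (a * c) d) * counit H b)" if f: "bilin f" for f
  proof -
    note fl = bilin_comp1[OF f] bilin_comp2[OF f]
    have "sw R f = sw R (\<lambda>a b. cp b (\<lambda>c d. f a c * counit H d))"
      by (subst cp_counit_right) (rule bilin_lin2[OF f], rule refl)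
    also have "\<dots> = sw R (\<lambda>a b. sw R (\<lambda>c d. f (a * c) d * counit H b))"
      by (rule R_id_cop) (intro trilinI lin_intros fl)
    finally show ?thesis by (simp add: sw_multc)
  qed
  have b: "bilin (\<lambda>x y. \<phi> x * counit H y)"
    by (intro bilinI lin_intros lin_comp[OF \<phi>])
  have "\<phi> 1 = sw R (\<lambda>a b. sw Ri (\<lambda>c d. \<phi> (a * c) * counit H (b * d)))"
    by (simp add: Ri[OF b] counit_one)
  also have "\<dots> = sw R (\<lambda>a b. sw R (\<lambda>p q. sw Ri (\<lambda>c d. \<phi> (a * (p * c)) * counit H (q * d))) * counit H b)"
    by (subst R) (intro bilinI lin_sw lin_intros lin_comp[OF \<phi>], simp add: mult.assoc)
  also have "\<dots> = sw R (\<lambda>a b. \<phi> a * counit H b)"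
  proof -
    have "bilin (\<lambda>x y. \<phi> (a * x) * counit H y)" for a
      by (intro bilinI lin_intros lin_comp[OF \<phi>])
    from Ri[OF this] show ?thesis by (simp add: counit_one)
  qed
  finally show ?thesis by simp
qed

text \<open>
  The Yang-Baxter equation \<open>R\<^sub>1\<^sub>2R\<^sub>1\<^sub>3R\<^sub>2\<^sub>3 = R\<^sub>2\<^sub>3R\<^sub>1\<^sub>3R\<^sub>1\<^sub>2\<close>: both sides equal
  \<open>R\<^sub>1\<^sub>2 (\<Delta> \<otimes> id)(R) = (\<Delta>\<^sup>o\<^sup>p \<otimes> id)(R) R\<^sub>1\<^sub>2\<close>.
\<close>

lemma R_yang_baxter:
  assumes f: "trilin f"
  shows "sw R (\<lambda>a b. sw R (\<lambda>c d. sw R (\<lambda>p q. f (a * c) (b * p) (d * q)))) =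
    sw R (\<lambda>p q. sw R (\<lambda>c d. sw R (\<lambda>a b. f (c * a) (p * b) (q * d))))"
proof -
  note fl = trilin_comp1[OF f] trilin_comp2[OF f] trilin_comp3[OF f]
  have "sw R (\<lambda>a b. sw R (\<lambda>c d. sw R (\<lambda>p q. f (a * c) (b * p) (d * q)))) =
      sw R (\<lambda>a b. sw R (\<lambda>c d. cp c (\<lambda>x y. f (a * x) (b * y) d)))"
    by (subst R_cop_id) (intro trilinI lin_intros fl, rule refl)
  also have "\<dots> = sw R (\<lambda>c d. sw R (\<lambda>a b. cp c (\<lambda>x y. f (a * x) (b * y) d)))"
    by (rule sw_swap)
  also have "\<dots> = sw R (\<lambda>c d. cp c (\<lambda>x y. sw R (\<lambda>a b. f (y * a) (x * b) d)))"
    by (subst R_cop) (rule bilin_of_trilin[OF f], rule refl)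
  also have "\<dots> = sw R (\<lambda>p q. sw R (\<lambda>c d. sw R (\<lambda>a b. f (c * a) (p * b) (q * d))))"
    by (rule R_cop_id) (intro trilinI lin_sw lin_intros fl)
  finally show ?thesis .
qed

end


section \<open>Linear operators on spaces of functions\<close>

definition flin :: "(('a \<Rightarrow> 'f::field) \<Rightarrow> 'b \<Rightarrow> 'f) \<Rightarrow> bool" where
  "flin F \<longleftrightarrow> (\<forall>c A B. F (\<lambda>k. c * A k + B k) = (\<lambda>k. c * F A k + F B k))"

lemma flinD: "flin F \<Longrightarrow> F (\<lambda>k. c * A k + B k) = (\<lambda>k. c * F A k + F B k)"
  by (simp add: flin_def)

lemma flin_zero: "flin F \<Longrightarrow> F (\<lambda>k. 0) = (\<lambda>k. 0)"
  using flinD[of F "- 1" "\<lambda>k. 0" "\<lambda>k. 0"] by simp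

lemma flin_scale: "flin F \<Longrightarrow> F (\<lambda>k. c * A k) = (\<lambda>k. c * F A k)"
  using flinD[of F c A "\<lambda>k. 0"] by (simp add: flin_zero)

lemma flin_scale_right: "flin F \<Longrightarrow> F (\<lambda>k. A k * c) = (\<lambda>k. F A k * c)"
  using flin_scale[of F c A] by (simp add: mult.commute)

lemma flin_add: "flin F \<Longrightarrow> F (\<lambda>k. A k + B k) = (\<lambda>k. F A k + F B k)"
  using flinD[of F 1 A B] by simp

lemma flin_sum: "flin F \<Longrightarrow> F (\<lambda>k. \<Sum>i\<in>I. G i k) = (\<lambda>k. \<Sum>i\<in>I. F (G i) k)"
proof (induction I rule: infinite_finite_induct)
  case (insert i I)
  then show ?case using flin_add[of F "G i" "\<lambda>k. \<Sum>i\<in>I. G i k"] by simp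
qed (simp_all add: flin_zero)

definition lincomb_closed :: "('a \<Rightarrow> 'f::field) set \<Rightarrow> bool" where
  "lincomb_closed D \<longleftrightarrow> D \<noteq> {} \<and> (\<forall>c. \<forall>A\<in>D. \<forall>B\<in>D. (\<lambda>k. c * A k + B k) \<in> D)"

lemma lincomb_closedD: "lincomb_closed D \<Longrightarrow> A \<in> D \<Longrightarrow> B \<in> D \<Longrightarrow> (\<lambda>k. c * A k + B k) \<in> D"
  by (simp add: lincomb_closed_def)

lemma lincomb_closed_zero: "lincomb_closed D \<Longrightarrow> (\<lambda>k. 0) \<in> D"
proof -
  assume D: "lincomb_closed D"
  then obtain A where "A \<in> D" by (auto simp: lincomb_closed_def)
  from lincomb_closedD[OF D this this, of "- 1"] show ?thesis by simp
qed

lemma lincomb_closed_scale: "lincomb_closed D \<Longrightarrow> A \<in> D \<Longrightarrow> (\<lambda>k. c * A k) \<in> D"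
  using lincomb_closedD[of D A "\<lambda>k. 0" c] lincomb_closed_zero[of D] by simp

lemma lincomb_closed_sum:
  assumes D: "lincomb_closed D" and G: "\<And>i. i \<in> I \<Longrightarrow> G i \<in> D"
  shows "(\<lambda>k. \<Sum>i\<in>I. G i k) \<in> D"
  using G
proof (induction I rule: infinite_finite_induct)
  case (insert i I)
  then show ?case using lincomb_closedD[OF D, of "G i" "\<lambda>k. \<Sum>i\<in>I. G i k" 1] by simp
qed (simp_all add: lincomb_closed_zero[OF D])

text \<open>
  Both \<open>K\<^sup>*\<^sup>\<otimes>\<^sup>n\<close> (combinations of pure tensors) and \<open>K\<^sup>\<otimes>\<^sup>n\<close> (combinations of
  evaluations, restricted to multilinear forms) arise from spaces of this shape.
\<close>

lemma lincomb_closed_finite_sums: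
  fixes g :: "'b \<Rightarrow> 'a \<Rightarrow> 'f::field"
  shows "lincomb_closed {A. \<exists>(m::nat) c a. (\<forall>p<m. P (a p)) \<and> A = (\<lambda>k. \<Sum>p<m. c p * g (a p) k)}"
    (is "lincomb_closed ?D")
  unfolding lincomb_closed_def
proof (intro conjI allI ballI)
  have "(\<lambda>k. 0) \<in> ?D"
    by (rule CollectI, rule exI[of _ 0]) simp
  then show "?D \<noteq> {}" by blast
  fix e A B assume "A \<in> ?D" "B \<in> ?D"
  then obtain m :: nat and c a and l :: nat and d b where
    A: "\<forall>p<m. P (a p)" "A = (\<lambda>k. \<Sum>p<m. c p * g (a p) k)" and
    B: "\<forall>p<l. P (b p)" "B = (\<lambda>k. \<Sum>p<l. d p * g (b p) k)"
    by blast
  define c' a' where "c' p = (if p < m then e * c p else d (p - m))"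
    and "a' p = (if p < m then a p else b (p - m))" for p
  have "(\<Sum>p<m + l'. c' p * g (a' p) k) =
      (\<Sum>p<m. c' p * g (a' p) k) + (\<Sum>p<l'. d p * g (b p) k)" for l' k
    by (induction l') (simp_all add: c'_def a'_def)
  moreover have "(\<Sum>p<m. c' p * g (a' p) k) = e * A k" for k
    by (simp add: A(2) c'_def a'_def sum_distrib_left mult.assoc)
  ultimately have "(\<lambda>k. e * A k + B k) = (\<lambda>k. \<Sum>p<m + l. c' p * g (a' p) k)"
    by (simp add: B(2))
  moreover have "\<forall>p<m + l. P (a' p)"
    using A(1) B(1) by (auto simp: a'_def)
  ultimately show "(\<lambda>k. e * A k + B k) \<in> ?D"
    by blast
qed

context fin_dim_hopf_algebra
begin

lemma flin_sw:
  assumes F: "flin F"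
  shows "F (\<lambda>k. sw t (\<lambda>a b. G a b k)) = (\<lambda>k. sw t (\<lambda>a b. F (G a b) k))"
  unfolding sw_def by (cases "SOME r. represents r t") (simp add: flin_sum[OF F])

lemma lincomb_closed_sw: "lincomb_closed D \<Longrightarrow> (\<And>a b. G a b \<in> D) \<Longrightarrow> (\<lambda>k. sw t (\<lambda>a b. G a b k)) \<in> D"
  unfolding sw_def by (cases "SOME r. represents r t") (simp add: lincomb_closed_sum)

lemma lin_flin:
  assumes G: "flin G" and F: "\<And>k. lin (\<lambda>h. F h k)"
  shows "lin (\<lambda>h. G (F h) k)"
proof -
  have "F (scl H c x + y) = (\<lambda>k. c * F x k + F y k)" for c x y
    using F by (auto simp: lin_def)
  then show ?thesis by (simp add: lin_def flinD[OF G])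
qed

end


section \<open>Module algebras of functions\<close>

text \<open>
  A right module algebra over \<open>K\<close> whose underlying space \<open>D\<close> consists of functions. The operations
  are required to be linear on all functions and not only on \<open>D\<close>, so that they commute with
  Sweedler sums without any proof that the summands lie in \<open>D\<close>.
\<close>

locale module_algebra = fin_dim_hopf_algebra H
  for H :: "('f::field, 'k::ring_1) hopf" +
  fixes D :: "('a \<Rightarrow> 'f) set"
    and mul :: "('a \<Rightarrow> 'f) \<Rightarrow> ('a \<Rightarrow> 'f) \<Rightarrow> 'a \<Rightarrow> 'f"
    and one :: "'a \<Rightarrow> 'f"
    and act :: "('a \<Rightarrow> 'f) \<Rightarrow> 'k \<Rightarrow> 'a \<Rightarrow> 'f"
  assumes closed: "lincomb_closed D"
    and one_in: "one \<in> D"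
    and mul_in: "A \<in> D \<Longrightarrow> B \<in> D \<Longrightarrow> mul A B \<in> D"
    and act_in: "A \<in> D \<Longrightarrow> act A h \<in> D"
    and flin_mul_left: "flin (\<lambda>A. mul A B)"
    and flin_mul_right: "flin (mul A)"
    and flin_act: "flin (\<lambda>A. act A h)"
    and lin_act: "A \<in> D \<Longrightarrow> lin (\<lambda>h. act A h k)"
    and mul_assoc: "A \<in> D \<Longrightarrow> B \<in> D \<Longrightarrow> C \<in> D \<Longrightarrow> mul (mul A B) C = mul A (mul B C)"
    and one_mul: "A \<in> D \<Longrightarrow> mul one A = A"
    and mul_one: "A \<in> D \<Longrightarrow> mul A one = A"
    and act_act: "A \<in> D \<Longrightarrow> act A (g * h) = act (act A g) h"
    and act_one: "A \<in> D \<Longrightarrow> act A 1 = A"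
    and one_act: "act one h = (\<lambda>k. counit H h * one k)"
    and act_mul: "A \<in> D \<Longrightarrow> B \<in> D \<Longrightarrow>
      act (mul A B) h = (\<lambda>k. cp h (\<lambda>a b. mul (act A a) (act B b) k))"
begin

lemma lin_actI: "A \<in> D \<Longrightarrow> klin g \<Longrightarrow> lin (\<lambda>h. act A (g h) k)"
  by (rule lin_comp[OF lin_act])

lemmas lin_mul_left = lin_flin[OF flin_mul_left]
lemmas lin_mul_right = lin_flin[OF flin_mul_right]
lemmas lin_act_left = lin_flin[OF flin_act]

lemmas ma_lin_intros = lin_actI lin_mul_left lin_mul_right lin_act_left

end


section \<open>The module algebra structures on the dual of K\<close>

context quasitriangular_hopf_algebra
begin

text \<open>
  All four products on \<open>K\<^sup>*\<close> are dual to a coproduct on \<open>K\<close>. For \<open>s = 0\<close> it is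
  \<open>k \<mapsto> \<Delta>(k)R\<^sub>2\<^sub>1 = R\<^sub>2\<^sub>1\<Delta>\<^sup>o\<^sup>p(k)\<close> for both orientations; for \<open>s \<noteq> 0\<close> it is \<open>\<Delta>\<close> at incoming ends
  and \<open>\<Delta>\<^sup>o\<^sup>p\<close> at outgoing ones.
\<close>

definition end_cop :: "nat \<Rightarrow> nat \<Rightarrow> 'k \<Rightarrow> ('k \<Rightarrow> 'k \<Rightarrow> 'f) \<Rightarrow> 'f" where
  "end_cop s t k f =
     (if s = 0 then cp k (\<lambda>a b. sw R (\<lambda>c d. f (d * b) (c * a)))
      else if t = 0 then cp k f else cp k (\<lambda>a b. f b a))"

definition end_mul :: "nat \<Rightarrow> nat \<Rightarrow> ('k \<Rightarrow> 'f) \<Rightarrow> ('k \<Rightarrow> 'f) \<Rightarrow> 'k \<Rightarrow> 'f" where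
  "end_mul s t \<alpha> \<beta> k = end_cop s t k (\<lambda>a b. \<alpha> a * \<beta> b)"

definition translate :: "nat \<Rightarrow> 'k \<Rightarrow> 'k \<Rightarrow> 'k" where
  "translate t h k = (if t = 0 then h * k else k * antipode H h)"

definition end_act :: "nat \<Rightarrow> ('k \<Rightarrow> 'f) \<Rightarrow> 'k \<Rightarrow> 'k \<Rightarrow> 'f" where
  "end_act t \<alpha> h k = \<alpha> (translate t h k)"

lemma klin_translate: "klin g \<Longrightarrow> klin (\<lambda>h. translate t (g h) k)"
  and klin_translate': "klin g \<Longrightarrow> klin (\<lambda>k. translate t h (g k))"
  unfolding translate_def by (cases "t = 0"; simp add: klin_left klin_right klin_antipode)+

lemma translate_mult: "translate t (g * h) k = translate t g (translate t h k)"
  by (simp add: translate_def antipode_mult mult.assoc)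

lemma translate_one: "translate t 1 k = k"
  by (simp add: translate_def antipode_one)

lemma counit_translate: "counit H (translate t h k) = counit H h * counit H k"
  by (simp add: translate_def counit_mult counit_antipode mult.commute)

lemma end_cop_cmult: "end_cop s t k (\<lambda>a b. c * f a b) = c * end_cop s t k f"
  and end_cop_multc: "end_cop s t k (\<lambda>a b. f a b * c) = end_cop s t k f * c"
  by (simp_all add: end_cop_def sw_cmult sw_multc)

lemma end_cop_add: "end_cop s t k (\<lambda>a b. f a b + g a b) = end_cop s t k f + end_cop s t k g"
  by (simp add: end_cop_def sw_add)

lemma lin_end_cop:
  assumes f: "bilin f" and g: "klin g"
  shows "lin (\<lambda>h. end_cop s t (g h) f)"
proof -
  note fl = bilin_comp1[OF f] bilin_comp2[OF f]
  have "lin (\<lambda>h. cp (g h) (\<lambda>a b. sw R (\<lambda>c d. f (d * b) (c * a))))"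
    by (rule lin_cp[OF _ g]) (intro bilinI lin_sw lin_intros fl)
  moreover have "lin (\<lambda>h. cp (g h) (\<lambda>a b. f b a))"
    by (rule lin_cp[OF _ g]) (intro bilinI lin_intros fl)
  ultimately show ?thesis
    using lin_cp[OF f g] unfolding end_cop_def by (cases "s = 0"; cases "t = 0") simp_all
qed

text \<open>
  For \<open>s = 0\<close> coassociativity is the Yang-Baxter equation: the hexagon identities turn
  the two sides into \<open>R\<^sub>2\<^sub>3R\<^sub>1\<^sub>3R\<^sub>1\<^sub>2\<close> and \<open>R\<^sub>1\<^sub>2R\<^sub>1\<^sub>3R\<^sub>2\<^sub>3\<close>, with the tensor factors in reverse order.
\<close>

lemma end_cop_coassoc:
  assumes f: "trilin f"
  shows "end_cop s t k (\<lambda>a b. end_cop s t a (\<lambda>c d. f c d b)) =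
    end_cop s t k (\<lambda>a b. end_cop s t b (\<lambda>c d. f a c d))"
proof -
  note fl = trilin_comp1[OF f] trilin_comp2[OF f] trilin_comp3[OF f]
  consider "s = 0" | "s \<noteq> 0" "t = 0" | "s \<noteq> 0" "t \<noteq> 0" by blast
  then show ?thesis
  proof cases
    case 1
    have left: "sw R (\<lambda>c d. cp (d * b) (\<lambda>p q. sw R (\<lambda>u v. f (v * q) (u * p) (c * a)))) =
        cp b (\<lambda>p q. sw R (\<lambda>x y. sw R (\<lambda>z w. sw R (\<lambda>u v. f (v * (y * q)) (u * (w * p)) (x * (z * a))))))"
      (is "?l = ?r") for a b
    proof -
      have "?l = sw R (\<lambda>c d. cp d (\<lambda>d1 d2. cp b (\<lambda>p q. sw R (\<lambda>u v. f (v * (d2 * q)) (u * (d1 * p)) (c * a)))))"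
        by (subst cp_mult) (intro bilinI lin_sw lin_intros fl, rule refl)
      also have "\<dots> = sw R (\<lambda>x y. sw R (\<lambda>z w. cp b (\<lambda>p q. sw R (\<lambda>u v. f (v * (y * q)) (u * (w * p)) ((x * z) * a)))))"
        by (rule R_id_cop) (intro trilinI lin_sw lin_intros fl)
      also have "\<dots> = sw R (\<lambda>x y. cp b (\<lambda>p q. sw R (\<lambda>z w. sw R (\<lambda>u v. f (v * (y * q)) (u * (w * p)) (x * (z * a))))))"
        by (subst sw_swap) (simp add: mult.assoc)
      also have "\<dots> = ?r"
        by (rule sw_swap)
      finally show ?thesis .
    qed
    have right: "sw R (\<lambda>c d. cp (c * a) (\<lambda>p q. sw R (\<lambda>u v. f (d * b) (v * q) (u * p)))) =
        cp a (\<lambda>p q. sw R (\<lambda>x y. sw R (\<lambda>z w. sw R (\<lambda>u v. f (y * (w * b)) (v * (z * q)) (u * (x * p))))))"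
      (is "?l = ?r") for a b
    proof -
      have "?l = sw R (\<lambda>c d. cp c (\<lambda>c1 c2. cp a (\<lambda>p q. sw R (\<lambda>u v. f (d * b) (v * (c2 * q)) (u * (c1 * p))))))"
        by (subst cp_mult) (intro bilinI lin_sw lin_intros fl, rule refl)
      also have "\<dots> = sw R (\<lambda>x y. sw R (\<lambda>z w. cp a (\<lambda>p q. sw R (\<lambda>u v. f ((y * w) * b) (v * (z * q)) (u * (x * p))))))"
        by (rule R_cop_id) (intro trilinI lin_sw lin_intros fl)
      also have "\<dots> = sw R (\<lambda>x y. cp a (\<lambda>p q. sw R (\<lambda>z w. sw R (\<lambda>u v. f (y * (w * b)) (v * (z * q)) (u * (x * p))))))"
        by (subst sw_swap) (simp add: mult.assoc)
      also have "\<dots> = ?r"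
        by (rule sw_swap)
      finally show ?thesis .
    qed
    have yang_baxter:
      "sw R (\<lambda>x y. sw R (\<lambda>z w. sw R (\<lambda>u v. f (v * (y * c)) (u * (w * b)) (x * (z * a))))) =
       sw R (\<lambda>x y. sw R (\<lambda>z w. sw R (\<lambda>u v. f (y * (w * c)) (v * (z * b)) (u * (x * a)))))" for a b c
    proof -
      have "trilin (\<lambda>x y z. f (z * c) (y * b) (x * a))"
        by (intro trilinI lin_intros fl)
      from R_yang_baxter[OF this]
      have yb: "sw R (\<lambda>u v. sw R (\<lambda>x y. sw R (\<lambda>z w. f (y * (w * c)) (v * (z * b)) (u * (x * a))))) =
          sw R (\<lambda>u v. sw R (\<lambda>x y. sw R (\<lambda>z w. f (v * (y * c)) (u * (w * b)) (x * (z * a)))))"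
        by (simp add: mult.assoc)
      have rotate: "sw R (\<lambda>x y. sw R (\<lambda>z w. sw R (\<lambda>u v. g u v x y z w))) =
          sw R (\<lambda>u v. sw R (\<lambda>x y. sw R (\<lambda>z w. g u v x y z w)))"
        for g :: "'k \<Rightarrow> 'k \<Rightarrow> 'k \<Rightarrow> 'k \<Rightarrow> 'k \<Rightarrow> 'k \<Rightarrow> 'f"
        by (subst (2) sw_swap) (rule sw_swap)
      show ?thesis
        by (rule trans[OF rotate trans[OF yb[symmetric] rotate[symmetric]]])
    qed
    have "end_cop s t k (\<lambda>a b. end_cop s t a (\<lambda>c d. f c d b)) =
        cp k (\<lambda>a b. cp b (\<lambda>p q. sw R (\<lambda>x y. sw R (\<lambda>z w. sw R (\<lambda>u v. f (v * (y * q)) (u * (w * p)) (x * (z * a)))))))"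
      using 1 by (simp add: end_cop_def left)
    also have "\<dots> = cp k (\<lambda>a b. cp a (\<lambda>p q. sw R (\<lambda>x y. sw R (\<lambda>z w. sw R (\<lambda>u v. f (y * (w * b)) (v * (z * q)) (u * (x * p)))))))"
      by (subst yang_baxter, rule cp_coassoc[symmetric]) (intro trilinI lin_sw lin_intros fl)
    also have "\<dots> = end_cop s t k (\<lambda>a b. end_cop s t b (\<lambda>c d. f a c d))"
      using 1 by (simp add: end_cop_def right)
    finally show ?thesis .
  next
    case 2
    then show ?thesis using cp_coassoc[OF f] by (simp add: end_cop_def)
  next
    case 3
    have "trilin (\<lambda>a b c. f c b a)"
      by (intro trilinI lin_intros fl)
    from cp_coassoc[OF this] show ?thesis using 3 by (simp add: end_cop_def)
  qed
qed

lemma end_cop_counit_left: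
  assumes \<phi>: "lin \<phi>"
  shows "end_cop s t k (\<lambda>a b. counit H a * \<phi> b) = \<phi> k"
proof -
  have "sw R (\<lambda>c d. counit H (d * b) * \<phi> (c * a)) = \<phi> a * counit H b" for a b
  proof -
    have "sw R (\<lambda>c d. \<phi> (c * a) * counit H d) = \<phi> (1 * a)"
      by (rule R_counit_right) (intro lin_intros lin_comp[OF \<phi>])
    then have "sw R (\<lambda>c d. (\<phi> (c * a) * counit H d) * counit H b) = \<phi> a * counit H b"
      by (simp only: sw_multc) simp
    then show ?thesis by (simp add: counit_mult mult_ac)
  qed
  moreover have "cp k (\<lambda>a b. counit H b * \<phi> a) = \<phi> k"
    using cp_counit_right[OF \<phi>] by (simp add: mult.commute)
  ultimately show ?thesis
    by (simp add: end_cop_def cp_counit_left[OF \<phi>] cp_counit_right[OF \<phi>])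
qed

lemma end_cop_counit_right:
  assumes \<phi>: "lin \<phi>"
  shows "end_cop s t k (\<lambda>a b. \<phi> a * counit H b) = \<phi> k"
proof -
  have "sw R (\<lambda>c d. \<phi> (d * b) * counit H (c * a)) = counit H a * \<phi> b" for a b
  proof -
    have "sw R (\<lambda>c d. counit H c * \<phi> (d * b)) = \<phi> (1 * b)"
      by (rule R_counit_left) (intro lin_intros lin_comp[OF \<phi>])
    then have "sw R (\<lambda>c d. counit H a * (counit H c * \<phi> (d * b))) = counit H a * \<phi> b"
      by (simp only: sw_cmult) simp
    then show ?thesis by (simp add: counit_mult mult_ac)
  qed
  moreover have "cp k (\<lambda>a b. \<phi> b * counit H a) = \<phi> k"
    using cp_counit_left[OF \<phi>] by (simp add: mult.commute)
  ultimately show ?thesis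
    by (simp add: end_cop_def cp_counit_left[OF \<phi>] cp_counit_right[OF \<phi>])
qed

text \<open>
  For incoming ends and \<open>s = 0\<close> this rests on \<open>R\<Delta>(h) = \<Delta>\<^sup>o\<^sup>p(h)R\<close>. For outgoing ends the translation is by
  \<open>S(h)\<close> from the right, and it is \<open>\<Delta>(S(h)) = S(h\<^sub>(\<^sub>2\<^sub>)) \<otimes> S(h\<^sub>(\<^sub>1\<^sub>))\<close> that restores the order of the factors.
\<close>

lemma end_cop_translate:
  assumes f: "bilin f"
  shows "end_cop s t (translate t h k) f =
    cp h (\<lambda>g l. end_cop s t k (\<lambda>a b. f (translate t g a) (translate t l b)))"
proof -
  note fl = bilin_comp1[OF f] bilin_comp2[OF f]
  have g: "bilin (\<lambda>a b. sw R (\<lambda>c d. f (d * b) (c * a)))"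
    by (intro bilinI lin_sw lin_intros fl)
  consider "t = 0" "s = 0" | "t = 0" "s \<noteq> 0" | "t \<noteq> 0" "s = 0" | "t \<noteq> 0" "s \<noteq> 0" by blast
  then show ?thesis
  proof cases
    case 1
    have "bilin (\<lambda>x y. f (y * b) (x * a))" for a b
      by (intro bilinI lin_intros fl)
    note R = R_cop[OF this, symmetric]
    have "end_cop s t (translate t h k) f =
        cp h (\<lambda>g l. cp k (\<lambda>a b. sw R (\<lambda>c d. f (d * (l * b)) (c * (g * a)))))"
      using 1 by (simp add: end_cop_def translate_def cp_mult[OF g])
    also have "\<dots> = cp k (\<lambda>a b. sw R (\<lambda>c d. cp h (\<lambda>g l. f (d * (l * b)) (c * (g * a)))))"
      by (subst sw_swap) (subst (2) sw_swap, rule refl)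
    also have "\<dots> = cp k (\<lambda>a b. cp h (\<lambda>g l. sw R (\<lambda>c d. f (g * (d * b)) (l * (c * a)))))"
      using R by (simp add: mult.assoc)
    also have "\<dots> = cp h (\<lambda>g l. cp k (\<lambda>a b. sw R (\<lambda>c d. f (g * (d * b)) (l * (c * a)))))"
      by (rule sw_swap)
    finally show ?thesis using 1 by (simp add: end_cop_def translate_def)
  next
    case 2
    then show ?thesis by (simp add: end_cop_def translate_def cp_mult[OF f])
  next
    case 3
    have "end_cop s t (translate t h k) f =
        cp k (\<lambda>a b. cp (antipode H h) (\<lambda>p q. sw R (\<lambda>c d. f (d * (b * q)) (c * (a * p)))))"
      using 3 by (simp add: end_cop_def translate_def cp_mult[OF g])
    also have "\<dots> = cp k (\<lambda>a b. cp h (\<lambda>p q. sw R (\<lambda>c d. f (d * (b * antipode H p)) (c * (a * antipode H q)))))"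
      by (subst cp_antipode) (intro bilinI lin_sw lin_intros fl, rule refl)
    also have "\<dots> = cp h (\<lambda>p q. cp k (\<lambda>a b. sw R (\<lambda>c d. f (d * (b * antipode H p)) (c * (a * antipode H q)))))"
      by (rule sw_swap)
    finally show ?thesis using 3 by (simp add: end_cop_def translate_def mult.assoc)
  next
    case 4
    have f': "bilin (\<lambda>a b. f b a)"
      by (intro bilinI lin_intros fl)
    have "end_cop s t (translate t h k) f =
        cp k (\<lambda>a b. cp (antipode H h) (\<lambda>p q. f (b * q) (a * p)))"
      using 4 by (simp add: end_cop_def translate_def cp_mult[OF f'])
    also have "\<dots> = cp k (\<lambda>a b. cp h (\<lambda>p q. f (b * antipode H p) (a * antipode H q)))"
      by (subst cp_antipode) (intro bilinI lin_sw lin_intros fl, rule refl)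
    also have "\<dots> = cp h (\<lambda>p q. cp k (\<lambda>a b. f (b * antipode H p) (a * antipode H q)))"
      by (rule sw_swap)
    finally show ?thesis using 4 by (simp add: end_cop_def translate_def)
  qed
qed

lemma module_algebra_end: "module_algebra H (dual H) (end_mul s t) (counit H) (end_act t)"
proof
  show "lincomb_closed (dual H)"
    unfolding lincomb_closed_def
  proof (intro conjI allI ballI)
    show "dual H \<noteq> {}" using counit_linear by auto
    show "(\<lambda>k. c * \<alpha> k + \<beta> k) \<in> dual H" if "\<alpha> \<in> dual H" "\<beta> \<in> dual H" for c \<alpha> \<beta>
      using that by (simp add: dual_iff_lin lin_def algebra_simps)
  qed
  show "counit H \<in> dual H"
    by (rule counit_linear)
next
  fix \<alpha> \<beta> assume "\<alpha> \<in> dual H" "\<beta> \<in> dual H"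
  then have \<alpha>: "lin \<alpha>" and \<beta>: "lin \<beta>" by (simp_all add: dual_iff_lin)
  have b: "bilin (\<lambda>a b. \<alpha> a * \<beta> b)"
    by (intro bilinI lin_intros lin_comp[OF \<alpha>] lin_comp[OF \<beta>])
  show "end_mul s t \<alpha> \<beta> \<in> dual H"
    using lin_end_cop[OF b klin_id] by (simp add: dual_iff_lin end_mul_def[abs_def])
  show "end_act t (end_mul s t \<alpha> \<beta>) h =
      (\<lambda>k. cp h (\<lambda>a b. end_mul s t (end_act t \<alpha> a) (end_act t \<beta> b) k))" for h
    by (simp add: fun_eq_iff end_act_def end_mul_def end_cop_translate[OF b])
next
  fix \<alpha> \<beta> \<gamma> assume "\<alpha> \<in> dual H" "\<beta> \<in> dual H" "\<gamma> \<in> dual H"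
  then have \<alpha>: "lin \<alpha>" and \<beta>: "lin \<beta>" and \<gamma>: "lin \<gamma>" by (simp_all add: dual_iff_lin)
  have "trilin (\<lambda>a b c. \<alpha> a * (\<beta> b * \<gamma> c))"
    by (intro trilinI lin_intros lin_comp[OF \<alpha>] lin_comp[OF \<beta>] lin_comp[OF \<gamma>])
  from end_cop_coassoc[OF this]
  show "end_mul s t (end_mul s t \<alpha> \<beta>) \<gamma> = end_mul s t \<alpha> (end_mul s t \<beta> \<gamma>)"
    by (simp add: fun_eq_iff end_mul_def end_cop_cmult[symmetric] end_cop_multc[symmetric] mult.assoc)
next
  fix \<alpha> assume "\<alpha> \<in> dual H"
  then have \<alpha>: "lin \<alpha>" by (simp add: dual_iff_lin)
  show "end_act t \<alpha> h \<in> dual H" for h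
    unfolding dual_iff_lin end_act_def by (intro lin_comp[OF \<alpha>] klin_translate' klin_id)
  show "lin (\<lambda>h. end_act t \<alpha> h k)" for k
    unfolding end_act_def by (intro lin_comp[OF \<alpha>] klin_translate klin_id)
  show "end_mul s t (counit H) \<alpha> = \<alpha>" "end_mul s t \<alpha> (counit H) = \<alpha>"
    by (simp_all add: fun_eq_iff end_mul_def end_cop_counit_left[OF \<alpha>] end_cop_counit_right[OF \<alpha>])
  show "end_act t \<alpha> (g * h) = end_act t (end_act t \<alpha> g) h" for g h
    by (simp add: fun_eq_iff end_act_def translate_mult)
  show "end_act t \<alpha> 1 = \<alpha>"
    by (simp add: fun_eq_iff end_act_def translate_one)
next
  show "flin (\<lambda>\<alpha>. end_mul s t \<alpha> \<beta>)" "flin (end_mul s t \<alpha>)" for \<alpha> \<beta>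
    unfolding flin_def end_mul_def
    by (simp_all add: fun_eq_iff algebra_simps end_cop_add end_cop_cmult)
  show "flin (\<lambda>\<alpha>. end_act t \<alpha> h)" for h
    by (simp add: flin_def end_act_def fun_eq_iff)
  show "end_act t (counit H) h = (\<lambda>k. counit H h * counit H k)" for h
    by (simp add: fun_eq_iff end_act_def counit_translate)
qed

end


section \<open>Tensor powers of the dual\<close>

lemma dpure_cong: "(\<And>i. i \<in> {1..n} \<Longrightarrow> \<alpha> i = \<beta> i) \<Longrightarrow> dpure n \<alpha> = dpure n \<beta>"
  by (simp add: dpure_def fun_eq_iff)

definition snoc :: "nat \<Rightarrow> (('f::field), 'k) dtens \<Rightarrow> ('k \<Rightarrow> 'f) \<Rightarrow> ('f, 'k) dtens" where
  "snoc n A \<alpha> = (\<lambda>k. A k * \<alpha> (k (Suc n)))"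

lemma dpure_Suc: "dpure (Suc n) \<alpha> = snoc n (dpure n \<alpha>) (\<alpha> (Suc n))"
  by (simp add: dpure_def snoc_def fun_eq_iff)

context fin_dim_hopf_algebra
begin

lemma dtens_one_Suc: "dtens_one H (Suc n) = snoc n (dtens_one H n) (counit H)"
  by (simp add: dtens_one_def dpure_Suc)

lemma dpure_in: "(\<And>i. i \<in> {1..n} \<Longrightarrow> \<alpha> i \<in> dual H) \<Longrightarrow> dpure n \<alpha> \<in> dual_tensor_power H n"
  unfolding dual_tensor_power_def
  by (rule CollectI, rule exI[of _ 1], rule exI[of _ "\<lambda>_. 1"], rule exI[of _ "\<lambda>_. \<alpha>"]) auto

lemma dtens_one_in: "dtens_one H n \<in> dual_tensor_power H n"
  unfolding dtens_one_def by (rule dpure_in) (simp add: counit_linear)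

lemma lincomb_closed_dual_tensor_power: "lincomb_closed (dual_tensor_power H n)"
  unfolding dual_tensor_power_def
  by (rule lincomb_closed_finite_sums[where P = "\<lambda>\<alpha>. \<forall>i\<in>{1..n}. \<alpha> i \<in> dual H"])

lemma dual_tensor_power_induct [consumes 1, case_names pure lincomb]:
  assumes A: "A \<in> dual_tensor_power H n"
    and pure: "\<And>\<alpha>. (\<And>i. i \<in> {1..n} \<Longrightarrow> \<alpha> i \<in> dual H) \<Longrightarrow> P (dpure n \<alpha>)"
    and lincomb: "\<And>c A B. A \<in> dual_tensor_power H n \<Longrightarrow> B \<in> dual_tensor_power H n \<Longrightarrow>
      P A \<Longrightarrow> P B \<Longrightarrow> P (\<lambda>k. c * A k + B k)"
  shows "P A"
proof -
  obtain m :: nat and c \<alpha> where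
    m: "\<forall>p<m. \<forall>i\<in>{1..n}. \<alpha> p i \<in> dual H" and A: "A = (\<lambda>k. \<Sum>p<m. c p * dpure n (\<alpha> p) k)"
    using A unfolding dual_tensor_power_def by blast
  have "(\<lambda>k. \<Sum>p<m. c p * dpure n (\<alpha> p) k) \<in> dual_tensor_power H n \<and>
      P (\<lambda>k. \<Sum>p<m. c p * dpure n (\<alpha> p) k)"
    using m
  proof (induction m)
    case 0
    \<comment> \<open>The empty sum is \<open>- 1 \<otimes> \<dots> \<otimes> 1 + 1 \<otimes> \<dots> \<otimes> 1\<close>.\<close>
    have one: "P (dpure n (\<lambda>_. counit H))"
      by (rule pure) (simp add: counit_linear)
    have "P (\<lambda>k. - 1 * dpure n (\<lambda>_. counit H) k + dpure n (\<lambda>_. counit H) k)"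
      by (rule lincomb) (simp_all add: one dtens_one_in[unfolded dtens_one_def])
    then show ?case
      using lincomb_closed_zero[OF lincomb_closed_dual_tensor_power] by simp
  next
    case (Suc m)
    let ?B = "\<lambda>k. \<Sum>p<m. c p * dpure n (\<alpha> p) k"
    have B: "?B \<in> dual_tensor_power H n" "P ?B"
      using Suc by auto
    have "dpure n (\<alpha> m) \<in> dual_tensor_power H n" "P (dpure n (\<alpha> m))"
      using Suc.prems by (auto intro: dpure_in pure)
    with B have "P (\<lambda>k. c m * dpure n (\<alpha> m) k + ?B k)"
        "(\<lambda>k. c m * dpure n (\<alpha> m) k + ?B k) \<in> dual_tensor_power H n"
      by (auto intro: lincomb lincomb_closedD[OF lincomb_closed_dual_tensor_power])
    then show ?case by (simp add: add.commute)
  qed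
  then show ?thesis by (simp add: A)
qed

lemma snoc_in:
  assumes A: "A \<in> dual_tensor_power H n" and \<alpha>: "\<alpha> \<in> dual H"
  shows "snoc n A \<alpha> \<in> dual_tensor_power H (Suc n)"
  using A
proof (induction rule: dual_tensor_power_induct)
  case (pure \<beta>)
  have "dpure n (\<beta>(Suc n := \<alpha>)) = dpure n \<beta>"
    by (rule dpure_cong) simp
  then have "snoc n (dpure n \<beta>) \<alpha> = dpure (Suc n) (\<beta>(Suc n := \<alpha>))"
    by (simp add: dpure_Suc)
  moreover have "dpure (Suc n) (\<beta>(Suc n := \<alpha>)) \<in> dual_tensor_power H (Suc n)"
    by (rule dpure_in) (use pure \<alpha> in auto)
  ultimately show ?case by simp
next
  case (lincomb c A B)
  then show ?case
    using lincomb_closedD[OF lincomb_closed_dual_tensor_power, of "snoc n A \<alpha>" "Suc n" "snoc n B \<alpha>" c]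
    by (simp add: snoc_def algebra_simps)
qed

lemma dual_tensor_power_Suc_induct [consumes 1, case_names snoc lincomb]:
  assumes A: "A \<in> dual_tensor_power H (Suc n)"
    and snoc: "\<And>A \<alpha>. A \<in> dual_tensor_power H n \<Longrightarrow> \<alpha> \<in> dual H \<Longrightarrow> P (snoc n A \<alpha>)"
    and lincomb: "\<And>c A B. A \<in> dual_tensor_power H (Suc n) \<Longrightarrow> B \<in> dual_tensor_power H (Suc n) \<Longrightarrow>
      P A \<Longrightarrow> P B \<Longrightarrow> P (\<lambda>k. c * A k + B k)"
  shows "P A"
  using A
proof (induction rule: dual_tensor_power_induct)
  case (pure \<alpha>)
  then show ?case by (auto simp: dpure_Suc intro!: snoc dpure_in)
qed (rule lincomb)

text \<open>Because \<open>K\<close> is finite-dimensional, \<open>K\<^sup>*\<^sup>\<otimes>\<^sup>n\<close> consists of all \<open>n\<close>-linear forms.\<close>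

lemma dual_tensor_power_eq_mforms: "dual_tensor_power H n = mforms H n"
proof
  show "dual_tensor_power H n \<subseteq> mforms H n"
  proof
    fix A assume "A \<in> dual_tensor_power H n"
    then show "A \<in> mforms H n"
    proof (induction rule: dual_tensor_power_induct)
      case (pure \<alpha>)
      have "dpure n \<alpha> k = dpure n \<alpha> k'" if "\<forall>i\<in>{1..n}. k i = k' i" for k k'
        using that by (simp add: dpure_def)
      moreover have "lin (\<lambda>x. dpure n \<alpha> (k(i := x)))" if i: "i \<in> {1..n}" for k i
      proof -
        have "dpure n \<alpha> (k(i := x)) = \<alpha> i x * (\<Prod>j\<in>{1..n} - {i}. \<alpha> j (k j))" for x
          using i by (simp add: dpure_def prod.remove[of "{1..n}" i])
        moreover have "lin (\<alpha> i)"
          using pure i by (simp add: dual_iff_lin)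
        ultimately show ?thesis by (simp add: lin_multc)
      qed
      ultimately show ?case by (simp add: mforms_iff)
    next
      case (lincomb c A B)
      then show ?case by (fastforce simp: mforms_iff intro!: lin_plus lin_cmult)
    qed
  qed
  show "mforms H n \<subseteq> dual_tensor_power H n"
  proof (induction n)
    case 0
    show ?case
    proof
      fix A assume A: "A \<in> mforms H 0"
      then have "A = (\<lambda>k. A undefined * dtens_one H 0 k)"
        by (simp add: mforms_iff dtens_one_def dpure_def fun_eq_iff)
      then show "A \<in> dual_tensor_power H 0"
        using lincomb_closed_scale[OF lincomb_closed_dual_tensor_power dtens_one_in, of "A undefined" 0]
        by simp
    qed
  next
    case (Suc n)
    obtain E co where E: "finite (E :: 'k set)" "\<And>b. lin (co b)"
        "\<And>x. (\<Sum>b\<in>E. scl H (co b x) b) = x"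
      using dual_basis by blast
    show ?case
    proof
      fix A assume A: "A \<in> mforms H (Suc n)"
      have "A k = (\<Sum>b\<in>E. snoc n (\<lambda>k. A (k(Suc n := b))) (co b) k)" for k
      proof -
        have "lin (\<lambda>x. A (k(Suc n := x)))"
          using A by (simp add: mforms_iff)
        from lin_expand[OF this E(3), of "k (Suc n)"] show ?thesis
          by (simp add: snoc_def mult.commute)
      qed
      then have "A = (\<lambda>k. \<Sum>b\<in>E. snoc n (\<lambda>k. A (k(Suc n := b))) (co b) k)"
        by (rule ext)
      moreover have "(\<lambda>k. A (k(Suc n := b))) \<in> mforms H n" for b
      proof -
        have "lin (\<lambda>x. A (k(Suc n := b, i := x)))" if "i \<in> {1..n}" for k i
          using A that by (simp add: mforms_iff)
        moreover have "k(i := x, Suc n := b) = k(Suc n := b, i := x)" if "i \<in> {1..n}" for k i and x :: 'k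
          using that by (simp add: fun_upd_twist)
        moreover have "A (k(Suc n := b)) = A (k'(Suc n := b))" if "\<forall>i\<in>{1..n}. k i = k' i" for k k'
        proof -
          have "\<forall>i\<in>{1..Suc n}. (k(Suc n := b)) i = (k'(Suc n := b)) i"
            using that by simp
          then show ?thesis using A unfolding mforms_iff by blast
        qed
        ultimately show ?thesis by (simp add: mforms_iff)
      qed
      then have "snoc n (\<lambda>k. A (k(Suc n := b))) (co b) \<in> dual_tensor_power H (Suc n)" for b
        using Suc E(2) by (intro snoc_in) (auto simp: dual_iff_lin)
      then have "(\<lambda>k. \<Sum>b\<in>E. snoc n (\<lambda>k. A (k(Suc n := b))) (co b) k) \<in> dual_tensor_power H (Suc n)"
        by (rule lincomb_closed_sum[OF lincomb_closed_dual_tensor_power])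
      ultimately show "A \<in> dual_tensor_power H (Suc n)" by simp
    qed
  qed
qed

lemma dual_tensor_power_local:
  "A \<in> dual_tensor_power H n \<Longrightarrow> (\<And>i. i \<in> {1..n} \<Longrightarrow> k i = k' i) \<Longrightarrow> A k = A k'"
  by (simp add: dual_tensor_power_eq_mforms mforms_iff)

lemma snoc_section:
  assumes "A \<in> dual_tensor_power H n"
  shows "(\<lambda>x. snoc n A \<alpha> (x(Suc n := y))) = (\<lambda>x. A x * \<alpha> y)"
proof
  fix x
  have "A (x(Suc n := y)) = A x"
    by (rule dual_tensor_power_local[OF assms]) simp
  then show "snoc n A \<alpha> (x(Suc n := y)) = A x * \<alpha> y" by (simp add: snoc_def)
qed

lemma flin_snoc: "flin (\<lambda>A. snoc n A \<alpha>)"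
  by (simp add: flin_def snoc_def fun_eq_iff algebra_simps)

end


section \<open>The braided tensor product\<close>

locale vertex_data = quasitriangular_hopf_algebra H R
  for H :: "('f::field, 'k::ring_1) hopf" and R +
  fixes \<sigma> \<tau> :: "nat \<Rightarrow> nat"
begin

text \<open>
  \<open>K\<^sup>*\<^sup>\<otimes>\<^sup>n\<^sup>+\<^sup>1\<close> is the braided tensor product of \<open>K\<^sup>*\<^sup>\<otimes>\<^sup>n\<close> and the algebra at the last end: \<open>h\<close> acts by
  \<open>h\<^sub>(\<^sub>1\<^sub>) \<otimes> h\<^sub>(\<^sub>2\<^sub>)\<close>, and
  \<open>(A \<otimes> \<alpha>)(B \<otimes> \<beta>) = A(B \<lhd> R\<^sub>(\<^sub>1\<^sub>)) \<otimes> (\<alpha> \<lhd> R\<^sub>(\<^sub>2\<^sub>))\<beta>\<close>. The equations below express this by evaluating on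
  the last argument, so that both operations are finite sums of values of \<open>A\<close> and \<open>B\<close> and hence
  linear on all functions, not only on tensors.
\<close>

primrec vact :: "nat \<Rightarrow> ('f, 'k) dtens \<Rightarrow> 'k \<Rightarrow> ('f, 'k) dtens" where
  "vact 0 = (\<lambda>A h k. counit H h * A k)"
| "vact (Suc n) = (\<lambda>A h k. cp h (\<lambda>a b.
     vact n (\<lambda>x. A (x(Suc n := translate (\<tau> (Suc n)) b (k (Suc n))))) a k))"

primrec vmul :: "nat \<Rightarrow> ('f, 'k) dtens \<Rightarrow> ('f, 'k) dtens \<Rightarrow> ('f, 'k) dtens" where
  "vmul 0 = (\<lambda>A B k. A k * B k)"
| "vmul (Suc n) = (\<lambda>A B k. sw R (\<lambda>r s. end_cop (\<sigma> (Suc n)) (\<tau> (Suc n)) (k (Suc n)) (\<lambda>a b.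
     vmul n (\<lambda>x. A (x(Suc n := translate (\<tau> (Suc n)) s a)))
       (\<lambda>x. vact n (\<lambda>y. B (y(Suc n := b))) r x) k)))"

declare vact.simps(2) [simp del] vmul.simps(2) [simp del]

lemma flin_vact: "flin (\<lambda>A. vact n A h)"
proof (induction n arbitrary: h)
  case 0
  show ?case by (simp add: flin_def fun_eq_iff algebra_simps)
next
  case (Suc n)
  show ?case
    unfolding flin_def by (simp add: vact.simps(2) flinD[OF Suc] fun_eq_iff sw_add sw_cmult)
qed

lemma flin_vmul: "flin (\<lambda>A. vmul n A B)" "flin (vmul n A)"
proof (induction n arbitrary: A B)
  case 0
  show "flin (\<lambda>A. vmul 0 A B)" "flin (vmul 0 A)" for A B
    by (simp_all add: flin_def fun_eq_iff algebra_simps)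
next
  case (Suc n)
  show "flin (\<lambda>A. vmul (Suc n) A B)" "flin (vmul (Suc n) A)" for A B
    unfolding flin_def
    by (simp_all add: vmul.simps(2) flinD[OF Suc(1)] flinD[OF Suc(2)] flinD[OF flin_vact] fun_eq_iff
        sw_add sw_cmult end_cop_add end_cop_cmult)
qed

lemma vact_snoc:
  assumes A: "A \<in> dual_tensor_power H n"
  shows "vact (Suc n) (snoc n A \<alpha>) h =
    (\<lambda>k. cp h (\<lambda>a b. snoc n (vact n A a) (end_act (\<tau> (Suc n)) \<alpha> b) k))"
  by (simp add: vact.simps(2) snoc_section[OF A] flin_scale_right[OF flin_vact] fun_eq_iff)
    (simp add: snoc_def end_act_def)

lemma vmul_snoc:
  assumes A: "A \<in> dual_tensor_power H n" and B: "B \<in> dual_tensor_power H n"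
  shows "vmul (Suc n) (snoc n A \<alpha>) (snoc n B \<beta>) =
    (\<lambda>k. sw R (\<lambda>r s. snoc n (vmul n A (vact n B r))
       (end_mul (\<sigma> (Suc n)) (\<tau> (Suc n)) (end_act (\<tau> (Suc n)) \<alpha> s) \<beta>) k))"
  by (simp add: vmul.simps(2) snoc_section[OF A] snoc_section[OF B] flin_scale_right[OF flin_vact]
      flin_scale_right[OF flin_vmul(1)] flin_scale_right[OF flin_vmul(2)] fun_eq_iff)
    (simp add: snoc_def end_mul_def end_act_def end_cop_cmult mult.assoc mult.commute[of "\<beta> _"])

text \<open>Without ends the module algebra is the ground field with the trivial action.\<close>

lemma module_algebra_0: "module_algebra H (dual_tensor_power H 0) (vmul 0) (dtens_one H 0) (vact 0)"
proof
  show "lincomb_closed (dual_tensor_power H 0)"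
    by (rule lincomb_closed_dual_tensor_power)
  show "dtens_one H 0 \<in> dual_tensor_power H 0"
    by (rule dtens_one_in)
next
  fix A B assume A: "A \<in> dual_tensor_power H 0" and B: "B \<in> dual_tensor_power H 0"
  have "A = (\<lambda>k. A undefined)"
    by (rule ext, rule dual_tensor_power_local[OF A]) simp
  then have "vmul 0 A B = (\<lambda>k. A undefined * B k)"
    by (simp add: fun_eq_iff)
  then show "vmul 0 A B \<in> dual_tensor_power H 0"
    using lincomb_closed_scale[OF lincomb_closed_dual_tensor_power B] by simp
  have "cp h (\<lambda>a b. counit H a * counit H b) = counit H h" for h
    by (rule cp_counit_left[OF lin_counit])
  then have "cp h (\<lambda>a b. c * (d * (counit H a * counit H b))) = c * (d * counit H h)" for h c d
    by (simp only: sw_cmult)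
  then show "vact 0 (vmul 0 A B) h = (\<lambda>k. cp h (\<lambda>a b. vmul 0 (vact 0 A a) (vact 0 B b) k))" for h
    by (simp add: fun_eq_iff mult_ac)
next
  fix A assume A: "A \<in> dual_tensor_power H 0"
  show "vact 0 A h \<in> dual_tensor_power H 0" for h
    using lincomb_closed_scale[OF lincomb_closed_dual_tensor_power A] by simp
  show "lin (\<lambda>h. vact 0 A h k)" for k
    by (simp add: lin_intros)
qed (simp_all add: flin_vmul flin_vact fun_eq_iff counit_mult counit_one mult_ac
      flin_def algebra_simps dtens_one_def dpure_def)

text \<open>
  With \<open>R'\<close> a second copy of \<open>R\<close>, both bracketings of \<open>(A \<otimes> \<alpha>)(B \<otimes> \<beta>)(C \<otimes> \<gamma>)\<close> are sums of terms
  \<open>A(B \<lhd> r)(C \<lhd> p) \<otimes> (\<alpha> \<lhd> x)((\<beta> \<lhd> y)\<gamma>)\<close>. In one of them the module algebra property splits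
  \<open>R'\<^sub>(\<^sub>2\<^sub>)\<close> by \<open>\<Delta>\<close>, in the other one \<open>R\<^sub>(\<^sub>1\<^sub>)\<close>, and the two hexagon identities turn both
  into the same product of three copies of \<open>R\<close>. For the action of \<open>h\<close> on a product, the two factors
  in the middle of \<open>h\<^sub>(\<^sub>1\<^sub>) \<otimes> \<dots> \<otimes> h\<^sub>(\<^sub>4\<^sub>)\<close> meet \<open>R\<close> as \<open>R\<Delta>\<close> on one side and as \<open>\<Delta>\<^sup>o\<^sup>pR\<close> on the other.
\<close>

lemma module_algebra_Suc:
  assumes "module_algebra H (dual_tensor_power H n) (vmul n) (dtens_one H n) (vact n)"
  shows "module_algebra H (dual_tensor_power H (Suc n)) (vmul (Suc n)) (dtens_one H (Suc n)) (vact (Suc n))"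
proof -
  let ?D = "dual_tensor_power H n" and ?D' = "dual_tensor_power H (Suc n)"
  let ?s = "\<sigma> (Suc n)" and ?t = "\<tau> (Suc n)"
  interpret X: module_algebra H ?D "vmul n" "dtens_one H n" "vact n"
    by (rule assms)
  interpret Y: module_algebra H "dual H" "end_mul ?s ?t" "counit H" "end_act ?t"
    by (rule module_algebra_end)
  note closed' = lincomb_closed_dual_tensor_power[of "Suc n"]
  note sw_linear = flin_sw[OF flin_vmul(1)] flin_sw[OF flin_vmul(2)] flin_sw[OF flin_vact]
    flin_sw[OF Y.flin_mul_left] flin_sw[OF Y.flin_mul_right] flin_sw[OF Y.flin_act]
    flin_sw[OF X.flin_mul_left] flin_sw[OF X.flin_mul_right] flin_sw[OF X.flin_act]
  note ins = X.mul_in X.act_in X.one_in Y.mul_in Y.act_in Y.one_in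
  note li = lin_intros X.ma_lin_intros Y.ma_lin_intros
  note lincombs = flinD[OF flin_vmul(1)] flinD[OF flin_vmul(2)] flinD[OF flin_vact]

  have mul_in: "vmul (Suc n) A B \<in> ?D'" if A: "A \<in> ?D'" and B: "B \<in> ?D'" for A B
    using A
  proof (induction rule: dual_tensor_power_Suc_induct)
    case (snoc A \<alpha>)
    note A = snoc
    show ?case using B
    proof (induction rule: dual_tensor_power_Suc_induct)
      case (snoc B \<beta>)
      with A show ?case
        by (simp add: vmul_snoc lincomb_closed_sw[OF closed'] snoc_in ins)
    qed (simp add: lincombs lincomb_closedD[OF closed'])
  qed (simp add: lincombs lincomb_closedD[OF closed'])

  have act_in: "vact (Suc n) A h \<in> ?D'" if "A \<in> ?D'" for A h
    using that
  proof (induction rule: dual_tensor_power_Suc_induct)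
    case (snoc A \<alpha>)
    then show ?case
      by (simp add: vact_snoc lincomb_closed_sw[OF closed'] snoc_in ins)
  qed (simp add: lincombs lincomb_closedD[OF closed'])

  have lin_act: "lin (\<lambda>h. vact (Suc n) A h k)" if "A \<in> ?D'" for A k
    using that
  proof (induction rule: dual_tensor_power_Suc_induct)
    case (snoc A \<alpha>)
    have "bilin (\<lambda>a b. vact n A a k * end_act ?t \<alpha> b (k (Suc n)))"
      by (intro bilinI li snoc)
    from lin_cp[OF this klin_id] show ?case
      by (simp add: vact_snoc[OF snoc(1)]) (simp add: snoc_def)
  qed (simp add: lincombs lin_plus lin_cmult)

  have assoc: "vmul (Suc n) (vmul (Suc n) (snoc n A \<alpha>) (snoc n B \<beta>)) (snoc n C \<gamma>) =
      vmul (Suc n) (snoc n A \<alpha>) (vmul (Suc n) (snoc n B \<beta>) (snoc n C \<gamma>))"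
    if A: "A \<in> ?D" and B: "B \<in> ?D" and C: "C \<in> ?D"
      and \<alpha>: "\<alpha> \<in> dual H" and \<beta>: "\<beta> \<in> dual H" and \<gamma>: "\<gamma> \<in> dual H" for A B C \<alpha> \<beta> \<gamma>
  proof
    fix k
    define f where "f r p x y = vmul n A (vmul n (vact n B r) (vact n C p)) k *
      end_mul ?s ?t (end_act ?t \<alpha> x) (end_mul ?s ?t (end_act ?t \<beta> y) \<gamma>) (k (Suc n))" for r p x y
    have lf: "klin g \<Longrightarrow> lin (\<lambda>z. f (g z) p x y)" "klin g \<Longrightarrow> lin (\<lambda>z. f r (g z) x y)"
      "klin g \<Longrightarrow> lin (\<lambda>z. f r p (g z) y)" "klin g \<Longrightarrow> lin (\<lambda>z. f r p x (g z))" for g r p x y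
      unfolding f_def by (intro li ins A B C \<alpha> \<beta> \<gamma>; assumption)+
    have "vmul (Suc n) (vmul (Suc n) (snoc n A \<alpha>) (snoc n B \<beta>)) (snoc n C \<gamma>) k =
        sw R (\<lambda>r s. sw R (\<lambda>p q. cp q (\<lambda>x y. f r p (s * x) y)))"
      using that
      by (simp add: vmul_snoc ins sw_linear)
        (simp add: snoc_def f_def ins sw_linear X.mul_assoc Y.mul_assoc Y.act_mul sw_cmult
          Y.act_act[symmetric])
    also have "\<dots> = sw R (\<lambda>r s. sw R (\<lambda>p q. sw R (\<lambda>p' q'. f r (p * p') (s * q') q)))"
      by (subst R_id_cop) (intro trilinI lf lin_intros, rule refl)
    also have "\<dots> = sw R (\<lambda>p q. sw R (\<lambda>r s. sw R (\<lambda>p' q'. f r (p * p') (s * q') q)))"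
      by (rule sw_swap)
    also have "\<dots> = sw R (\<lambda>p q. sw R (\<lambda>r s. cp r (\<lambda>x y. f x (p * y) s q)))"
      by (subst R_cop_id) (intro trilinI lf lin_intros, rule refl)
    also have "\<dots> = vmul (Suc n) (snoc n A \<alpha>) (vmul (Suc n) (snoc n B \<beta>) (snoc n C \<gamma>)) k"
      using that
      by (simp add: vmul_snoc ins sw_linear)
        (simp add: snoc_def f_def ins sw_linear X.act_mul sw_multc X.act_act[symmetric])
    finally show "vmul (Suc n) (vmul (Suc n) (snoc n A \<alpha>) (snoc n B \<beta>)) (snoc n C \<gamma>) k =
      vmul (Suc n) (snoc n A \<alpha>) (vmul (Suc n) (snoc n B \<beta>) (snoc n C \<gamma>)) k" .
  qed

  have act_mul: "vact (Suc n) (vmul (Suc n) (snoc n A \<alpha>) (snoc n B \<beta>)) h k =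
      cp h (\<lambda>a b. vmul (Suc n) (vact (Suc n) (snoc n A \<alpha>) a) (vact (Suc n) (snoc n B \<beta>) b) k)"
    if A: "A \<in> ?D" and B: "B \<in> ?D" and \<alpha>: "\<alpha> \<in> dual H" and \<beta>: "\<beta> \<in> dual H" for A B \<alpha> \<beta> h k
  proof -
    define f where "f a r s b = vmul n (vact n A a) (vact n B r) k *
      end_mul ?s ?t (end_act ?t \<alpha> s) (end_act ?t \<beta> b) (k (Suc n))" for a r s b
    have lf: "klin g \<Longrightarrow> lin (\<lambda>z. f (g z) p x y)" "klin g \<Longrightarrow> lin (\<lambda>z. f r (g z) x y)"
      "klin g \<Longrightarrow> lin (\<lambda>z. f r p (g z) y)" "klin g \<Longrightarrow> lin (\<lambda>z. f r p x (g z))" for g r p x y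
      unfolding f_def by (intro li ins A B \<alpha> \<beta>; assumption)+
    have R: "sw R (\<lambda>r s. cp h (\<lambda>x y. f a (r * x) (s * y) b)) =
        cp h (\<lambda>x y. sw R (\<lambda>r s. f a (y * r) (x * s) b))" for a b h
      by (rule R_cop) (intro bilinI lf lin_intros)
    have "vact (Suc n) (vmul (Suc n) (snoc n A \<alpha>) (snoc n B \<beta>)) h k =
        sw R (\<lambda>r s. cp h (\<lambda>p q. cp p (\<lambda>a b. cp q (\<lambda>c d. f a (r * b) (s * c) d))))"
      using that
      by (simp add: vmul_snoc ins sw_linear vact_snoc)
        (simp add: snoc_def f_def ins X.act_mul Y.act_mul sw_cmult sw_multc
          X.act_act[symmetric] Y.act_act[symmetric])
    also have "\<dots> = sw R (\<lambda>r s. cp h (\<lambda>a m. cp m (\<lambda>n d. cp n (\<lambda>b c. f a (r * b) (s * c) d))))"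
      by (subst cp_coassoc4) ((intro lf lin_intros)+, rule refl)
    also have "\<dots> = cp h (\<lambda>a m. cp m (\<lambda>n d. sw R (\<lambda>r s. cp n (\<lambda>b c. f a (r * b) (s * c) d))))"
      by (subst sw_swap, subst (2) sw_swap, rule refl)
    also have "\<dots> = cp h (\<lambda>a m. cp m (\<lambda>n d. cp n (\<lambda>b c. sw R (\<lambda>r s. f a (c * r) (b * s) d))))"
      by (simp only: R)
    also have "\<dots> = cp h (\<lambda>p q. cp p (\<lambda>a b. cp q (\<lambda>c d. sw R (\<lambda>r s. f a (c * r) (b * s) d))))"
      by (rule cp_coassoc4[symmetric]) (intro lin_sw lf lin_intros)+
    also have "\<dots> = cp h (\<lambda>a b. vmul (Suc n) (vact (Suc n) (snoc n A \<alpha>) a) (vact (Suc n) (snoc n B \<beta>) b) k)"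
      using that
      by (simp add: vmul_snoc ins sw_linear vact_snoc)
        (simp add: snoc_def f_def ins X.act_act[symmetric] Y.act_act[symmetric])
    finally show ?thesis .
  qed

  show ?thesis
  proof
    show "lincomb_closed ?D'" by (rule closed')
    show "dtens_one H (Suc n) \<in> ?D'" by (rule dtens_one_in)
    show "flin (\<lambda>A. vmul (Suc n) A B)" "flin (vmul (Suc n) A)" "flin (\<lambda>A. vact (Suc n) A h)" for A B h
      by (rule flin_vmul flin_vact)+
  next
    fix A assume A: "A \<in> ?D'"
    show "vact (Suc n) A h \<in> ?D'" for h
      using A by (rule act_in)
    show "lin (\<lambda>h. vact (Suc n) A h k)" for k
      using A by (rule lin_act)
    show "vact (Suc n) A (g * h) = vact (Suc n) (vact (Suc n) A g) h" for g h
      using A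
    proof (induction rule: dual_tensor_power_Suc_induct)
      case (snoc A \<alpha>)
      have b: "bilin (\<lambda>a b. vact n A a k * end_act ?t \<alpha> b (k (Suc n)))" for k
        by (intro bilinI li snoc)
      show ?case
        using snoc
        by (simp add: vact_snoc sw_linear ins fun_eq_iff)
          (simp add: snoc_def cp_mult[OF b] X.act_act Y.act_act)
    qed (simp add: lincombs)
    show "vact (Suc n) A 1 = A"
      using A
    proof (induction rule: dual_tensor_power_Suc_induct)
      case (snoc A \<alpha>)
      have b: "bilin (\<lambda>a b. vact n A a k * end_act ?t \<alpha> b (k (Suc n)))" for k
        by (intro bilinI li snoc)
      show ?case
        using snoc
        by (simp add: vact_snoc fun_eq_iff) (simp add: snoc_def cp_one[OF b] X.act_one Y.act_one)
    qed (simp add: lincombs)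
    show "vmul (Suc n) (dtens_one H (Suc n)) A = A"
      using A
    proof (induction rule: dual_tensor_power_Suc_induct)
      case (snoc A \<alpha>)
      have "sw R (\<lambda>r s. vact n A r k * counit H s) = vact n A 1 k" for k
        by (rule R_counit_right) (rule X.lin_act[OF snoc(1)])
      then have *: "sw R (\<lambda>r s. (vact n A r k * counit H s) * c) = A k * c" for k c
        by (simp only: sw_multc X.act_one[OF snoc(1)])
      show ?case
        using snoc *
        by (simp add: dtens_one_Suc vmul_snoc ins fun_eq_iff)
          (simp add: snoc_def ins Y.one_act flin_scale[OF Y.flin_mul_left] X.one_mul Y.one_mul mult.assoc)
    qed (simp add: lincombs)
    show "vmul (Suc n) A (dtens_one H (Suc n)) = A"
      using A
    proof (induction rule: dual_tensor_power_Suc_induct)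
      case (snoc A \<alpha>)
      have "sw R (\<lambda>r s. counit H r * end_act ?t \<alpha> s k) = end_act ?t \<alpha> 1 k" for k
        by (rule R_counit_left) (rule Y.lin_act[OF snoc(2)])
      then have *: "sw R (\<lambda>r s. c * (counit H r * end_act ?t \<alpha> s k)) = c * \<alpha> k" for k c
        by (simp only: sw_cmult Y.act_one[OF snoc(2)])
      show ?case
        using snoc *
        by (simp add: dtens_one_Suc vmul_snoc ins fun_eq_iff)
          (simp add: snoc_def ins X.one_act flin_scale[OF X.flin_mul_right] X.mul_one Y.mul_one mult_ac)
    qed (simp add: lincombs)
  next
    fix A B assume A: "A \<in> ?D'" and B: "B \<in> ?D'"
    show "vmul (Suc n) A B \<in> ?D'"
      using A B by (rule mul_in)
    show "vact (Suc n) (vmul (Suc n) A B) h =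
        (\<lambda>k. cp h (\<lambda>a b. vmul (Suc n) (vact (Suc n) A a) (vact (Suc n) B b) k))" for h
      using A
    proof (induction rule: dual_tensor_power_Suc_induct)
      case (snoc A \<alpha>)
      note A = snoc
      show ?case
        using B
      proof (induction rule: dual_tensor_power_Suc_induct)
        case (snoc B \<beta>)
        show ?case by (rule ext) (rule act_mul[OF A(1) snoc(1) A(2) snoc(2)])
      qed (simp add: lincombs sw_add sw_cmult)
    qed (simp add: lincombs sw_add sw_cmult)
  next
    fix A B C assume A: "A \<in> ?D'" and B: "B \<in> ?D'" and C: "C \<in> ?D'"
    show "vmul (Suc n) (vmul (Suc n) A B) C = vmul (Suc n) A (vmul (Suc n) B C)"
      using A
    proof (induction rule: dual_tensor_power_Suc_induct)
      case (snoc A \<alpha>)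
      note A = snoc
      show ?case
        using B
      proof (induction rule: dual_tensor_power_Suc_induct)
        case (snoc B \<beta>)
        note B = snoc
        show ?case
          using C
        proof (induction rule: dual_tensor_power_Suc_induct)
          case (snoc C \<gamma>)
          show ?case by (rule assoc[OF A(1) B(1) snoc(1) A(2) B(2) snoc(2)])
        qed (simp add: lincombs)
      qed (simp add: lincombs)
    qed (simp add: lincombs)
  next
    have "cp h (\<lambda>a b. counit H a * counit H b) = counit H h" for h
      by (rule cp_counit_left[OF lin_counit])
    then have *: "cp h (\<lambda>a b. counit H a * (counit H b * c)) = counit H h * c" for h c
      by (simp only: mult.assoc[symmetric] sw_multc)
    show "vact (Suc n) (dtens_one H (Suc n)) h = (\<lambda>k. counit H h * dtens_one H (Suc n) k)" for h
      by (simp add: dtens_one_Suc vact_snoc ins fun_eq_iff)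
        (simp add: snoc_def X.one_act Y.one_act mult_ac *)
  qed
qed

theorem module_algebra_vertex:
  "module_algebra H (dual_tensor_power H n) (vmul n) (dtens_one H n) (vact n)"
  by (induction n) (rule module_algebra_0, rule module_algebra_Suc)

end


section \<open>Products and actions on the generators\<close>

lemma dplace1_eval:
  "i \<in> {1..n} \<Longrightarrow> dplace1 H n i \<alpha> k = \<alpha> (k i) * (\<Prod>j\<in>{1..n} - {i}. counit H (k j))"
  by (simp add: dplace1_def dpure_def prod.remove[of "{Suc 0..n}" i])

lemma dplace1_Suc: "i \<noteq> Suc n \<Longrightarrow> dplace1 H (Suc n) i \<alpha> = snoc n (dplace1 H n i \<alpha>) (counit H)"
  by (simp add: dplace1_def dpure_Suc)

lemma dplace1_last: "dplace1 H (Suc n) (Suc n) \<alpha> = snoc n (dtens_one H n) \<alpha>"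
proof -
  have "dpure n ((\<lambda>_. counit H)(Suc n := \<alpha>)) = dpure n (\<lambda>_. counit H)"
    by (rule dpure_cong) simp
  then show ?thesis by (simp add: dplace1_def dpure_Suc dtens_one_def)
qed

lemma dplace1_counit: "dplace1 H n i (counit H) = dtens_one H n"
  by (simp add: dplace1_def dtens_one_def fun_upd_idem)

lemma dplace2_Suc:
  assumes "i \<in> {1..n}" "j \<in> {1..n}"
  shows "dplace2 H (Suc n) i j A = snoc n (dplace2 H n i j A) (counit H)"
proof -
  have "{1..Suc n} - {i, j} = insert (Suc n) ({1..n} - {i, j})"
    using assms by auto
  then show ?thesis by (simp add: dplace2_def snoc_def fun_eq_iff mult_ac)
qed

lemma dpure_2: "dpure 2 \<alpha> k = \<alpha> 1 (k 1) * \<alpha> 2 (k 2)"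
  by (simp add: dpure_def numeral_2_eq_2)

lemma dplace2_last:
  assumes i: "i \<in> {1..n}"
  shows "dplace2 H (Suc n) i (Suc n) (dpure 2 (tup [\<alpha>, \<beta>])) = snoc n (dplace1 H n i \<alpha>) \<beta>"
proof -
  have "{1..Suc n} - {i, Suc n} = {1..n} - {i}"
    by auto
  then show ?thesis
    using i by (simp add: dplace2_def dpure_2 snoc_def dplace1_eval fun_eq_iff tup_def mult_ac)
qed

lemma dplace2_commute:
  "dplace2 H n i j (dpure 2 (tup [\<alpha>, \<beta>])) = dplace2 H n j i (dpure 2 (tup [\<beta>, \<alpha>]))"
  by (simp add: dplace2_def dpure_2 fun_eq_iff tup_def insert_commute)

lemma atLeastAtMost_SucE:
  assumes "i \<in> {1..Suc n}"
  obtains "i \<in> {1..n}" | "i = Suc n"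
  using assms by (cases "i = Suc n") auto

context fin_dim_hopf_algebra
begin

lemma dplace1_in: "\<alpha> \<in> dual H \<Longrightarrow> dplace1 H n i \<alpha> \<in> dual_tensor_power H n"
  unfolding dplace1_def by (rule dpure_in) (simp add: counit_linear)

end

context vertex_data
begin

sublocale V: module_algebra H "dual_tensor_power H n" "vmul n" "dtens_one H n" "vact n" for n
  by (rule module_algebra_vertex)

sublocale E: module_algebra H "dual H" "end_mul s t" "counit H" "end_act t" for s t
  by (rule module_algebra_end)

text \<open>
  In the braided tensor product the subalgebra \<open>A \<otimes> 1\<close> of the first ends and the subalgebra
  \<open>1 \<otimes> \<alpha>\<close> of the last end keep their own products and actions, since \<open>R\<close> becomes trivial when the counit is
  applied to either factor.
\<close>

lemma vmul_snoc_counit: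
  assumes A: "A \<in> dual_tensor_power H n" and B: "B \<in> dual_tensor_power H n" and \<beta>: "\<beta> \<in> dual H"
  shows "vmul (Suc n) (snoc n A (counit H)) (snoc n B \<beta>) = snoc n (vmul n A B) \<beta>"
proof
  fix k :: "nat \<Rightarrow> 'k"
  let ?c = "\<beta> (k (Suc n))"
  have "vmul (Suc n) (snoc n A (counit H)) (snoc n B \<beta>) k =
      sw R (\<lambda>r s. (vmul n A (vact n B r) k * counit H s) * ?c)"
    by (simp add: vmul_snoc[OF A B])
      (simp add: snoc_def E.one_act flin_scale[OF E.flin_mul_left] E.one_mul[OF \<beta>] mult.assoc)
  also have "\<dots> = vmul n A (vact n B 1) k * ?c"
    by (subst sw_multc, subst R_counit_right) (intro V.lin_mul_right V.lin_act B, rule refl)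
  finally show "vmul (Suc n) (snoc n A (counit H)) (snoc n B \<beta>) k = snoc n (vmul n A B) \<beta> k"
    by (simp add: V.act_one[OF B] snoc_def)
qed

lemma vmul_snoc_one:
  assumes A: "A \<in> dual_tensor_power H n" and \<alpha>: "\<alpha> \<in> dual H"
  shows "vmul (Suc n) (snoc n A \<alpha>) (snoc n (dtens_one H n) \<beta>) =
    snoc n A (end_mul (\<sigma> (Suc n)) (\<tau> (Suc n)) \<alpha> \<beta>)"
proof
  fix k :: "nat \<Rightarrow> 'k"
  let ?t = "\<tau> (Suc n)" and ?x = "k (Suc n)"
  have "vmul (Suc n) (snoc n A \<alpha>) (snoc n (dtens_one H n) \<beta>) k =
      sw R (\<lambda>r s. A k * (counit H r * end_mul (\<sigma> (Suc n)) ?t (end_act ?t \<alpha> s) \<beta> ?x))"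
    by (simp add: vmul_snoc[OF A V.one_in])
      (simp add: snoc_def V.one_act flin_scale[OF V.flin_mul_right] V.mul_one[OF A] mult_ac)
  also have "\<dots> = A k * end_mul (\<sigma> (Suc n)) ?t (end_act ?t \<alpha> 1) \<beta> ?x"
    by (subst sw_cmult, subst R_counit_left) (intro E.lin_mul_left E.lin_act \<alpha>, rule refl)
  finally show "vmul (Suc n) (snoc n A \<alpha>) (snoc n (dtens_one H n) \<beta>) k =
      snoc n A (end_mul (\<sigma> (Suc n)) ?t \<alpha> \<beta>) k"
    by (simp add: E.act_one[OF \<alpha>] snoc_def)
qed

lemma vact_snoc_counit:
  assumes A: "A \<in> dual_tensor_power H n"
  shows "vact (Suc n) (snoc n A (counit H)) h = snoc n (vact n A h) (counit H)"
proof
  fix k :: "nat \<Rightarrow> 'k"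
  have "vact (Suc n) (snoc n A (counit H)) h k =
      cp h (\<lambda>a b. (vact n A a k * counit H b) * counit H (k (Suc n)))"
    by (simp add: vact_snoc[OF A]) (simp add: snoc_def E.one_act mult.assoc)
  also have "\<dots> = vact n A h k * counit H (k (Suc n))"
    by (subst sw_multc, subst cp_counit_right) (intro V.lin_act A, rule refl)
  finally show "vact (Suc n) (snoc n A (counit H)) h k = snoc n (vact n A h) (counit H) k"
    by (simp add: snoc_def)
qed

lemma vact_snoc_one:
  assumes \<alpha>: "\<alpha> \<in> dual H"
  shows "vact (Suc n) (snoc n (dtens_one H n) \<alpha>) h = snoc n (dtens_one H n) (end_act (\<tau> (Suc n)) \<alpha> h)"
proof
  fix k :: "nat \<Rightarrow> 'k"
  have "vact (Suc n) (snoc n (dtens_one H n) \<alpha>) h k =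
      cp h (\<lambda>a b. dtens_one H n k * (counit H a * end_act (\<tau> (Suc n)) \<alpha> b (k (Suc n))))"
    by (simp add: vact_snoc[OF V.one_in]) (simp add: snoc_def V.one_act mult_ac)
  also have "\<dots> = dtens_one H n k * end_act (\<tau> (Suc n)) \<alpha> h (k (Suc n))"
    by (subst sw_cmult, subst cp_counit_left) (intro E.lin_act \<alpha>, rule refl)
  finally show "vact (Suc n) (snoc n (dtens_one H n) \<alpha>) h k =
      snoc n (dtens_one H n) (end_act (\<tau> (Suc n)) \<alpha> h) k"
    by (simp add: snoc_def)
qed

lemma vact_dplace1:
  assumes \<alpha>: "\<alpha> \<in> dual H"
  shows "i \<in> {1..n} \<Longrightarrow> vact n (dplace1 H n i \<alpha>) h = dplace1 H n i (end_act (\<tau> i) \<alpha> h)"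
proof (induction n)
  case (Suc n)
  from Suc.prems show ?case
  proof (cases rule: atLeastAtMost_SucE)
    case 1
    then show ?thesis
      using Suc.IH by (simp add: dplace1_Suc vact_snoc_counit dplace1_in \<alpha>)
  next
    case 2
    then show ?thesis by (simp add: dplace1_last vact_snoc_one \<alpha>)
  qed
qed simp

lemma vmul_same_end:
  assumes \<alpha>: "\<alpha> \<in> dual H" and \<beta>: "\<beta> \<in> dual H"
  shows "i \<in> {1..n} \<Longrightarrow> vmul n (dplace1 H n i \<alpha>) (dplace1 H n i \<beta>) =
    dplace1 H n i (end_mul (\<sigma> i) (\<tau> i) \<alpha> \<beta>)"
proof (induction n)
  case (Suc n)
  from Suc.prems show ?case
  proof (cases rule: atLeastAtMost_SucE)
    case 1
    then show ?thesis
      using Suc.IH by (simp add: dplace1_Suc vmul_snoc_counit dplace1_in counit_linear \<alpha> \<beta>)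
  next
    case 2
    then show ?thesis by (simp add: dplace1_last vmul_snoc_one V.one_in \<alpha>)
  qed
qed simp

lemma vmul_increasing:
  assumes \<alpha>: "\<alpha> \<in> dual H" and \<beta>: "\<beta> \<in> dual H"
  shows "i \<in> {1..n} \<Longrightarrow> j \<in> {1..n} \<Longrightarrow> i < j \<Longrightarrow>
    vmul n (dplace1 H n i \<alpha>) (dplace1 H n j \<beta>) = dplace2 H n i j (dpure 2 (tup [\<alpha>, \<beta>]))"
proof (induction n)
  case (Suc n)
  from Suc.prems(2) show ?case
  proof (cases rule: atLeastAtMost_SucE)
    case 1
    with Suc.prems have "i \<in> {1..n}" by simp
    then show ?thesis
      using Suc 1 by (simp add: dplace1_Suc dplace2_Suc vmul_snoc_counit dplace1_in counit_linear \<alpha> \<beta>)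
  next
    case 2
    with Suc.prems have i: "i \<in> {1..n}" by simp
    have "dplace1 H (Suc n) i \<alpha> = snoc n (dplace1 H n i \<alpha>) (counit H)"
      using i by (simp add: dplace1_Suc)
    then show ?thesis
      using i 2 by (simp only: dplace1_last dplace2_last vmul_snoc_counit dplace1_in V.one_in \<alpha> \<beta> V.mul_one)
  qed
qed simp

text \<open>
  Only here does the braiding show: with \<open>i\<close> the last end, \<open>(1 \<otimes> \<alpha>)((\<beta>)\<^sub>j \<otimes> 1)\<close> is
  \<open>(\<beta>)\<^sub>j \<lhd> R\<^sub>(\<^sub>1\<^sub>) \<otimes> \<alpha> \<lhd> R\<^sub>(\<^sub>2\<^sub>)\<close>, and further ends on the right do not change it.
\<close>

lemma vmul_decreasing:
  assumes \<alpha>: "\<alpha> \<in> dual H" and \<beta>: "\<beta> \<in> dual H"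
  shows "i \<in> {1..n} \<Longrightarrow> j \<in> {1..n} \<Longrightarrow> j < i \<Longrightarrow>
    vmul n (dplace1 H n i \<alpha>) (dplace1 H n j \<beta>) =
    (\<lambda>k. sw R (\<lambda>r s. dplace2 H n i j (dpure 2 (tup [end_act (\<tau> i) \<alpha> s, end_act (\<tau> j) \<beta> r])) k))"
proof (induction n)
  case (Suc n)
  from Suc.prems(1) show ?case
  proof (cases rule: atLeastAtMost_SucE)
    case 1
    with Suc.prems have "j \<in> {1..n}" by simp
    then show ?thesis
      using Suc 1 by (simp add: dplace1_Suc dplace2_Suc vmul_snoc_counit dplace1_in counit_linear \<alpha> \<beta>
          flin_sw[OF flin_snoc])
  next
    case 2
    with Suc.prems have j: "j \<in> {1..n}" by simp
    have "dplace1 H (Suc n) j \<beta> = snoc n (dplace1 H n j \<beta>) (counit H)"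
      using j by (simp add: dplace1_Suc)
    moreover have "end_act t \<alpha> s \<in> dual H" "end_act t \<beta> s \<in> dual H" for t s
      by (simp_all add: E.act_in \<alpha> \<beta>)
    ultimately show ?thesis
      using j 2
      by (simp add: dplace1_last vmul_snoc V.one_in dplace1_in \<beta> vact_dplace1 V.one_mul E.mul_one
          dplace2_commute[of H "Suc n" "Suc n" j] dplace2_last del: One_nat_def)
  qed
qed simp

lemma dpure_eq_foldr_vmul:
  "(\<And>i. i \<in> {1..n} \<Longrightarrow> \<alpha> i \<in> dual H) \<Longrightarrow>
    dpure n \<alpha> = foldr (vmul n) (map (\<lambda>i. dplace1 H n i (\<alpha> i)) [1..<n + 1]) (dtens_one H n)"
proof (induction n)
  case 0
  show ?case by (simp add: dtens_one_def dpure_def)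
next
  case (Suc n)
  have fold: "foldr (vmul n) (map (\<lambda>i. dplace1 H n i (\<alpha> i)) xs) (dtens_one H n) \<in> dual_tensor_power H n \<and>
      foldr (vmul (Suc n)) (map (\<lambda>i. dplace1 H (Suc n) i (\<alpha> i)) xs) (snoc n (dtens_one H n) (\<alpha> (Suc n))) =
      snoc n (foldr (vmul n) (map (\<lambda>i. dplace1 H n i (\<alpha> i)) xs) (dtens_one H n)) (\<alpha> (Suc n))"
    if "set xs \<subseteq> {1..n}" for xs
    using that
  proof (induction xs)
    case Nil
    show ?case by (simp add: V.one_in)
  next
    case (Cons i xs)
    then have "\<alpha> i \<in> dual H" "\<alpha> (Suc n) \<in> dual H" "i \<noteq> Suc n"
      using Suc.prems by auto
    with Cons show ?case
      by (simp add: dplace1_Suc vmul_snoc_counit dplace1_in V.mul_in)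
  qed
  have "\<alpha> (Suc n) \<in> dual H"
    using Suc.prems by simp
  then have "vmul (Suc n) (dplace1 H (Suc n) (Suc n) (\<alpha> (Suc n))) (dtens_one H (Suc n)) =
      snoc n (dtens_one H n) (\<alpha> (Suc n))"
    by (simp add: dplace1_last V.mul_one snoc_in V.one_in)
  moreover have "[1..<Suc n + 1] = [1..<n + 1] @ [Suc n]"
    by simp
  moreover have "set [1..<n + 1] \<subseteq> {1..n}"
    by auto
  ultimately have "foldr (vmul (Suc n)) (map (\<lambda>i. dplace1 H (Suc n) i (\<alpha> i)) [1..<Suc n + 1]) (dtens_one H (Suc n)) =
      snoc n (foldr (vmul n) (map (\<lambda>i. dplace1 H n i (\<alpha> i)) [1..<n + 1]) (dtens_one H n)) (\<alpha> (Suc n))"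
    using fold[of "[1..<n + 1]"] by (simp only: map_append foldr_append) simp
  with Suc show ?case by (simp add: dpure_Suc)
qed

end


section \<open>Sweedler notation in the dual\<close>

context fin_dim_hopf_algebra
begin

lemma sweedler_mult: "sweedler H \<alpha> m a \<Longrightarrow> \<alpha> (x * y) = (\<Sum>p<m. a p 1 x * a p 2 y)"
  unfolding sweedler_def dcop_def by (drule conjunct2, drule fun_cong[of _ _ "tup [x, y]"])
    (simp add: dpure_2 tup_2)

lemma sweedler_lin: "sweedler H \<alpha> m a \<Longrightarrow> p < m \<Longrightarrow> lin (a p 1)" "sweedler H \<alpha> m a \<Longrightarrow> p < m \<Longrightarrow> lin (a p 2)"
  by (simp_all add: sweedler_def dual_iff_lin)

text \<open>The form \<open>\<Delta>(\<alpha>)\<close> is bilinear, and every bilinear form is a sum of pure ones.\<close>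

lemma sweedler_exists:
  assumes \<alpha>: "\<alpha> \<in> dual H"
  shows "\<exists>m a. sweedler H \<alpha> m a"
proof -
  have \<alpha>': "lin \<alpha>"
    using \<alpha> by (simp add: dual_iff_lin)
  have "bilin (\<lambda>x y. \<alpha> (x * y))"
    by (intro bilinI lin_comp[OF \<alpha>'] lin_intros)
  then have "dcop \<alpha> \<in> dual_tensor_power H 2"
    using mforms_2I unfolding dual_tensor_power_eq_mforms dcop_def by blast
  then obtain m :: nat and c b where b: "\<forall>p<m. \<forall>i\<in>{1..2}. b p i \<in> dual H"
      "dcop \<alpha> = (\<lambda>k. \<Sum>p<m. c p * dpure 2 (b p) k)"
    unfolding dual_tensor_power_def by blast
  have "sweedler H \<alpha> m (\<lambda>p. (b p)(1 := \<lambda>x. c p * b p 1 x))"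
    unfolding sweedler_def using b by (auto simp: dpure_2 dual_iff_lin mult.assoc intro!: lin_cmult)
  then show ?thesis by blast
qed

lemma pairing_eval:
  assumes "x \<in> tensor_power H 2" "lin \<alpha>" "lin \<beta>"
  shows "pairing (dpure 2 (tup [\<alpha>, \<beta>])) x = sw x (\<lambda>a b. \<alpha> a * \<beta> b)"
proof -
  have "bilin (\<lambda>a b. \<alpha> a * \<beta> b)"
    by (intro bilinI lin_intros assms)
  then show ?thesis
    by (simp add: sw_eval[OF assms(1)] pairing_def dpure_2[abs_def] tup_2)
qed

lemma dmult_eval: "lin \<alpha> \<Longrightarrow> lin \<beta> \<Longrightarrow> dmult H \<alpha> \<beta> x = cp x (\<lambda>a b. \<alpha> a * \<beta> b)"
  by (simp add: dmult_def pairing_eval[OF cop_in])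

lemma klin_antipode_pow: "klin (antipode H ^^ t)"
proof (induction t)
  case 0
  show ?case using klin_id by (simp add: id_def)
next
  case (Suc t)
  from klin_antipode[OF this] show ?case by (simp add: o_def)
qed

lemma dantipode_pow: "(dantipode H ^^ t) \<alpha> h = \<alpha> ((antipode H ^^ t) h)"
  by (induction t arbitrary: h) (simp_all add: dantipode_def funpow_swap1[of "antipode H"])

end

context vertex_data
begin

lemma end_act_sweedler:
  assumes "sweedler H \<alpha> m a" "t \<in> {0, 1}"
  shows "end_act t \<alpha> h x = (\<Sum>p<m. a p (1 + t) ((antipode H ^^ t) h) * a p (2 - t) x)"
proof -
  have one: "2 - 1 = (1::nat)" "antipode H ^^ 1 = antipode H"
    by (simp_all add: One_nat_def)
  consider "t = 0" | "t = 1"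
    using assms(2) by blast
  then show ?thesis
  proof cases
    case 1
    then show ?thesis by (simp add: end_act_def translate_def sweedler_mult[OF assms(1)])
  next
    case 2
    show ?thesis
      unfolding 2 one one_add_one
      by (simp add: end_act_def translate_def sweedler_mult[OF assms(1)] mult.commute)
  qed
qed

text \<open>
  For \<open>s = 0\<close> the two formulas express the same product, the one for outgoing ends after
  moving \<open>R\<close> to the other side of \<open>\<Delta>(k)\<close>.
\<close>

lemma end_mul_sweedler:
  assumes a: "sweedler H \<alpha> m a" and b: "sweedler H \<beta> l b" and \<alpha>: "\<alpha> \<in> dual H" and \<beta>: "\<beta> \<in> dual H"
    and s: "s \<in> {0, 1}" and t: "t \<in> {0, 1}"
  shows "end_mul s t \<alpha> \<beta> =
    (if s = 0 \<and> t = 0 then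
       (\<lambda>x. \<Sum>q<l. \<Sum>p<m. pairing (dpure 2 (tup [b q 1, a p 1])) R * dmult H (b q 2) (a p 2) x)
     else if s = 0 \<and> t = 1 then
       (\<lambda>x. \<Sum>q<l. \<Sum>p<m. pairing (dpure 2 (tup [b q 2, a p 2])) R * dmult H (a p 1) (b q 1) x)
     else if s = 1 \<and> t = 0 then dmult H \<alpha> \<beta>
     else dmult H \<beta> \<alpha>)"
proof -
  note la = sweedler_lin[OF a] and lb = sweedler_lin[OF b]
  have \<alpha>': "lin \<alpha>" and \<beta>': "lin \<beta>" using \<alpha> \<beta> by (simp_all add: dual_iff_lin)
  note eval = pairing_eval[OF R_in] dmult_eval
  have incoming: "end_mul 0 t \<alpha> \<beta> x = (\<Sum>q<l. \<Sum>p<m. pairing (dpure 2 (tup [b q 1, a p 1])) R * dmult H (b q 2) (a p 2) x)"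
    for x
  proof -
    have "end_mul 0 t \<alpha> \<beta> x = cp x (\<lambda>u v. sw R (\<lambda>c d. \<Sum>q<l. \<Sum>p<m. (b q 1 c * a p 1 d) * (b q 2 u * a p 2 v)))"
      by (simp add: end_mul_def end_cop_def sweedler_mult[OF a] sweedler_mult[OF b] sum_product
          sum.swap[of _ "{..<l}" "{..<m}"] mult_ac)
    also have "\<dots> = (\<Sum>q<l. \<Sum>p<m. sw R (\<lambda>c d. b q 1 c * a p 1 d) * cp x (\<lambda>u v. b q 2 u * a p 2 v))"
      by (simp add: sw_sum sw_multc sw_cmult)
    also have "\<dots> = (\<Sum>q<l. \<Sum>p<m. pairing (dpure 2 (tup [b q 1, a p 1])) R * dmult H (b q 2) (a p 2) x)"
      by (intro sum.cong refl) (simp add: eval la lb)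
    finally show ?thesis .
  qed
  have outgoing: "end_mul 0 t \<alpha> \<beta> x = (\<Sum>q<l. \<Sum>p<m. pairing (dpure 2 (tup [b q 2, a p 2])) R * dmult H (a p 1) (b q 1) x)"
    for x
  proof -
    have f: "bilin (\<lambda>c d. \<alpha> d * \<beta> c)"
      by (intro bilinI lin_intros \<alpha>' \<beta>')
    have "end_mul 0 t \<alpha> \<beta> x = cp x (\<lambda>u v. sw R (\<lambda>c d. \<alpha> (d * v) * \<beta> (c * u)))"
      by (simp add: end_mul_def end_cop_def)
    also have "\<dots> = sw R (\<lambda>c d. cp x (\<lambda>u v. \<alpha> (d * v) * \<beta> (c * u)))"
      by (rule sw_swap)
    also have "\<dots> = cp x (\<lambda>u v. sw R (\<lambda>c d. \<alpha> (u * d) * \<beta> (v * c)))"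
      by (rule R_cop[OF f])
    also have "\<dots> = cp x (\<lambda>u v. sw R (\<lambda>c d. \<Sum>q<l. \<Sum>p<m. (b q 2 c * a p 2 d) * (a p 1 u * b q 1 v)))"
      by (simp add: sweedler_mult[OF a] sweedler_mult[OF b] sum_product
          sum.swap[of _ "{..<l}" "{..<m}"] mult_ac)
    also have "\<dots> = (\<Sum>q<l. \<Sum>p<m. sw R (\<lambda>c d. b q 2 c * a p 2 d) * cp x (\<lambda>u v. a p 1 u * b q 1 v))"
      by (simp add: sw_sum sw_multc sw_cmult)
    also have "\<dots> = (\<Sum>q<l. \<Sum>p<m. pairing (dpure 2 (tup [b q 2, a p 2])) R * dmult H (a p 1) (b q 1) x)"
      by (intro sum.cong refl) (simp add: eval la lb)
    finally show ?thesis .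
  qed
  consider "s = 0" "t = 0" | "s = 0" "t = 1" | "s = 1" "t = 0" | "s = 1" "t = 1"
    using s t by auto
  then show ?thesis
  proof cases
    case 1
    then show ?thesis using incoming by (simp add: fun_eq_iff)
  next
    case 2
    then show ?thesis using outgoing by (simp add: fun_eq_iff)
  next
    case 3
    then show ?thesis by (simp add: fun_eq_iff dmult_eval \<alpha>' \<beta>' end_mul_def end_cop_def)
  next
    case 4
    then show ?thesis by (simp add: fun_eq_iff dmult_eval \<alpha>' \<beta>' end_mul_def end_cop_def mult.commute)
  qed
qed

end


context fin_dim_hopf_algebra
begin

lemma sweedler_in_dual:
  assumes "sweedler H \<alpha> m a" "p < m" "t \<in> {0, 1}"
  shows "a p (1 + t) \<in> dual H" "a p (2 - t) \<in> dual H"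
proof -
  have one: "2 - 1 = (1::nat)"
    by (simp add: One_nat_def)
  consider "t = 0" | "t = 1"
    using assms(3) by blast
  then have "a p (1 + t) \<in> dual H \<and> a p (2 - t) \<in> dual H"
  proof cases
    case 1
    then show ?thesis using sweedler_lin[OF assms(1,2)] by (simp add: dual_iff_lin)
  next
    case 2
    show ?thesis
      unfolding 2 one one_add_one using sweedler_lin[OF assms(1,2)] by (simp add: dual_iff_lin)
  qed
  then show "a p (1 + t) \<in> dual H" "a p (2 - t) \<in> dual H" by simp_all
qed

lemma dpure_2_in: "\<alpha> \<in> dual H \<Longrightarrow> \<beta> \<in> dual H \<Longrightarrow> dpure 2 (tup [\<alpha>, \<beta>]) \<in> dual_tensor_power H 2"
  by (rule dpure_in) (auto simp: tup_def nth_Cons split: nat.splits)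

lemma pairing_tens_map:
  assumes x: "x \<in> tensor_power H 2" and \<alpha>: "lin \<alpha>" and \<beta>: "lin \<beta>" and f: "klin f" and g: "klin g"
  shows "pairing (dpure 2 (tup [\<alpha>, \<beta>])) (tens_map H 2 (tup [f, g]) x) = sw x (\<lambda>a b. \<alpha> (f a) * \<beta> (g b))"
proof -
  have "bilin (\<lambda>a b. \<alpha> (f a) * \<beta> (g b))"
    by (intro bilinI lin_cmult lin_multc lin_comp[OF \<alpha> f] lin_comp[OF \<beta> g])
  moreover have "dpure 2 (tup [\<alpha>, \<beta>]) \<in> mforms H 2"
    using \<alpha> \<beta> dpure_2_in by (simp add: dual_iff_lin dual_tensor_power_eq_mforms)
  ultimately show ?thesis
    by (simp add: pairing_def tens_map_def sw_eval[OF x] dpure_2 tup_2)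
qed

end

context vertex_data
begin

text \<open>
  The indices \<open>1 + \<tau>\<close> and \<open>2 - \<tau>\<close> select the factor of \<open>\<Delta>(\<alpha>)\<close> that is evaluated on
  \<open>S\<^sup>\<tau>(h)\<close> and the one that remains in \<open>\<alpha> \<lhd> h\<close>.
\<close>

lemma vmul_decreasing_sweedler:
  assumes a: "sweedler H \<alpha> m a" and b: "sweedler H \<beta> l b" and \<alpha>: "\<alpha> \<in> dual H" and \<beta>: "\<beta> \<in> dual H"
    and ij: "i \<in> {1..n}" "j \<in> {1..n}" "j < i" and ti: "\<tau> i \<in> {0, 1}" and tj: "\<tau> j \<in> {0, 1}"
  shows "vmul n (dplace1 H n i \<alpha>) (dplace1 H n j \<beta>) =
    (\<lambda>k. \<Sum>q<l. \<Sum>p<m.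
       pairing (dpure 2 (tup [b q (1 + \<tau> j), a p (1 + \<tau> i)]))
         (tens_map H 2 (tup [antipode H ^^ \<tau> j, antipode H ^^ \<tau> i]) R) *
       dplace2 H n i j (dpure 2 (tup [a p (2 - \<tau> i), b q (2 - \<tau> j)])) k)"
proof
  fix k
  let ?c = "\<Prod>l\<in>{1..n} - {i, j}. counit H (k l)"
  let ?A = "\<lambda>p s. a p (1 + \<tau> i) ((antipode H ^^ \<tau> i) s)" and ?B = "\<lambda>q r. b q (1 + \<tau> j) ((antipode H ^^ \<tau> j) r)"
  let ?D = "\<lambda>p q. dplace2 H n i j (dpure 2 (tup [a p (2 - \<tau> i), b q (2 - \<tau> j)])) k"
  have "vmul n (dplace1 H n i \<alpha>) (dplace1 H n j \<beta>) k =
      sw R (\<lambda>r s. end_act (\<tau> i) \<alpha> s (k i) * end_act (\<tau> j) \<beta> r (k j) * ?c)"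
    by (simp add: vmul_decreasing[OF \<alpha> \<beta> ij] dplace2_def dpure_2 tup_2)
  also have "\<dots> = sw R (\<lambda>r s. \<Sum>q<l. \<Sum>p<m. (?B q r * ?A p s) * ?D p q)"
    by (simp add: end_act_sweedler[OF a ti] end_act_sweedler[OF b tj] dplace2_def dpure_2 tup_2
        sum_product sum_distrib_left sum_distrib_right sum.swap[of _ "{..<l}" "{..<m}"] mult_ac)
  also have "\<dots> = (\<Sum>q<l. \<Sum>p<m. sw R (\<lambda>r s. ?B q r * ?A p s) * ?D p q)"
    by (simp add: sw_sum sw_multc)
  also have "\<dots> = (\<Sum>q<l. \<Sum>p<m.
       pairing (dpure 2 (tup [b q (1 + \<tau> j), a p (1 + \<tau> i)]))
         (tens_map H 2 (tup [antipode H ^^ \<tau> j, antipode H ^^ \<tau> i]) R) * ?D p q)"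
    by (intro sum.cong refl) (simp add: pairing_tens_map[OF R_in] klin_antipode_pow
        sweedler_in_dual[OF a _ ti, unfolded dual_iff_lin] sweedler_in_dual[OF b _ tj, unfolded dual_iff_lin])
  finally show "vmul n (dplace1 H n i \<alpha>) (dplace1 H n j \<beta>) k = (\<Sum>q<l. \<Sum>p<m.
       pairing (dpure 2 (tup [b q (1 + \<tau> j), a p (1 + \<tau> i)]))
         (tens_map H 2 (tup [antipode H ^^ \<tau> j, antipode H ^^ \<tau> i]) R) * ?D p q)" .
qed

lemma dtens_algebra_vmul: "dtens_algebra H n (vmul n)"
  unfolding dtens_algebra_def Let_def
  by (simp add: V.mul_in V.mul_assoc V.one_mul V.mul_one flinD[OF flin_vmul(1)] flinD[OF flin_vmul(2)])

lemma vertex_multiplication_vmul: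
  assumes \<sigma>: "\<And>i. i \<in> {1..n} \<Longrightarrow> \<sigma> i \<in> {0, 1}" and \<tau>: "\<And>i. i \<in> {1..n} \<Longrightarrow> \<tau> i \<in> {0, 1}"
  shows "vertex_multiplication H R n \<sigma> \<tau> (vmul n)"
  unfolding vertex_multiplication_def
proof (intro conjI allI ballI impI)
  show "dtens_algebra H n (vmul n)"
    by (rule dtens_algebra_vmul)
  show "dpure n \<alpha> = foldr (vmul n) (map (\<lambda>i. dplace1 H n i (\<alpha> i)) [1..<n + 1]) (dtens_one H n)"
    if "\<forall>i\<in>{1..n}. \<alpha> i \<in> dual H" for \<alpha>
    using that by (intro dpure_eq_foldr_vmul) simp
next
  fix \<alpha> \<beta> m a l b i j
  assume \<alpha>: "\<alpha> \<in> dual H" and \<beta>: "\<beta> \<in> dual H" and ab: "sweedler H \<alpha> m a \<and> sweedler H \<beta> l b"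
    and i: "i \<in> {1..n}" and j: "j \<in> {1..n}"
  show "vmul n (dplace1 H n i \<alpha>) (dplace1 H n j \<beta>) = dplace2 H n i j (dpure 2 (tup [\<alpha>, \<beta>]))" if "i < j"
    using vmul_increasing[OF \<alpha> \<beta> i j that] .
  show "vmul n (dplace1 H n i \<alpha>) (dplace1 H n j \<beta>) =
      (\<lambda>k. \<Sum>q<l. \<Sum>p<m.
       pairing (dpure 2 (tup [b q (1 + \<tau> j), a p (1 + \<tau> i)]))
         (tens_map H 2 (tup [antipode H ^^ \<tau> j, antipode H ^^ \<tau> i]) R) *
       dplace2 H n i j (dpure 2 (tup [a p (2 - \<tau> i), b q (2 - \<tau> j)])) k)" if "j < i"
    using ab by (intro vmul_decreasing_sweedler \<alpha> \<beta> i j that \<tau>) auto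
next
  fix \<alpha> \<beta> m a l b i
  assume \<alpha>: "\<alpha> \<in> dual H" and \<beta>: "\<beta> \<in> dual H" and ab: "sweedler H \<alpha> m a \<and> sweedler H \<beta> l b"
    and i: "i \<in> {1..n}"
  let ?c = "\<lambda>k. \<Prod>j\<in>{1..n} - {i}. counit H (k j)"
  have *: "vmul n (dplace1 H n i \<alpha>) (dplace1 H n i \<beta>) = (\<lambda>k. end_mul (\<sigma> i) (\<tau> i) \<alpha> \<beta> (k i) * ?c k)"
    by (simp add: vmul_same_end[OF \<alpha> \<beta> i] dplace1_eval[OF i] fun_eq_iff)
  show "vmul n (dplace1 H n i \<alpha>) (dplace1 H n i \<beta>) =
           (if \<sigma> i = 0 \<and> \<tau> i = 0 then
              (\<lambda>k. \<Sum>q<l. \<Sum>p<m. pairing (dpure 2 (tup [b q 1, a p 1])) R *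
                                  dplace1 H n i (dmult H (b q 2) (a p 2)) k)
            else if \<sigma> i = 0 \<and> \<tau> i = 1 then
              (\<lambda>k. \<Sum>q<l. \<Sum>p<m. pairing (dpure 2 (tup [b q 2, a p 2])) R *
                                  dplace1 H n i (dmult H (a p 1) (b q 1)) k)
            else if \<sigma> i = 1 \<and> \<tau> i = 0 then dplace1 H n i (dmult H \<alpha> \<beta>)
            else dplace1 H n i (dmult H \<beta> \<alpha>))"
    unfolding * end_mul_sweedler[OF conjunct1[OF ab] conjunct2[OF ab] \<alpha> \<beta> \<sigma>[OF i] \<tau>[OF i]]
    by (simp add: fun_eq_iff dplace1_eval[OF i] sum_distrib_right mult.assoc)
qed

end


section \<open>Uniqueness of the multiplication\<close>

context fin_dim_hopf_algebra
begin

text \<open>The subspace \<open>1 \<otimes> \<dots> \<otimes> 1 \<otimes> K\<^sup>* \<otimes> \<dots> \<otimes> K\<^sup>*\<close> with \<open>K\<^sup>*\<close> in the factors from the \<open>j\<close>th on.\<close>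

inductive_set tail_tensors :: "nat \<Rightarrow> nat \<Rightarrow> ('f, 'k) dtens set" for n j where
  pure: "(\<And>i. i \<in> {1..n} \<Longrightarrow> \<beta> i \<in> dual H) \<Longrightarrow> (\<And>i. i \<in> {1..n} \<Longrightarrow> i < j \<Longrightarrow> \<beta> i = counit H) \<Longrightarrow>
    dpure n \<beta> \<in> tail_tensors n j"
| lincomb: "A \<in> tail_tensors n j \<Longrightarrow> B \<in> tail_tensors n j \<Longrightarrow> (\<lambda>k. c * A k + B k) \<in> tail_tensors n j"

lemma tail_tensors_subset: "A \<in> tail_tensors n j \<Longrightarrow> A \<in> dual_tensor_power H n"
  by (induction rule: tail_tensors.induct)
    (auto intro: dpure_in lincomb_closedD[OF lincomb_closed_dual_tensor_power])

lemma tail_tensors_1: "tail_tensors n 1 = dual_tensor_power H n"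
proof
  show "dual_tensor_power H n \<subseteq> tail_tensors n 1"
  proof
    fix A assume "A \<in> dual_tensor_power H n"
    then show "A \<in> tail_tensors n 1"
      by (induction rule: dual_tensor_power_induct) (auto intro: tail_tensors.intros)
  qed
qed (auto intro: tail_tensors_subset)

text \<open>
  In the product \<open>(\<beta>\<^sup>1)\<^sub>1 \<cdots> (\<beta>\<^sup>n)\<^sub>n\<close> trivial factors can be dropped, so multiplying from the left by a
  generator in front of all others just fills its slot.
\<close>

lemma ordered_mult:
  assumes algebra: "dtens_algebra H n mul"
    and fold: "\<And>\<alpha>. (\<And>i. i \<in> {1..n} \<Longrightarrow> \<alpha> i \<in> dual H) \<Longrightarrow>
      dpure n \<alpha> = foldr mul (map (\<lambda>i. dplace1 H n i (\<alpha> i)) [1..<n + 1]) (dtens_one H n)"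
    and i: "i \<in> {1..n}" and \<alpha>: "\<alpha> \<in> dual H"
    and \<beta>: "\<And>l. l \<in> {1..n} \<Longrightarrow> \<beta> l \<in> dual H" "\<And>l. l \<in> {1..n} \<Longrightarrow> l \<le> i \<Longrightarrow> \<beta> l = counit H"
  shows "mul (dplace1 H n i \<alpha>) (dpure n \<beta>) = dpure n (\<beta>(i := \<alpha>))"
proof -
  let ?F = "\<lambda>\<beta> xs. foldr mul (map (\<lambda>i. dplace1 H n i (\<beta> i)) xs) (dtens_one H n)"
  have one: "A \<in> dual_tensor_power H n \<Longrightarrow> mul (dtens_one H n) A = A" for A
    using algebra by (simp add: dtens_algebra_def Let_def)
  have F_in: "?F \<gamma> xs \<in> dual_tensor_power H n"
    if "\<And>l. l \<in> {1..n} \<Longrightarrow> \<gamma> l \<in> dual H" "set xs \<subseteq> {1..n}" for \<gamma> xs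
    using that(2)
  proof (induction xs)
    case (Cons l xs)
    then show ?case
      using algebra that(1) by (simp add: dtens_algebra_def Let_def dplace1_in)
  qed (simp add: dtens_one_in)
  have drop: "foldr mul (map (\<lambda>i. dplace1 H n i (\<gamma> i)) xs) A = A"
    if "\<And>l. l \<in> set xs \<Longrightarrow> \<gamma> l = counit H" "A \<in> dual_tensor_power H n" for \<gamma> xs A
    using that by (induction xs) (simp_all add: dplace1_counit one)
  let ?\<beta> = "\<beta>(i := \<alpha>)"
  have split: "[1..<n + 1] = [1..<i] @ i # [i + 1..<n + 1]"
  proof -
    have "[1..<n + 1] = [1..<i] @ [i..<n + 1]"
      using i upt_add_eq_append[of 1 i "n + 1 - i"] by simp
    moreover have "[i..<n + 1] = i # [i + 1..<n + 1]"
      using i upt_conv_Cons[of i "n + 1"] by (simp add: Suc_eq_plus1)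
    ultimately show ?thesis by simp
  qed
  have tail: "?F ?\<beta> [i + 1..<n + 1] = ?F \<beta> [i + 1..<n + 1]"
    by (intro arg_cong[of _ _ "\<lambda>xs. foldr mul xs _"] map_cong refl) auto
  have tail_in: "?F \<beta> [i + 1..<n + 1] \<in> dual_tensor_power H n"
    using i by (intro F_in \<beta>) auto
  have one_i: "dplace1 H n i (\<beta> i) = dtens_one H n"
    using \<beta>(2)[OF i] by (simp add: dplace1_counit)
  have "dpure n \<beta> = ?F \<beta> [1..<n + 1]"
    by (rule fold) (rule \<beta>)
  also have "\<dots> = foldr mul (map (\<lambda>i. dplace1 H n i (\<beta> i)) [1..<i]) (?F \<beta> [i + 1..<n + 1])"
    unfolding split by (simp add: one_i one tail_in del: upt_Suc)
  also have "\<dots> = ?F \<beta> [i + 1..<n + 1]"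
    using i by (intro drop tail_in \<beta>) auto
  finally have 1: "dpure n \<beta> = ?F \<beta> [i + 1..<n + 1]" .
  have "dpure n ?\<beta> = ?F ?\<beta> [1..<n + 1]"
    by (rule fold) (simp add: \<alpha> \<beta>)
  also have "\<dots> = foldr mul (map (\<lambda>i. dplace1 H n i (?\<beta> i)) [1..<i])
      (mul (dplace1 H n i \<alpha>) (?F ?\<beta> [i + 1..<n + 1]))"
    unfolding split by (simp del: upt_Suc)
  also have "\<dots> = mul (dplace1 H n i \<alpha>) (?F ?\<beta> [i + 1..<n + 1])"
  proof (rule drop)
    show "?\<beta> l = counit H" if "l \<in> set [1..<i]" for l
      using that i by (simp add: \<beta>(2))
    show "mul (dplace1 H n i \<alpha>) (?F ?\<beta> [i + 1..<n + 1]) \<in> dual_tensor_power H n"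
      using algebra tail_in unfolding tail by (simp add: dtens_algebra_def Let_def dplace1_in \<alpha>)
  qed
  finally show ?thesis
    unfolding tail 1 by simp
qed

end

context vertex_data
begin

text \<open>
  Multiplying by a generator from the left is determined by the relations: moving \<open>(\<alpha>)\<^sub>i\<close> to the
  right past \<open>(\<beta>)\<^sub>j\<close> with \<open>j < i\<close> creates only terms in which a generator at \<open>j\<close> precedes one at
  \<open>i\<close>, and two generators at the same end combine into one. Hence downward induction on the first
  occupied slot reduces every such product to ordered monomials.
\<close>

lemma vertex_multiplication_generator:
  assumes mul: "vertex_multiplication H R n \<sigma> \<tau> mul"
    and \<sigma>: "\<And>i. i \<in> {1..n} \<Longrightarrow> \<sigma> i \<in> {0, 1}" and \<tau>: "\<And>i. i \<in> {1..n} \<Longrightarrow> \<tau> i \<in> {0, 1}"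
    and j: "1 \<le> j" "j \<le> n + 1"
  shows "A \<in> tail_tensors n j \<Longrightarrow> i \<in> {j..n} \<Longrightarrow> \<alpha> \<in> dual H \<Longrightarrow>
    mul (dplace1 H n i \<alpha>) A = vmul n (dplace1 H n i \<alpha>) A \<and>
    vmul n (dplace1 H n i \<alpha>) A \<in> tail_tensors n j"
  using j
proof (induction "n + 1 - j" arbitrary: j A i \<alpha>)
  case 0
  then show ?case by simp
next
  case (Suc d)
  let ?D = "dual_tensor_power H n" and ?x = "dplace1 H n"
  have jn: "j \<in> {1..n}" using Suc.hyps(2) Suc.prems by auto
  have i: "i \<in> {1..n}" and ij: "j \<le> i" using Suc.prems by auto
  have algebra: "dtens_algebra H n mul"
    using mul by (simp add: vertex_multiplication_def)
  have mul_linear: "mul (\<lambda>k. c * A k + B k) C = (\<lambda>k. c * mul A C k + mul B C k)"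
    "mul C (\<lambda>k. c * A k + B k) = (\<lambda>k. c * mul C A k + mul C B k)"
    if "A \<in> ?D" "B \<in> ?D" "C \<in> ?D" for A B C c
    using algebra that by (simp_all add: dtens_algebra_def Let_def)
  have mul_assoc: "mul (mul A B) C = mul A (mul B C)" if "A \<in> ?D" "B \<in> ?D" "C \<in> ?D" for A B C
    using algebra that by (simp add: dtens_algebra_def Let_def)
  have vmul: "vertex_multiplication H R n \<sigma> \<tau> (vmul n)"
    by (rule vertex_multiplication_vmul) (fact \<sigma> \<tau>)+
  have gen: "mul (?x i' \<alpha>') (?x j' \<beta>') = vmul n (?x i' \<alpha>') (?x j' \<beta>')"
    if ij': "i' \<in> {1..n}" "j' \<in> {1..n}" and \<alpha>': "\<alpha>' \<in> dual H" and \<beta>': "\<beta>' \<in> dual H" for i' j' \<alpha>' \<beta>'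
  proof -
    obtain m a l b where ab: "sweedler H \<alpha>' m a \<and> sweedler H \<beta>' l b"
      using sweedler_exists[OF \<alpha>'] sweedler_exists[OF \<beta>'] by blast
    note rel = mul[unfolded vertex_multiplication_def, THEN conjunct2, THEN conjunct2, rule_format,
        OF \<alpha>' \<beta>' ab]
      and rel' = vmul[unfolded vertex_multiplication_def, THEN conjunct2, THEN conjunct2, rule_format,
        OF \<alpha>' \<beta>' ab]
    consider "i' < j'" | "i' = j'" | "j' < i'" by linarith
    then show ?thesis
    proof cases
      case 1
      show ?thesis
        using conjunct1[OF conjunct2[OF rel, rule_format, OF ij']] vmul_increasing[OF \<alpha>' \<beta>' ij' 1] 1
        by simp
    next
      case 2
      with ij' have "mul (?x i' \<alpha>') (?x i' \<beta>') = vmul n (?x i' \<alpha>') (?x i' \<beta>')"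
        using rel rel' by simp
      then show ?thesis using 2 by simp
    next
      case 3
      with ij' show ?thesis
        using rel rel' by simp
    qed
  qed
  have fold: "dpure n \<alpha> = foldr mul (map (\<lambda>i. dplace1 H n i (\<alpha> i)) [1..<n + 1]) (dtens_one H n)"
    if "\<And>i. i \<in> {1..n} \<Longrightarrow> \<alpha> i \<in> dual H" for \<alpha>
    using mul that unfolding vertex_multiplication_def by blast
  have ordered: "mul (?x j \<gamma>) T = vmul n (?x j \<gamma>) T \<and> vmul n (?x j \<gamma>) T \<in> tail_tensors n j"
    if T: "T \<in> tail_tensors n (j + 1)" and \<gamma>: "\<gamma> \<in> dual H" for T \<gamma>
    using T
  proof (induction rule: tail_tensors.induct)
    case (pure \<beta>)
    then have "mul (?x j \<gamma>) (dpure n \<beta>) = dpure n (\<beta>(j := \<gamma>))"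
      "vmul n (?x j \<gamma>) (dpure n \<beta>) = dpure n (\<beta>(j := \<gamma>))"
      by (auto intro!: ordered_mult algebra fold jn \<gamma> dtens_algebra_vmul dpure_eq_foldr_vmul simp del: upt_Suc)
    moreover have "dpure n (\<beta>(j := \<gamma>)) \<in> tail_tensors n j"
      using pure \<gamma> by (intro tail_tensors.pure) auto
    ultimately show ?case by simp
  next
    case (lincomb A B c)
    then show ?case
      by (simp add: mul_linear tail_tensors_subset dplace1_in \<gamma> flinD[OF flin_vmul(2)] tail_tensors.lincomb)
  qed
  show ?case
    using Suc.prems(1)
  proof (induction rule: tail_tensors.induct)
    case (pure \<beta>)
    define T where "T = dpure n (\<beta>(j := counit H))"
    have T: "T \<in> tail_tensors n (j + 1)"
      unfolding T_def using pure counit_linear by (intro tail_tensors.pure) auto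
    have \<beta>j: "\<beta> j \<in> dual H" using pure jn by simp
    have "vmul n (?x j (\<beta> j)) T = dpure n ((\<beta>(j := counit H))(j := \<beta> j))"
      unfolding T_def using pure
      by (intro ordered_mult dtens_algebra_vmul dpure_eq_foldr_vmul jn \<beta>j) (auto simp: counit_linear)
    then have \<beta>: "dpure n \<beta> = vmul n (?x j (\<beta> j)) T" by simp
    \<comment> \<open>\<open>S\<close> is a subspace, so it contains the Sweedler sum of the relation once it contains the summands.\<close>
    define S where "S = {B \<in> ?D. mul B T = vmul n B T \<and> vmul n B T \<in> tail_tensors n j}"
    have ins: "?x l \<gamma> \<in> ?D" if "\<gamma> \<in> dual H" for l \<gamma>
      using that by (rule dplace1_in)
    have TD: "T \<in> ?D" by (rule tail_tensors_subset[OF T])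
    have closed: "lincomb_closed S"
      unfolding lincomb_closed_def
    proof (intro conjI allI ballI)
      have "?x j (counit H) \<in> S"
        unfolding S_def using ordered[OF T counit_linear] ins[OF counit_linear] by simp
      then show "S \<noteq> {}" by blast
      show "(\<lambda>k. c * A k + B k) \<in> S" if "A \<in> S" "B \<in> S" for c A B
        using that TD by (simp add: S_def mul_linear flinD[OF flin_vmul(1)] V.closed lincomb_closedD
            tail_tensors.lincomb)
    qed
    have "vmul n (?x i \<alpha>) (?x j (\<beta> j)) \<in> S"
    proof (cases "i = j")
      case True
      have "end_mul (\<sigma> j) (\<tau> j) \<alpha> (\<beta> j) \<in> dual H"
        using Suc.prems(3) \<beta>j by (rule E.mul_in)
      with ordered[OF T this] show ?thesis
        using jn by (simp add: True vmul_same_end Suc.prems(3) \<beta>j S_def ins)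
    next
      case False
      with ij have ji: "j < i" by simp
      have "vmul n (?x j \<beta>') (?x i \<alpha>') \<in> S" if \<alpha>': "\<alpha>' \<in> dual H" and \<beta>': "\<beta>' \<in> dual H" for \<alpha>' \<beta>'
      proof -
        have IH: "mul (?x i \<alpha>') T = vmul n (?x i \<alpha>') T \<and> vmul n (?x i \<alpha>') T \<in> tail_tensors n (j + 1)"
          using Suc.hyps(2) ji i jn by (intro Suc.hyps(1) T \<alpha>') auto
        have "mul (vmul n (?x j \<beta>') (?x i \<alpha>')) T = mul (?x j \<beta>') (mul (?x i \<alpha>') T)"
          by (simp add: gen[OF jn i \<beta>' \<alpha>', symmetric] mul_assoc ins \<alpha>' \<beta>' TD)
        also have "\<dots> = vmul n (?x j \<beta>') (vmul n (?x i \<alpha>') T)"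
          using IH ordered[OF _ \<beta>'] by simp
        also have "\<dots> = vmul n (vmul n (?x j \<beta>') (?x i \<alpha>')) T"
          by (simp add: V.mul_assoc ins \<alpha>' \<beta>' TD)
        finally show ?thesis
          using IH ordered[OF conjunct2[OF IH] \<beta>']
          by (simp add: S_def V.mul_in V.mul_assoc ins \<alpha>' \<beta>' TD)
      qed
      then have "dplace2 H n i j (dpure 2 (tup [\<alpha>', \<beta>'])) \<in> S" if "\<alpha>' \<in> dual H" "\<beta>' \<in> dual H" for \<alpha>' \<beta>'
        using that by (simp add: dplace2_commute[of H n i j] vmul_increasing[OF _ _ jn i ji, symmetric])
      then have "(\<lambda>k. sw R (\<lambda>r s. dplace2 H n i j
          (dpure 2 (tup [end_act (\<tau> i) \<alpha> s, end_act (\<tau> j) (\<beta> j) r])) k)) \<in> S"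
        by (intro lincomb_closed_sw closed) (simp add: E.act_in Suc.prems(3) \<beta>j)
      then show ?thesis
        by (simp add: vmul_decreasing[OF Suc.prems(3) \<beta>j i jn ji])
    qed
    moreover have "mul (?x i \<alpha>) (dpure n \<beta>) = mul (vmul n (?x i \<alpha>) (?x j (\<beta> j))) T"
    proof -
      have "mul (?x i \<alpha>) (dpure n \<beta>) = mul (?x i \<alpha>) (mul (?x j (\<beta> j)) T)"
        using ordered[OF T \<beta>j] by (simp add: \<beta>)
      also have "\<dots> = mul (mul (?x i \<alpha>) (?x j (\<beta> j))) T"
        by (simp add: mul_assoc ins Suc.prems(3) \<beta>j TD)
      finally show ?thesis
        by (simp only: gen[OF i jn Suc.prems(3) \<beta>j])
    qed
    moreover have "vmul n (?x i \<alpha>) (dpure n \<beta>) = vmul n (vmul n (?x i \<alpha>) (?x j (\<beta> j))) T"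
      by (simp add: \<beta> V.mul_assoc ins Suc.prems(3) \<beta>j TD)
    ultimately show ?case by (simp add: S_def)
  next
    case (lincomb A B c)
    then show ?case
      by (simp add: mul_linear tail_tensors_subset dplace1_in Suc.prems(3) flinD[OF flin_vmul(2)]
          tail_tensors.lincomb)
  qed
qed

text \<open>
  A pure tensor is a product of generators, which can be moved one by one into the second argument.
\<close>

lemma vertex_multiplication_unique:
  assumes mul: "vertex_multiplication H R n \<sigma> \<tau> mul"
    and \<sigma>: "\<And>i. i \<in> {1..n} \<Longrightarrow> \<sigma> i \<in> {0, 1}" and \<tau>: "\<And>i. i \<in> {1..n} \<Longrightarrow> \<tau> i \<in> {0, 1}"
    and A: "A \<in> dual_tensor_power H n" and B: "B \<in> dual_tensor_power H n"
  shows "mul A B = vmul n A B"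
  using A
proof (induction rule: dual_tensor_power_induct)
  case (pure \<alpha>)
  let ?D = "dual_tensor_power H n"
  have algebra: "dtens_algebra H n mul"
    using mul by (simp add: vertex_multiplication_def)
  have gen: "mul (dplace1 H n i (\<alpha> i)) C = vmul n (dplace1 H n i (\<alpha> i)) C" if "C \<in> ?D" "i \<in> {1..n}" for C i
    using vertex_multiplication_generator[OF mul \<sigma> \<tau>, of 1 C i "\<alpha> i"] that pure
    by (simp add: tail_tensors_1)
  let ?F = "\<lambda>mul xs. foldr mul (map (\<lambda>i. dplace1 H n i (\<alpha> i)) xs) (dtens_one H n)"
  have fold: "?F mul xs = ?F (vmul n) xs \<and> ?F (vmul n) xs \<in> ?D \<and> mul (?F (vmul n) xs) B = vmul n (?F (vmul n) xs) B"
    if "set xs \<subseteq> {1..n}" for xs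
    using that
  proof (induction xs)
    case Nil
    then show ?case
      using algebra B by (simp add: V.one_in V.one_mul dtens_algebra_def Let_def)
  next
    case (Cons i xs)
    let ?x = "dplace1 H n i (\<alpha> i)" and ?W = "?F (vmul n) xs"
    have i: "i \<in> {1..n}" and W: "?F mul xs = ?W" "?W \<in> ?D" "mul ?W B = vmul n ?W B"
      using Cons by auto
    have x: "?x \<in> ?D"
      using i pure by (simp add: dplace1_in)
    have "mul (vmul n ?x ?W) B = mul (mul ?x ?W) B"
      by (simp only: gen[OF W(2) i])
    also have "\<dots> = mul ?x (mul ?W B)"
      using algebra x W(2) B by (simp add: dtens_algebra_def Let_def)
    also have "\<dots> = vmul n ?x (vmul n ?W B)"
      by (simp only: W(3) gen[OF V.mul_in[OF W(2) B] i])
    also have "\<dots> = vmul n (vmul n ?x ?W) B"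
      by (simp add: V.mul_assoc x W(2) B)
    finally show ?case
      using W x by (simp add: gen[OF W(2) i] V.mul_in)
  qed
  have "dpure n \<alpha> = ?F (vmul n) [1..<n + 1]"
    by (rule dpure_eq_foldr_vmul) (rule pure)
  moreover have "set [1..<n + 1] \<subseteq> {1..n}"
    by auto
  ultimately show ?case
    using fold[of "[1..<n + 1]"] by (simp only: simp_thms)
next
  case (lincomb c A A')
  moreover have "dtens_algebra H n mul"
    using mul by (simp add: vertex_multiplication_def)
  ultimately show ?case
    using B by (simp add: dtens_algebra_def Let_def flinD[OF flin_vmul(1)])
qed

end


section \<open>The action in Sweedler notation\<close>

lemma sum_PiE_Suc:
  "(\<Sum>p\<in>Pi\<^sub>E {1..Suc n} T. F p) = (\<Sum>p\<in>Pi\<^sub>E {1..n} T. \<Sum>q\<in>T (Suc n). F (p(Suc n := q)))"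
proof -
  have "{1..Suc n} = insert (Suc n) {1..n}"
    by auto
  then have "(\<Sum>p\<in>Pi\<^sub>E {1..Suc n} T. F p) =
      (\<Sum>p\<in>(\<lambda>(q, p). p(Suc n := q)) ` (T (Suc n) \<times> Pi\<^sub>E {1..n} T). F p)"
    by (simp add: PiE_insert_eq)
  also have "\<dots> = (\<Sum>(q, p)\<in>T (Suc n) \<times> Pi\<^sub>E {1..n} T. F (p(Suc n := q)))"
    by (subst sum.reindex) (auto intro!: inj_combinator simp: case_prod_beta)
  also have "\<dots> = (\<Sum>q\<in>T (Suc n). \<Sum>p\<in>Pi\<^sub>E {1..n} T. F (p(Suc n := q)))"
    by (rule sum.cartesian_product[symmetric])
  also have "\<dots> = (\<Sum>p\<in>Pi\<^sub>E {1..n} T. \<Sum>q\<in>T (Suc n). F (p(Suc n := q)))"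
    by (rule sum.swap)
  finally show ?thesis .
qed

context vertex_data
begin

lemma dmult_eq_end_mul: "\<alpha> \<in> dual H \<Longrightarrow> \<beta> \<in> dual H \<Longrightarrow> dmult H \<alpha> \<beta> = end_mul 1 0 \<alpha> \<beta>"
  by (simp add: fun_eq_iff dmult_eval dual_iff_lin end_mul_def end_cop_def)

lemma foldr_dmult_in: "(\<And>\<alpha>. \<alpha> \<in> set xs \<Longrightarrow> \<alpha> \<in> dual H) \<Longrightarrow> foldr (dmult H) xs (counit H) \<in> dual H"
  by (induction xs) (simp_all add: counit_linear dmult_eq_end_mul E.mul_in)

lemma foldr_dmult_snoc:
  "(\<And>\<alpha>. \<alpha> \<in> set xs \<Longrightarrow> \<alpha> \<in> dual H) \<Longrightarrow> \<beta> \<in> dual H \<Longrightarrow>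
    foldr (dmult H) (xs @ [\<beta>]) (counit H) = dmult H (foldr (dmult H) xs (counit H)) \<beta>"
proof (induction xs)
  case Nil
  then show ?case by (simp add: dmult_eq_end_mul counit_linear E.mul_one E.one_mul)
next
  case (Cons \<alpha> xs)
  then show ?case
    using foldr_dmult_in[of xs] by (simp add: dmult_eq_end_mul E.mul_in E.mul_assoc)
qed

text \<open>
  The diagonal action splits off one factor \<open>h\<^sub>(\<^sub>2\<^sub>)\<close> at each end, and summing against it is the
  multiplication of \<open>K\<^sup>*\<close> from the right. Associativity in \<open>K\<^sup>*\<close> reconciles this left-nested product with the
  right-nested one in the formula.
\<close>

lemma vact_dpure:
  assumes "\<And>i. i \<in> {1..n} \<Longrightarrow> \<alpha> i \<in> dual H" "\<And>i. i \<in> {1..n} \<Longrightarrow> sweedler H (\<alpha> i) (m i) (a i)"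
    and "\<And>i. i \<in> {1..n} \<Longrightarrow> \<tau> i \<in> {0, 1}"
  shows "vact n (dpure n \<alpha>) h k =
    (\<Sum>p\<in>Pi\<^sub>E {1..n} (\<lambda>i. {..<m i}).
      foldr (dmult H)
        (map (\<lambda>i. (dantipode H ^^ \<tau> i) (a i (p i) (1 + \<tau> i))) [1..<n+1]) (counit H) h *
      dpure n (\<lambda>i. a i (p i) (2 - \<tau> i)) k)"
  using assms
proof (induction n arbitrary: h)
  case 0
  show ?case by (simp add: dpure_def)
next
  case (Suc n)
  let ?i = "Suc n" and ?S = "Pi\<^sub>E {1..n} (\<lambda>i. {..<m i})"
  define b where "b i q = (dantipode H ^^ \<tau> i) (a i q (1 + \<tau> i))" for i q
  define P where "P n p = foldr (dmult H) (map (\<lambda>i. b i (p i)) [1..<n + 1]) (counit H)" for n p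
  define C where "C n p = dpure n (\<lambda>i. a i (p i) (2 - \<tau> i)) k" for n p
  have b_in: "b i q \<in> dual H" if "i \<in> {1..Suc n}" "q < m i" for i q
  proof -
    have "lin (a i q (1 + \<tau> i))"
      using sweedler_in_dual(1)[OF Suc.prems(2)[OF that(1)] that(2) Suc.prems(3)[OF that(1)]]
      by (simp add: dual_iff_lin)
    from lin_comp[OF this klin_antipode_pow] show ?thesis
      by (simp add: b_def dual_iff_lin dantipode_pow[abs_def])
  qed
  have p_in: "p i < m i" if "p \<in> ?S" "i \<in> {1..n}" for p i
    using that by (auto simp: PiE_def Pi_def)
  have P_in: "P n p \<in> dual H" if "p \<in> ?S" for p
    unfolding P_def using p_in[OF that] by (intro foldr_dmult_in) (auto intro!: b_in)
  have P_Suc: "P (Suc n) (p(?i := q)) = dmult H (P n p) (b ?i q)" if "p \<in> ?S" "q < m ?i" for p q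
  proof -
    have "map (\<lambda>i. b i ((p(?i := q)) i)) [1..<Suc n + 1] = map (\<lambda>i. b i (p i)) [1..<n + 1] @ [b ?i q]"
    proof -
      have "[1..<Suc n + 1] = [1..<n + 1] @ [?i]"
        by (simp add: One_nat_def)
      then show ?thesis by (simp del: upt_Suc)
    qed
    moreover have "foldr (dmult H) (map (\<lambda>i. b i (p i)) [1..<n + 1] @ [b ?i q]) (counit H) =
        dmult H (P n p) (b ?i q)"
      unfolding P_def using p_in[OF that(1)] that(2)
      by (intro foldr_dmult_snoc) (auto intro!: b_in)
    ultimately show ?thesis by (simp only: P_def)
  qed
  have C_Suc: "C (Suc n) (p(?i := q)) = C n p * a ?i q (2 - \<tau> ?i) (k ?i)" for p q
  proof -
    have "dpure n (\<lambda>i. a i ((p(?i := q)) i) (2 - \<tau> i)) = dpure n (\<lambda>i. a i (p i) (2 - \<tau> i))"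
      by (rule dpure_cong) simp
    then show ?thesis by (simp add: C_def dpure_Suc snoc_def)
  qed
  have IH: "vact n (dpure n \<alpha>) x k = (\<Sum>p\<in>?S. P n p x * C n p)" for x
    unfolding P_def C_def b_def using Suc.prems by (intro Suc.IH) auto
  have last: "end_act (\<tau> ?i) (\<alpha> ?i) y (k ?i) = (\<Sum>q<m ?i. b ?i q y * a ?i q (2 - \<tau> ?i) (k ?i))" for y
    using end_act_sweedler[of "\<alpha> ?i" "m ?i" "a ?i" "\<tau> ?i"] Suc.prems(2,3)[of ?i]
    by (simp add: b_def dantipode_pow)
  have "dpure n \<alpha> \<in> dual_tensor_power H n"
    using Suc.prems(1) by (intro dpure_in) simp
  then have "vact (Suc n) (dpure (Suc n) \<alpha>) h k =
      cp h (\<lambda>x y. (\<Sum>p\<in>?S. P n p x * C n p) * (\<Sum>q<m ?i. b ?i q y * a ?i q (2 - \<tau> ?i) (k ?i)))"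
    by (simp add: dpure_Suc vact_snoc) (simp add: snoc_def IH last)
  also have "\<dots> = cp h (\<lambda>x y. \<Sum>p\<in>?S. \<Sum>q<m ?i. (P n p x * b ?i q y) * C (Suc n) (p(?i := q)))"
    by (simp add: sum_product C_Suc mult_ac)
  also have "\<dots> = (\<Sum>p\<in>?S. \<Sum>q<m ?i. cp h (\<lambda>x y. P n p x * b ?i q y) * C (Suc n) (p(?i := q)))"
    by (simp add: sw_sum sw_multc)
  also have "\<dots> = (\<Sum>p\<in>?S. \<Sum>q<m ?i. P (Suc n) (p(?i := q)) h * C (Suc n) (p(?i := q)))"
  proof (intro sum.cong refl)
    fix p q assume "p \<in> ?S" "q \<in> {..<m ?i}"
    then show "cp h (\<lambda>x y. P n p x * b ?i q y) * C (Suc n) (p(?i := q)) =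
        P (Suc n) (p(?i := q)) h * C (Suc n) (p(?i := q))"
      using P_in[of p] b_in[of ?i q] by (simp add: P_Suc dmult_eval dual_iff_lin)
  qed
  also have "\<dots> = (\<Sum>p\<in>Pi\<^sub>E {1..Suc n} (\<lambda>i. {..<m i}). P (Suc n) p h * C (Suc n) p)"
    by (rule sum_PiE_Suc[symmetric])
  finally show ?case by (simp only: P_def C_def b_def)
qed

lemma vertex_action_vact:
  assumes \<tau>: "\<And>i. i \<in> {1..n} \<Longrightarrow> \<tau> i \<in> {0, 1}"
  shows "vertex_action H n \<tau> (vact n)"
  unfolding vertex_action_def Let_def
proof (intro conjI allI ballI impI)
  fix \<alpha> m a h
  assume "\<forall>i\<in>{1..n}. \<alpha> i \<in> dual H \<and> sweedler H (\<alpha> i) (m i) (a i)"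
  then show "vact n (dpure n \<alpha>) h =
           (\<lambda>k. \<Sum>p\<in>Pi\<^sub>E {1..n} (\<lambda>i. {..<m i}).
              foldr (dmult H)
                (map (\<lambda>i. (dantipode H ^^ \<tau> i) (a i (p i) (1 + \<tau> i))) [1..<n+1]) (counit H) h *
              dpure n (\<lambda>i. a i (p i) (2 - \<tau> i)) k)"
    using \<tau> by (intro ext vact_dpure) auto
next
  show "vact n A h \<in> dual_tensor_power H n" if "A \<in> dual_tensor_power H n" for A h
    using that by (rule V.act_in)
  show "vact n (\<lambda>k. c * A k + B k) h = (\<lambda>k. c * vact n A h k + vact n B h k)" for c h A B
    by (rule flinD[OF flin_vact])
  show "vact n A (scl H c g + h) = (\<lambda>k. c * vact n A g k + vact n A h k)"
    if "A \<in> dual_tensor_power H n" for c g h A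
    using linD[OF V.lin_act[OF that]] by (simp add: fun_eq_iff)
qed

lemma vertex_action_unique:
  assumes dact: "vertex_action H n \<tau> dact" and \<tau>: "\<And>i. i \<in> {1..n} \<Longrightarrow> \<tau> i \<in> {0, 1}"
    and A: "A \<in> dual_tensor_power H n"
  shows "dact A h = vact n A h"
  using A
proof (induction rule: dual_tensor_power_induct)
  case (pure \<alpha>)
  define m where "m i = (SOME m. \<exists>a. sweedler H (\<alpha> i) m a)" for i
  define a where "a i = (SOME a. sweedler H (\<alpha> i) (m i) a)" for i
  have ma: "sweedler H (\<alpha> i) (m i) (a i)" if "i \<in> {1..n}" for i
    unfolding a_def m_def using sweedler_exists[OF pure[OF that]] by (metis (mono_tags, lifting) someI_ex)
  then have "\<forall>i\<in>{1..n}. \<alpha> i \<in> dual H \<and> sweedler H (\<alpha> i) (m i) (a i)"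
    using pure by blast
  then have formula: "dact' (dpure n \<alpha>) h =
           (\<lambda>k. \<Sum>p\<in>Pi\<^sub>E {1..n} (\<lambda>i. {..<m i}).
              foldr (dmult H)
                (map (\<lambda>i. (dantipode H ^^ \<tau> i) (a i (p i) (1 + \<tau> i))) [1..<n+1]) (counit H) h *
              dpure n (\<lambda>i. a i (p i) (2 - \<tau> i)) k)" if "vertex_action H n \<tau> dact'" for dact'
    using that unfolding vertex_action_def Let_def by blast
  have "vertex_action H n \<tau> (vact n)"
    by (rule vertex_action_vact) (fact \<tau>)
  from formula[OF dact] formula[OF this] show ?case
    by simp
next
  case (lincomb c A B)
  then show ?case
    using dact by (simp add: vertex_action_def Let_def flinD[OF flin_vact])
qed

end


section \<open>The dual action on connections\<close>

text \<open>
  Finite combinations of evaluations. An element of \<open>K\<^sup>\<otimes>\<^sup>n\<close> is such a functional restricted to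
  \<open>n\<close>-linear forms.
\<close>

definition evaluations :: "(('a \<Rightarrow> 'f::field) \<Rightarrow> 'f) set" where
  "evaluations = {F. \<exists>(m::nat) c y. F = (\<lambda>\<Phi>. \<Sum>p<m. c p * \<Phi> (y p))}"

lemma lincomb_closed_evaluations: "lincomb_closed evaluations"
  using lincomb_closed_finite_sums[of "\<lambda>_. True" "\<lambda>y \<Phi>. \<Phi> y"] by (simp add: evaluations_def)

lemma evaluation_in: "(\<lambda>\<Phi>. \<Phi> y) \<in> evaluations"
  unfolding evaluations_def
  by (rule CollectI, rule exI[of _ 1], rule exI[of _ "\<lambda>_. 1"], rule exI[of _ "\<lambda>_. y"]) simp

lemma evaluations_linear:
  "F \<in> evaluations \<Longrightarrow> F (\<lambda>k. c * \<Phi> k + \<Psi> k) = c * F \<Phi> + F \<Psi>"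
  by (auto simp: evaluations_def sum.distrib sum_distrib_left algebra_simps)

lemma tensor_power_iff: "x \<in> tensor_power H n \<longleftrightarrow> (\<exists>F\<in>evaluations. x = restrict F (mforms H n))"
proof -
  have "(\<lambda>\<Phi>\<in>mforms H n. \<Sum>p<(m::nat). c p * pure H n (k p) \<Phi>) =
      restrict (\<lambda>\<Phi>. \<Sum>p<m. c p * \<Phi> (k p)) (mforms H n)" for m c k
    by (auto simp: pure_def restrict_def fun_eq_iff)
  then show ?thesis
    unfolding tensor_power_def evaluations_def by auto
qed

context vertex_data
begin

lemma vact_evaluations:
  "(\<And>k. (\<lambda>\<Phi>. G \<Phi> k) \<in> evaluations) \<Longrightarrow> (\<lambda>\<Phi>. vact n (G \<Phi>) h k) \<in> evaluations"
proof (induction n arbitrary: G h)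
  case 0
  then show ?case
    by (simp add: lincomb_closed_scale[OF lincomb_closed_evaluations])
next
  case (Suc n)
  show ?case
    unfolding vact.simps(2)
    by (rule lincomb_closed_sw[OF lincomb_closed_evaluations], rule Suc.IH, rule Suc.prems)
qed

lemma evaluations_vact:
  assumes F: "F \<in> evaluations"
  shows "(\<lambda>\<Phi>. F (vact n \<Phi> h)) \<in> evaluations"
proof -
  obtain m :: nat and c y where F_eq: "F = (\<lambda>\<Phi>. \<Sum>p<m. c p * \<Phi> (y p))"
    using F by (auto simp: evaluations_def)
  show ?thesis
    unfolding F_eq
    by (intro lincomb_closed_sum lincomb_closed_scale lincomb_closed_evaluations vact_evaluations evaluation_in)
qed

text \<open>
  The transpose of \<open>vact\<close>. It maps \<open>K\<^sup>\<otimes>\<^sup>n\<close> to itself because \<open>\<Phi> \<lhd> h\<close> at a point is a finite combination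
  of values of \<open>\<Phi>\<close>.
\<close>

definition tact :: "nat \<Rightarrow> 'k \<Rightarrow> ('f, 'k) tens \<Rightarrow> ('f, 'k) tens" where
  "tact n h x = (\<lambda>\<Phi>\<in>mforms H n. x (vact n \<Phi> h))"

lemma vact_mforms: "\<Phi> \<in> mforms H n \<Longrightarrow> vact n \<Phi> h \<in> mforms H n"
  using V.act_in by (simp add: dual_tensor_power_eq_mforms)

lemma tens_left_module_tact: "tens_left_module H n (tact n)"
  unfolding tens_left_module_def Let_def
proof (intro conjI allI ballI)
  fix h x assume "x \<in> tensor_power H n"
  then obtain F where F: "F \<in> evaluations" "x = restrict F (mforms H n)"
    by (auto simp: tensor_power_iff)
  then have "tact n h x = restrict (\<lambda>\<Phi>. F (vact n \<Phi> h)) (mforms H n)"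
    by (auto simp: tact_def fun_eq_iff restrict_def vact_mforms)
  then show "tact n h x \<in> tensor_power H n"
    using evaluations_vact[OF F(1)] by (auto simp: tensor_power_iff)
next
  show "tact n h (\<lambda>\<Phi>\<in>mforms H n. c * x \<Phi> + y \<Phi>) =
      (\<lambda>\<Phi>\<in>mforms H n. c * tact n h x \<Phi> + tact n h y \<Phi>)" for c h x y
    by (auto simp: tact_def fun_eq_iff restrict_def vact_mforms)
next
  fix c g h x assume "x \<in> tensor_power H n"
  then obtain F where F: "F \<in> evaluations" "x = restrict F (mforms H n)"
    by (auto simp: tensor_power_iff)
  have "vact n \<Phi> (scl H c g + h) = (\<lambda>k. c * vact n \<Phi> g k + vact n \<Phi> h k)" if "\<Phi> \<in> mforms H n" for \<Phi>
    using linD[OF V.lin_act[of \<Phi> n]] that by (simp add: fun_eq_iff dual_tensor_power_eq_mforms)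
  then have "x (vact n \<Phi> (scl H c g + h)) = c * x (vact n \<Phi> g) + x (vact n \<Phi> h)" if "\<Phi> \<in> mforms H n" for \<Phi>
    using that vact_mforms[OF that, of "scl H c g + h"]
    by (simp add: F(2) evaluations_linear[OF F(1)] vact_mforms)
  then show "tact n (scl H c g + h) x = (\<lambda>\<Phi>\<in>mforms H n. c * tact n g x \<Phi> + tact n h x \<Phi>)"
    by (auto simp: tact_def fun_eq_iff restrict_def)
next
  have "vact n \<Phi> (g * h) = vact n (vact n \<Phi> g) h" if "\<Phi> \<in> mforms H n" for \<Phi> g h
    using that by (simp add: V.act_act dual_tensor_power_eq_mforms)
  then show "tact n (g * h) x = tact n g (tact n h x)" for g h x
    by (auto simp: tact_def restrict_def vact_mforms intro!: ext)
next
  fix x assume "x \<in> tensor_power H n"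
  then obtain F where "x = restrict F (mforms H n)"
    by (auto simp: tensor_power_iff)
  moreover have "vact n \<Phi> 1 = \<Phi>" if "\<Phi> \<in> mforms H n" for \<Phi>
    using that by (simp add: V.act_one dual_tensor_power_eq_mforms)
  ultimately show "tact n 1 x = x"
    by (auto simp: tact_def restrict_def intro!: ext)
qed

lemma proj_tact_place1:
  assumes i: "i \<in> {1..n}"
  shows "proj H n i (tact n h (place1 H n i k)) = translate (\<tau> i) h k"
proof -
  let ?k = "(\<lambda>_. 1)(i := k)" and ?x = "tact n h (place1 H n i k)"
  have val: "?x (\<lambda>l. \<alpha> (scl H (\<Prod>j\<in>{1..n} - {i}. counit H (l j)) (l i))) = \<alpha> (translate (\<tau> i) h k)"
    if \<alpha>: "\<alpha> \<in> dual H" for \<alpha>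
  proof -
    have form: "(\<lambda>l. \<alpha> (scl H (\<Prod>j\<in>{1..n} - {i}. counit H (l j)) (l i))) = dplace1 H n i \<alpha>"
      using \<alpha> by (simp add: fun_eq_iff dplace1_eval[OF i] lin_scl dual_iff_lin mult.commute)
    have "?x (dplace1 H n i \<alpha>) = dplace1 H n i (end_act (\<tau> i) \<alpha> h) ?k"
      using dplace1_in[OF \<alpha>, of n i] dplace1_in[OF E.act_in[OF \<alpha>], of n i "\<tau> i" h]
      by (simp add: tact_def place1_def pure_def dual_tensor_power_eq_mforms vact_dplace1[OF \<alpha> i])
    also have "\<dots> = end_act (\<tau> i) \<alpha> h k"
      by (simp add: dplace1_eval[OF i] counit_one)
    finally show ?thesis
      by (simp add: form end_act_def)
  qed
  show ?thesis
    unfolding proj_def lift_def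
  proof (rule the_equality)
    show "\<forall>\<alpha>\<in>dual H. \<alpha> (translate (\<tau> i) h k) =
        ?x (\<lambda>l. \<alpha> (scl H (\<Prod>j\<in>{1..n} - {i}. counit H (l j)) (l i)))"
      by (simp add: val)
    show "z = translate (\<tau> i) h k"
      if "\<forall>\<alpha>\<in>dual H. \<alpha> z = ?x (\<lambda>l. \<alpha> (scl H (\<Prod>j\<in>{1..n} - {i}. counit H (l j)) (l i)))" for z
      using that by (intro lin_separates) (simp add: val dual_iff_lin[symmetric])
  qed
qed

lemma dplace2_sw:
  assumes "\<And>a b. F a b \<in> dual_tensor_power H 2"
  shows "(\<lambda>k. sw x (\<lambda>a b. dplace2 H n i j (F a b) k)) \<in> dplace2 H n i j ` dual_tensor_power H 2"
proof (rule image_eqI)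
  show "(\<lambda>k. sw x (\<lambda>a b. F a b k)) \<in> dual_tensor_power H 2"
    by (rule lincomb_closed_sw[OF lincomb_closed_dual_tensor_power assms])
  show "(\<lambda>k. sw x (\<lambda>a b. dplace2 H n i j (F a b) k)) = dplace2 H n i j (\<lambda>k. sw x (\<lambda>a b. F a b k))"
    by (simp add: dplace2_def sw_multc)
qed

section \<open>The gauge theory on the vertex neighbourhood\<close>

lemma vertex_gauge_theory_vmul_vact:
  assumes ends: "numbered_ends G ord v n ed"
    and \<tau>: "\<And>i. i \<in> {1..n} \<Longrightarrow> \<tau> i = end_sign (ed i)"
  shows "vertex_gauge_theory H G v n ed (vmul n) (tact n) (vact n)"
  unfolding vertex_gauge_theory_def Let_def
proof (intro conjI allI ballI impI)
  show "bij_betw ed {1..n} (arcs (vertex_nbhd G v))"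
    using ends by (simp add: numbered_ends_def vertex_nbhd_def)
  show "dtens_algebra H n (vmul n)" "tens_left_module H n (tact n)"
    by (rule dtens_algebra_vmul tens_left_module_tact)+
next
  fix i \<alpha> \<beta> assume "i \<in> {1..n}" "\<alpha> \<in> dual H" "\<beta> \<in> dual H"
  then show "vmul n (dplace1 H n i \<alpha>) (dplace1 H n i \<beta>) \<in> dplace1 H n i ` dual H"
    by (simp add: vmul_same_end E.mul_in)
next
  fix i j \<alpha> \<beta> assume ij: "i \<in> {1..n}" "j \<in> {1..n}" "i \<noteq> j" and \<alpha>\<beta>: "\<alpha> \<in> dual H" "\<beta> \<in> dual H"
  consider "i < j" | "j < i" using ij(3) by linarith
  then show "vmul n (dplace1 H n i \<alpha>) (dplace1 H n j \<beta>) \<in> dplace2 H n i j ` dual_tensor_power H 2"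
  proof cases
    case 1
    show ?thesis
      unfolding vmul_increasing[OF \<alpha>\<beta> ij(1,2) 1] by (intro imageI dpure_2_in \<alpha>\<beta>)
  next
    case 2
    show ?thesis
      unfolding vmul_decreasing[OF \<alpha>\<beta> ij(1,2) 2] by (intro dplace2_sw dpure_2_in E.act_in \<alpha>\<beta>)
  qed
next
  fix A h x assume A: "A \<in> dual_tensor_power H n"
  show "vact n A h \<in> dual_tensor_power H n"
    using A by (rule V.act_in)
  show "pairing (vact n A h) x = pairing A (tact n h x)"
    using A by (simp add: pairing_def tact_def dual_tensor_power_eq_mforms)
next
  fix A B h assume A: "A \<in> dual_tensor_power H n" and B: "B \<in> dual_tensor_power H n"
  have "bilin (\<lambda>a b. vmul n (vact n A a) (vact n B b) k)" for k
    by (intro bilinI V.ma_lin_intros A B klin_id)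
  then show "vact n (vmul n A B) h = (\<lambda>k. cop H h (\<lambda>p. vmul n (vact n A (p 1)) (vact n B (p 2)) k))"
    by (simp add: V.act_mul[OF A B] cp_eval)
next
  show "vact n (dtens_one H n) h = (\<lambda>k. counit H h * dtens_one H n k)" for h
    by (rule V.one_act)
next
  fix i h k assume i: "i \<in> {1..n}"
  show "proj H n i (tact n h (place1 H n i k)) = h * k"
    if "head (vertex_nbhd G v) (ed i) = Centre v"
    using that i by (simp add: proj_tact_place1 vertex_nbhd_def translate_def \<tau> end_sign_def
        split: edge_end.splits)
  show "proj H n i (tact n h (place1 H n i k)) = k * antipode H h"
    if "tail (vertex_nbhd G v) (ed i) = Centre v"
    using that i by (simp add: proj_tact_place1 vertex_nbhd_def translate_def \<tau> end_sign_def
        split: edge_end.splits)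
qed

end

theorem theorem3p14:
  fixes H :: "('f::field_char_0, 'k::ring_1) hopf"
    and R :: "('f, 'k) tens"
    and G :: "('v, 'e) pre_digraph"
    and ord :: "'v \<Rightarrow> 'e edge_end rel"
    and v :: 'v
    and n :: nat
    and ed :: "nat \<Rightarrow> 'e edge_end"
    and \<sigma> \<tau> :: "nat \<Rightarrow> nat"
  assumes "ribbon_hopf_algebra H R"
    and "ciliated_ribbon_graph G ord"
    and "v \<in> verts G"
    and "numbered_ends G ord v n ed"
    and "\<And>i. i \<in> {1..n} \<Longrightarrow> \<tau> i = end_sign (ed i)"
    and "\<And>i. i \<in> {1..n} \<Longrightarrow> \<sigma> i \<in> {0, 1}"
  shows "\<exists>mul act dact.
    vertex_multiplication H R n \<sigma> \<tau> mul \<and>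
    (\<forall>mul'. vertex_multiplication H R n \<sigma> \<tau> mul' \<longrightarrow>
       (\<forall>A\<in>dual_tensor_power H n. \<forall>B\<in>dual_tensor_power H n. mul' A B = mul A B)) \<and>
    vertex_action H n \<tau> dact \<and>
    (\<forall>dact'. vertex_action H n \<tau> dact' \<longrightarrow>
       (\<forall>A\<in>dual_tensor_power H n. \<forall>h. dact' A h = dact A h)) \<and>
    vertex_gauge_theory H G v n ed mul act dact"
proof -
  interpret fin_dim_hopf_algebra H
    using assms(1) by (simp add: ribbon_hopf_algebra_def)
  interpret vertex_data H R \<sigma> \<tau>
    using assms(1) by unfold_locales (simp add: ribbon_hopf_algebra_def)
  have \<tau>: "\<tau> i \<in> {0, 1}" if "i \<in> {1..n}" for i
    using assms(5)[OF that] by (simp add: end_sign_def split: edge_end.splits)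
  note \<sigma> = assms(6)
  have "vertex_multiplication H R n \<sigma> \<tau> (vmul n)"
    by (rule vertex_multiplication_vmul) (fact \<sigma> \<tau>)+
  moreover have "mul' A B = vmul n A B"
    if "vertex_multiplication H R n \<sigma> \<tau> mul'" "A \<in> dual_tensor_power H n" "B \<in> dual_tensor_power H n"
    for mul' A B
    by (rule vertex_multiplication_unique) (fact that \<sigma> \<tau>)+
  moreover have "vertex_action H n \<tau> (vact n)"
    by (rule vertex_action_vact) (fact \<tau>)
  moreover have "dact' A h = vact n A h"
    if "vertex_action H n \<tau> dact'" "A \<in> dual_tensor_power H n" for dact' A h
    by (rule vertex_action_unique) (fact that \<tau>)+
  moreover have "vertex_gauge_theory H G v n ed (vmul n) (tact n) (vact n)"
    by (rule vertex_gauge_theory_vmul_vact) (fact assms)+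
  ultimately show ?thesis
    by blast
qed

end
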